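(* Let $P$ be a parameterized program without synchronization with thread template $G$, let $I\subseteq\Sigma(G)^2$ be a (not necessarily symmetric) commutativity relation, and let $\mathcal F=(G',(\beta_1,G_{\beta_1}),\dots,(\beta_n,G_{\beta_n}))$ be an atomic fusion of $P$. The following algorithm decides whether $\mathcal F$ is sound with respect to $I$, and terminates in polynomial time. Step 1: Compute the graph $(\Sigma(G),\rightarrowtail)$. Then perform the subsequent steps for each $\beta_k$. Step 2: Compute the strongly connected components (SCCs) of the edges of $G_{\beta_k}$, along with the reachability relation $\preceq$ between SCCs (a partial order). Step 3: For each $a\in\Sigma(G)$ compute $\min(a)$, the set of $\preceq$-minimal SCCs of $G_{\beta_k}$ containing some edge labeled by an action $b\in\Sigma(G_{\beta_k})$ with $(b,a)\notin I$. Step 4: For each $a\in\Sigma(G)$ compute $\max(a)$, the set of $\preceq$-maximal SCCs of $G_{\beta_k}$ containing some edge labeled by an action $b\in\Sigma(G_{\beta_k})$ with $(a,b)\notin I$. Step 5: Check if there exist SCCs $S_1,S_2$ of $G_{\beta_k}$ such that (i) $S_1\preceq S_2$, and if $S_1=S_2$ then $S_1$ is a non-trivial SCC, and (ii) the graph $(\Sigma(G),\rightarrowtail)$ has an edge from some $a$ to some $b$ with $S_1\in\min(a)$ and $S_2\in\max(b)$. Output: if such $S_1,S_2$ exist for some $\beta_k$, then $\mathcal F$ is declared unsound; otherwise $\mathcal F$ is declared sound.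
   Context: Sequences. $X^*$ is the set of finite sequences over $X$. A morphism is a map $\mu:X\to\wp(Y^* )$, extended to $X^*$ by $\mu(\varepsilon)=\{\varepsilon\}$, $\mu(x\sigma)=\mu(x)\mu(\sigma)$ and to languages by union. $\mathsf{Act}$ is a fixed infinite set of actions. $\mathsf{Act}_{\mathsf{idx}}=\mathsf{Act}\times\mathbb N$; its elements are written $\langle a:i\rangle$ (action $a$ executed by thread $i$). $\langle\tau:i\rangle$ is the sequence in which every letter of $\tau$ is indexed by $i$. For $\tau\in\mathsf{Act}_{\mathsf{idx}}^*$, $\lfloor\tau\rfloor_i\in\mathsf{Act}^*$ is the sequence of actions of thread $i$ in $\tau$. For a morphism $\mu$, $\widehat\mu(\langle a:i\rangle)=\{\langle\tau:i\rangle\mid\tau\in\mu(a)\}$. Programs. A control flow graph $G=(\mathbb L,\Delta,\ell_{\mathsf{init}},\ell_{\mathsf{exit}})$ has finitely many locations $\mathbb L$, a finite transition relation $\Delta\subseteq\mathbb L\times\mathsf{Act}\times\mathbb L$, and $\ell_{\mathsf{init}}\ne\ell_{\mathsf{exit}}$. Every location is reachable from $\ell_{\mathsf{init}}$, $\ell_{\mathsf{exit}}$ is reachable from every location, and each $a\in\mathsf{Act}$ labels at most one edge. $\Sigma(G)$ is the set of labels occurring in $G$; $\mathcal T(G)$ is the set of label sequences of paths from $\ell_{\mathsf{init}}$ to $\ell_{\mathsf{exit}}$. A parameterized program $P$ without synchronization (trivial synchronization alphabet) is given by a control flow graph $G$ (the thread template); its interleavings are $\mathcal L(P)=\{\tau\in\mathsf{Act}_{\mathsf{idx}}^*\mid\forall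 i\in\mathbb N.\ \lfloor\tau\rfloor_i\in\mathcal T(G)\cup\{\varepsilon\}\}$. Reductions. $\sqsubseteq_I$ is the smallest reflexive-transitive relation on $\mathsf{Act}_{\mathsf{idx}}^*$ with $\rho\langle a:i\rangle\langle b:j\rangle\sigma\sqsubseteq_I\rho\langle b:j\rangle\langle a:i\rangle\sigma$ for all $\rho,\sigma$, $(a,b)\in I$, $i\ne j$. $L_1$ is a Mazurkiewicz reduction of $L_2$ (up to $I$) if $L_1\subseteq L_2$ and every $\tau\in L_2$ has some $\tau'\in L_1$ with $\tau\sqsubseteq_I\tau'$. Atomic fusions. An atomic fusion $\mathcal F=(G',(\beta_1,G_{\beta_1}),\dots,(\beta_n,G_{\beta_n}))$ for $P$ consists of a control flow graph $G'$, distinct actions $\beta_1,\dots,\beta_n\in\Sigma(G')$ and control flow graphs $G_{\beta_k}$ with $\Sigma(G_{\beta_k})\subseteq\mathsf{Act}\setminus\{\beta_1,\dots,\beta_n\}$ and $\mathcal T(G_{\beta_k})\ne\emptyset$, such that $G$ is obtained from $G'$ by inserting each $G_{\beta_k}$ in place of the unique edge labeled $\beta_k$. The morphism $\mu_{\mathcal F}$ maps $\beta_k\mapsto\mathcal T(G_{\beta_k})$ and $a\mapsto\{a\}$ for all other $a$; insertion is such that $\mathcal T(G)=\mu_{\mathcal F}(\mathcal T(G'))$. The fused program $P\lhd_{\mathsf{at}}\mathcal F$ is the program with thread template $G'$. $\mathcal F$ is sound w.r.t. $I$ if $\widehat{\mu_{\mathcal F}}(\mathcal L(P\lhd_{\mathsf{at}}\mathcal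 F))$ is a Mazurkiewicz reduction up to $I$ of $\mathcal L(P)$. Relations used by the algorithm. For $a,b\in\Sigma(G)$: $(a,b)\in\mathsf{po}$ (program order) if there is a trace $\rho\iota\sigma\in\mathcal T(G)$ where $\iota$ begins with $a$ and ends with $b$ (possibly $a=\iota=b$); $(a,b)\in\mathsf{at}$ if there is a trace $\rho\,b\,\iota\,a\,\sigma\in\mathcal T(G_{\beta_k})$ for some $k$ (reverse program order within atomic blocks). $I^{\mathsf c}=\Sigma(G)^2\setminus I$. The relation $\rightarrowtail$ on $\Sigma(G)$ is $I^{\mathsf c}\circ\big((\mathsf{po}\cup\mathsf{at})\circ I^{\mathsf c}\big)^+$, where $\circ$ is relational composition read from left to right ($(x,z)\in R\circ S$ iff $(x,y)\in R$ and $(y,z)\in S$ for some $y$) and $R^+$ is the transitive closure of $R$. SCCs of edges. The edges of $G_{\beta_k}$ are regarded as vertices of a graph in which an edge leads to every edge that starts at its target location; SCCs are taken in this graph, and $S_1\preceq S_2$ means that an edge in $S_2$ is reachable from an edge in $S_1$. An SCC is non-trivial if it contains at least two elements, or its single element has a self-loop.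
   Formalization: For non-symmetric I the algorithm as given can wrongly answer "sound". Proved instead: it decides soundness with step 1 using (po ∪ at)∘(I^c∘(po ∪ at))^* in place of ↣; with ↣ as given, it decides soundness for symmetric I, and "unsound" is always right. Both run in polynomial time. *)

theory Defs
  imports
    "HOL-Computational_Algebra.Polynomial"
    "HOL-Library.Monad_Syntax"
begin

section \<open>Control flow graphs\<close>

type_synonym ('l, 'a) edge = "'l \<times> 'a \<times> 'l"

abbreviation src :: "('l, 'a) edge \<Rightarrow> 'l" where "src e \<equiv> fst e"
abbreviation lab :: "('l, 'a) edge \<Rightarrow> 'a" where "lab e \<equiv> fst (snd e)"
abbreviation tgt :: "('l, 'a) edge \<Rightarrow> 'l" where "tgt e \<equiv> snd (snd e)"

record ('l, 'a) cfg =
  locs :: "'l set"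
  edges :: "('l, 'a) edge set"
  init :: 'l
  exit :: 'l

inductive path :: "('l, 'a) cfg \<Rightarrow> 'l \<Rightarrow> 'a list \<Rightarrow> 'l \<Rightarrow> bool" for G where
  path_Nil: "path G l [] l"
| path_Cons: "(l, a, m) \<in> edges G \<Longrightarrow> path G m w n \<Longrightarrow> path G l (a # w) n"

definition is_cfg :: "('l, 'a) cfg \<Rightarrow> bool" where
  "is_cfg G \<longleftrightarrow>
     finite (locs G) \<and> finite (edges G) \<and>
     edges G \<subseteq> locs G \<times> UNIV \<times> locs G \<and>
     init G \<in> locs G \<and> exit G \<in> locs G \<and> init G \<noteq> exit G \<and>
     (\<forall>l\<in>locs G. \<exists>w. path G (init G) w l) \<and>
     (\<forall>l\<in>locs G. \<exists>w. path G l w (exit G)) \<and>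
     (\<forall>e\<in>edges G. \<forall>f\<in>edges G. lab e = lab f \<longrightarrow> e = f)"

definition labels :: "('l, 'a) cfg \<Rightarrow> 'a set" where
  "labels G = (\<lambda>e. lab e) ` edges G"

definition traces :: "('l, 'a) cfg \<Rightarrow> 'a list set" where
  "traces G = {w. path G (init G) w (exit G)}"


section \<open>Sequences, morphisms and interleavings\<close>

text \<open>The indexed action \<open>\<langle>a:i\<rangle>\<close> is the pair \<open>(a, i)\<close>.\<close>

definition index :: "nat \<Rightarrow> 'a list \<Rightarrow> ('a \<times> nat) list" where
  "index i w = map (\<lambda>a. (a, i)) w"

definition proj :: "nat \<Rightarrow> ('a \<times> nat) list \<Rightarrow> 'a list" where
  "proj i w = map fst (filter (\<lambda>x. snd x = i) w)"

primrec morph_word :: "('x \<Rightarrow> 'y list set) \<Rightarrow> 'x list \<Rightarrow> 'y list set" where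
  "morph_word \<mu> [] = {[]}"
| "morph_word \<mu> (x # w) = {u @ v | u v. u \<in> \<mu> x \<and> v \<in> morph_word \<mu> w}"

definition morph_lang :: "('x \<Rightarrow> 'y list set) \<Rightarrow> 'x list set \<Rightarrow> 'y list set" where
  "morph_lang \<mu> L = (\<Union>w\<in>L. morph_word \<mu> w)"

definition indexed_morph ::
    "('a \<Rightarrow> 'b list set) \<Rightarrow> 'a \<times> nat \<Rightarrow> ('b \<times> nat) list set" where
  "indexed_morph \<mu> x = index (snd x) ` \<mu> (fst x)"

text \<open>A parameterized program without synchronization is determined by its thread template;
  the following is its set of interleavings.\<close>

definition interleavings :: "('l, 'a) cfg \<Rightarrow> ('a \<times> nat) list set" where
  "interleavings G = {w. \<forall>i. proj i w \<in> traces G \<union> {[]}}"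


section \<open>Mazurkiewicz reductions\<close>

inductive swap :: "('a \<times> 'a) set \<Rightarrow> ('a \<times> nat) list \<Rightarrow> ('a \<times> nat) list \<Rightarrow> bool" for I where
  "(a, b) \<in> I \<Longrightarrow> i \<noteq> j \<Longrightarrow>
     swap I (r @ [(a, i), (b, j)] @ s) (r @ [(b, j), (a, i)] @ s)"

definition reorder_le ::
    "('a \<times> 'a) set \<Rightarrow> ('a \<times> nat) list \<Rightarrow> ('a \<times> nat) list \<Rightarrow> bool" where
  "reorder_le I = (swap I)\<^sup>*\<^sup>*"

definition mazurkiewicz_reduction ::
    "('a \<times> 'a) set \<Rightarrow> ('a \<times> nat) list set \<Rightarrow> ('a \<times> nat) list set \<Rightarrow> bool" where
  "mazurkiewicz_reduction I L1 L2 \<longleftrightarrow>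
     L1 \<subseteq> L2 \<and> (\<forall>w\<in>L2. \<exists>w'\<in>L1. reorder_le I w w')"


section \<open>Atomic fusions\<close>

record ('l, 'a) fusion =
  fused_cfg :: "('l, 'a) cfg"
  blocks :: "('a \<times> ('l, 'a) cfg) list"

definition block_actions :: "('l, 'a) fusion \<Rightarrow> 'a set" where
  "block_actions F = fst ` set (blocks F)"

definition fusion_morph :: "('l, 'a) fusion \<Rightarrow> 'a \<Rightarrow> 'a list set" where
  "fusion_morph F a =
     (case map_of (blocks F) a of None \<Rightarrow> {[a]} | Some H \<Rightarrow> traces H)"

definition inner_locs :: "('l, 'a) cfg \<Rightarrow> 'l set" where
  "inner_locs H = locs H - {init H, exit H}"

definition rename_edges :: "('l \<Rightarrow> 'l) \<Rightarrow> ('l, 'a) edge set \<Rightarrow> ('l, 'a) edge set" where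
  "rename_edges h E = (\<lambda>(l, a, m). (h l, a, h m)) ` E"

text \<open>\<open>G\<close> arises from the fused graph by replacing, for every \<open>k\<close>, the edge labelled
  \<open>\<beta>\<^sub>k\<close> by a copy of the \<open>k\<close>-th block graph, whose initial and exit locations are glued to the
  source and the target of that edge. Locations are only considered up to the renamings \<open>h\<close> (of
  the fused graph) and \<open>g k\<close> (of the blocks). The remaining edges and the edges of the different
  blocks are different edges of \<open>G\<close>; as an action labels at most one edge of \<open>G\<close>, this is
  expressed by the disjointness of their labels.\<close>

definition inserted :: "('l, 'a) cfg \<Rightarrow> ('l, 'a) fusion \<Rightarrow> bool" where
  "inserted G F \<longleftrightarrow>
    (let G' = fused_cfg F; n = length (blocks F);
         \<beta> = (\<lambda>k. fst (blocks F ! k)); H = (\<lambda>k. snd (blocks F ! k));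
         kept = {e \<in> edges G'. lab e \<notin> block_actions F}
     in \<exists>(h :: 'l \<Rightarrow> 'l) (g :: nat \<Rightarrow> 'l \<Rightarrow> 'l).
       inj_on h (locs G') \<and> h (init G') = init G \<and> h (exit G') = exit G \<and>
       (\<forall>k<n. inj_on (g k) (inner_locs (H k)) \<and> g k ` inner_locs (H k) \<inter> h ` locs G' = {}) \<and>
       (\<forall>j<n. \<forall>k<n. j \<noteq> k \<longrightarrow> g j ` inner_locs (H j) \<inter> g k ` inner_locs (H k) = {}) \<and>
       (\<forall>k<n. \<forall>e\<in>edges G'. lab e = \<beta> k \<longrightarrow>
          g k (init (H k)) = h (src e) \<and> g k (exit (H k)) = h (tgt e)) \<and>
       locs G = h ` locs G' \<union> (\<Union>k<n. g k ` locs (H k)) \<and>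
       edges G = rename_edges h kept \<union> (\<Union>k<n. rename_edges (g k) (edges (H k))) \<and>
       (\<forall>k<n. labels (H k) \<inter> (\<lambda>e. lab e) ` kept = {}) \<and>
       (\<forall>j<n. \<forall>k<n. j \<noteq> k \<longrightarrow> labels (H j) \<inter> labels (H k) = {}))"

definition atomic_fusion :: "('l, 'a) fusion \<Rightarrow> ('l, 'a) cfg \<Rightarrow> bool" where
  "atomic_fusion F G \<longleftrightarrow>
     is_cfg (fused_cfg F) \<and>
     distinct (map fst (blocks F)) \<and>
     block_actions F \<subseteq> labels (fused_cfg F) \<and>
     (\<forall>(\<beta>, H) \<in> set (blocks F).
        is_cfg H \<and> labels H \<inter> block_actions F = {} \<and> traces H \<noteq> {}) \<and>
     inserted G F \<and>
     traces G = morph_lang (fusion_morph F) (traces (fused_cfg F))"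

text \<open>The last conjunct is not implied by \<open>inserted\<close>: if, say, a block can return to its
  initial location, gluing may create additional traces. Such insertions are excluded.\<close>

definition sound_fusion :: "('l, 'a) cfg \<Rightarrow> ('a \<times> 'a) set \<Rightarrow> ('l, 'a) fusion \<Rightarrow> bool" where
  "sound_fusion G I F \<longleftrightarrow>
     mazurkiewicz_reduction I
       (morph_lang (indexed_morph (fusion_morph F)) (interleavings (fused_cfg F)))
       (interleavings G)"


section \<open>The objects computed by the algorithm\<close>

definition po :: "('l, 'a) cfg \<Rightarrow> ('a \<times> 'a) set" where
  "po G = {(a, b). \<exists>r u s. r @ u @ s \<in> traces G \<and> u \<noteq> [] \<and> hd u = a \<and> last u = b}"

definition atomic_rel :: "('l, 'a) fusion \<Rightarrow> ('a \<times> 'a) set" where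
  "atomic_rel F =
     {(a, b). \<exists>(\<beta>, H) \<in> set (blocks F). \<exists>r u s. r @ [b] @ u @ [a] @ s \<in> traces H}"

definition dependence :: "('l, 'a) cfg \<Rightarrow> ('a \<times> 'a) set \<Rightarrow> ('a \<times> 'a) set" where
  "dependence G I = labels G \<times> labels G - I"

definition arrow :: "('l, 'a) cfg \<Rightarrow> ('a \<times> 'a) set \<Rightarrow> ('l, 'a) fusion \<Rightarrow> ('a \<times> 'a) set" where
  "arrow G I F =
     dependence G I O ((po G \<union> atomic_rel F) O dependence G I)\<^sup>+"

text \<open>The relation \<open>arrow\<close> begins and ends with a dependence, and so do the conditions on
  \<open>min\<close> and \<open>max\<close> in the last step. The chains counted in that step are therefore those of the
  following relation: both dependences at the ends of \<open>arrow\<close> are stripped off.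
  The difference matters only if the commutativity relation is not symmetric. For example, let the
  thread template have the traces \<open>b\<^sub>1 b\<^sub>2\<close> (one atomic block) and \<open>a a'\<close>, and let \<open>(b\<^sub>1, a)\<close> and
  \<open>(a', b\<^sub>2)\<close> be the only pairs that do not commute. Then the fusion is unsound. The only action
  with a nonempty \<open>min_sccs\<close> is \<open>a\<close>; it has no successor under \<open>arrow\<close>, but \<open>(a, a')\<close> is in
  \<open>inner_arrow\<close>.\<close>

definition inner_arrow ::
    "('l, 'a) cfg \<Rightarrow> ('a \<times> 'a) set \<Rightarrow> ('l, 'a) fusion \<Rightarrow> ('a \<times> 'a) set" where
  "inner_arrow G I F =
     (po G \<union> atomic_rel F) O (dependence G I O (po G \<union> atomic_rel F))\<^sup>*"

lemma arrow_eq: "arrow G I F = dependence G I O inner_arrow G I F O dependence G I"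
proof -
  have *: "(R O D)\<^sup>+ = R O (D O R)\<^sup>* O D" for R D :: "('a \<times> 'a) set"
  proof (intro equalityI subrelI)
    fix x y assume "(x, y) \<in> (R O D)\<^sup>+"
    then show "(x, y) \<in> R O (D O R)\<^sup>* O D"
    proof (induction rule: trancl_induct)
      case (base y)
      then show ?case by blast
    next
      case (step y z)
      then obtain u v w where "(x, u) \<in> R" "(u, v) \<in> (D O R)\<^sup>*" "(v, y) \<in> D" "(y, w) \<in> R" "(w, z) \<in> D"
        by blast
      then have "(u, w) \<in> (D O R)\<^sup>*" by (meson relcomp.relcompI rtrancl.rtrancl_into_rtrancl)
      with \<open>(x, u) \<in> R\<close> \<open>(w, z) \<in> D\<close> show ?case by blast
    qed
  next
    fix x y assume "(x, y) \<in> R O (D O R)\<^sup>* O D"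
    then obtain u v where xu: "(x, u) \<in> R" and uv: "(u, v) \<in> (D O R)\<^sup>*" and vy: "(v, y) \<in> D"
      by blast
    from uv vy show "(x, y) \<in> (R O D)\<^sup>+"
    proof (induction arbitrary: y rule: rtrancl_induct)
      case base
      then show ?case using xu by blast
    next
      case (step v w)
      then obtain t where "(v, t) \<in> D" "(t, w) \<in> R" by blast
      then have "(x, t) \<in> (R O D)\<^sup>+" "(t, y) \<in> R O D" using step by blast+
      then show ?case by (rule trancl_into_trancl)
    qed
  qed
  show ?thesis by (simp only: arrow_def inner_arrow_def * O_assoc)
qed

definition edge_succ :: "('l, 'a) cfg \<Rightarrow> (('l, 'a) edge \<times> ('l, 'a) edge) set" where
  "edge_succ H = {(e, f). e \<in> edges H \<and> f \<in> edges H \<and> tgt e = src f}"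

definition sccs :: "('l, 'a) cfg \<Rightarrow> ('l, 'a) edge set set" where
  "sccs H =
     (\<lambda>e. {f \<in> edges H. (e, f) \<in> (edge_succ H)\<^sup>* \<and> (f, e) \<in> (edge_succ H)\<^sup>*}) ` edges H"

definition scc_le :: "('l, 'a) cfg \<Rightarrow> ('l, 'a) edge set \<Rightarrow> ('l, 'a) edge set \<Rightarrow> bool" where
  "scc_le H S T \<longleftrightarrow> (\<exists>e\<in>S. \<exists>f\<in>T. (e, f) \<in> (edge_succ H)\<^sup>*)"

definition nontrivial_scc :: "('l, 'a) cfg \<Rightarrow> ('l, 'a) edge set \<Rightarrow> bool" where
  "nontrivial_scc H S \<longleftrightarrow> card S \<ge> 2 \<or> (\<exists>e. S = {e} \<and> (e, e) \<in> edge_succ H)"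

definition min_sccs ::
    "('l, 'a) cfg \<Rightarrow> ('a \<times> 'a) set \<Rightarrow> 'a \<Rightarrow> ('l, 'a) edge set set" where
  "min_sccs H I a =
     (let M = {S \<in> sccs H. \<exists>e\<in>S. (lab e, a) \<notin> I}
      in {S \<in> M. \<forall>T\<in>M. scc_le H T S \<longrightarrow> T = S})"

definition max_sccs ::
    "('l, 'a) cfg \<Rightarrow> ('a \<times> 'a) set \<Rightarrow> 'a \<Rightarrow> ('l, 'a) edge set set" where
  "max_sccs H I a =
     (let M = {S \<in> sccs H. \<exists>e\<in>S. (a, lab e) \<notin> I}
      in {S \<in> M. \<forall>T\<in>M. scc_le H S T \<longrightarrow> T = S})"

text \<open>The abstract outcome of the five steps, where \<open>A\<close> is the edge relation of the graph of
  step 1; the executable version follows below.\<close>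

definition declared_unsound ::
    "('a \<times> 'a) set \<Rightarrow> ('a \<times> 'a) set \<Rightarrow> ('l, 'a) fusion \<Rightarrow> bool" where
  "declared_unsound A I F \<longleftrightarrow>
     (\<exists>(\<beta>, H) \<in> set (blocks F). \<exists>S1 \<in> sccs H. \<exists>S2 \<in> sccs H.
        scc_le H S1 S2 \<and> (S1 = S2 \<longrightarrow> nontrivial_scc H S1) \<and>
        (\<exists>(a, b) \<in> A. S1 \<in> min_sccs H I a \<and> S2 \<in> max_sccs H I b))"


section \<open>Step-counting computations\<close>

text \<open>A computation yields a value and its number of steps. Steps are charged by \<open>tick\<close> only.
  One step is charged for every list cell (or list end) that a traversal visits, and for every
  comparison of two items; the items compared with \<open>eq_t\<close> are always locations, actions, or tuples
  of at most six of these. Apart from \<open>eq_t\<close> and the list traversals, the algorithm uses only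
  constructors, projections and Boolean connectives.\<close>

datatype 'x timed = Timed (val: 'x) (steps: nat)

definition ret :: "'x \<Rightarrow> 'x timed" where
  "ret x = Timed x 0"

definition tick :: "unit timed" where
  "tick = Timed () 1"

definition bind_timed :: "'x timed \<Rightarrow> ('x \<Rightarrow> 'y timed) \<Rightarrow> 'y timed" where
  "bind_timed m f = (case m of Timed x s \<Rightarrow> case f x of Timed y t \<Rightarrow> Timed y (s + t))"

adhoc_overloading Monad_Syntax.bind \<rightleftharpoons> bind_timed

definition eq_t :: "'x \<Rightarrow> 'x \<Rightarrow> bool timed" where
  "eq_t x y = do { tick; ret (x = y) }"

primrec any_t :: "('x \<Rightarrow> bool timed) \<Rightarrow> 'x list \<Rightarrow> bool timed" where
  "any_t p [] = do { tick; ret False }"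
| "any_t p (x # xs) = do { tick; b \<leftarrow> p x; if b then ret True else any_t p xs }"

primrec filter_t :: "('x \<Rightarrow> bool timed) \<Rightarrow> 'x list \<Rightarrow> 'x list timed" where
  "filter_t p [] = do { tick; ret [] }"
| "filter_t p (x # xs) =
     do { tick; b \<leftarrow> p x; ys \<leftarrow> filter_t p xs; ret (if b then x # ys else ys) }"

primrec map_t :: "('x \<Rightarrow> 'y timed) \<Rightarrow> 'x list \<Rightarrow> 'y list timed" where
  "map_t f [] = do { tick; ret [] }"
| "map_t f (x # xs) = do { tick; y \<leftarrow> f x; ys \<leftarrow> map_t f xs; ret (y # ys) }"

primrec append_t :: "'x list \<Rightarrow> 'x list \<Rightarrow> 'x list timed" where
  "append_t [] ys = do { tick; ret ys }"
| "append_t (x # xs) ys = do { tick; zs \<leftarrow> append_t xs ys; ret (x # zs) }"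

primrec concat_map_t :: "('x \<Rightarrow> 'y list timed) \<Rightarrow> 'x list \<Rightarrow> 'y list timed" where
  "concat_map_t f [] = do { tick; ret [] }"
| "concat_map_t f (x # xs) =
     do { tick; ys \<leftarrow> f x; zs \<leftarrow> concat_map_t f xs; append_t ys zs }"

definition mem_t :: "'x \<Rightarrow> 'x list \<Rightarrow> bool timed" where
  "mem_t x xs = any_t (eq_t x) xs"

primrec remdups_t :: "'x list \<Rightarrow> 'x list timed" where
  "remdups_t [] = do { tick; ret [] }"
| "remdups_t (x # xs) =
     do { tick; b \<leftarrow> mem_t x xs; ys \<leftarrow> remdups_t xs; ret (if b then ys else x # ys) }"

text \<open>Finite relations are represented by lists of pairs.\<close>

definition product_t :: "'x list \<Rightarrow> 'y list \<Rightarrow> ('x \<times> 'y) list timed" where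
  "product_t xs ys = concat_map_t (\<lambda>x. map_t (\<lambda>y. ret (x, y)) ys) xs"

definition union_t :: "'x list \<Rightarrow> 'x list \<Rightarrow> 'x list timed" where
  "union_t xs ys = do { zs \<leftarrow> append_t xs ys; remdups_t zs }"

definition comp_t :: "('x \<times> 'y) list \<Rightarrow> ('y \<times> 'z) list \<Rightarrow> ('x \<times> 'z) list timed" where
  "comp_t R Q =
     do { T \<leftarrow> concat_map_t
            (\<lambda>p. do { Q' \<leftarrow> filter_t (\<lambda>q. eq_t (snd p) (fst q)) Q;
                       map_t (\<lambda>q. ret (fst p, snd q)) Q' }) R;
          remdups_t T }"

text \<open>The second argument only bounds the number of iterations; one iteration per pair of the
  relation suffices to reach its transitive closure.\<close>

primrec trancl_iter_t :: "('x \<times> 'x) list \<Rightarrow> 'y list \<Rightarrow> ('x \<times> 'x) list timed" where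
  "trancl_iter_t R [] = do { tick; ret R }"
| "trancl_iter_t R (x # xs) =
     do { tick; Q \<leftarrow> trancl_iter_t R xs; Q' \<leftarrow> comp_t Q R; union_t Q Q' }"

definition trancl_t :: "('x \<times> 'x) list \<Rightarrow> ('x \<times> 'x) list timed" where
  "trancl_t R = trancl_iter_t R R"


section \<open>The algorithm\<close>

text \<open>The input consists of lists that enumerate the sets in question, in any order and possibly
  with repetitions.\<close>

record ('l, 'a) cfg_rep =
  loc_list :: "'l list"
  edge_list :: "('l, 'a) edge list"
  init_loc :: 'l
  exit_loc :: 'l

record ('l, 'a) fusion_rep =
  fused_rep :: "('l, 'a) cfg_rep"
  block_reps :: "('a \<times> ('l, 'a) cfg_rep) list"

definition cfg_of :: "('l, 'a) cfg_rep \<Rightarrow> ('l, 'a) cfg" where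
  "cfg_of g = \<lparr>locs = set (loc_list g), edges = set (edge_list g),
               init = init_loc g, exit = exit_loc g\<rparr>"

definition fusion_of :: "('l, 'a) fusion_rep \<Rightarrow> ('l, 'a) fusion" where
  "fusion_of f = \<lparr>fused_cfg = cfg_of (fused_rep f),
                  blocks = map (\<lambda>(\<beta>, h). (\<beta>, cfg_of h)) (block_reps f)\<rparr>"

definition cfg_size :: "('l, 'a) cfg_rep \<Rightarrow> nat" where
  "cfg_size g = length (loc_list g) + length (edge_list g) + 2"

definition input_size ::
    "('l, 'a) cfg_rep \<Rightarrow> ('a \<times> 'a) list \<Rightarrow> ('l, 'a) fusion_rep \<Rightarrow> nat" where
  "input_size g is f =
     cfg_size g + length is + cfg_size (fused_rep f) +
     (\<Sum>(\<beta>, h) \<leftarrow> block_reps f. cfg_size h + 1)"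

text \<open>The pairs of edges \<open>(e, f)\<close> such that \<open>f\<close> is reachable from \<open>e\<close> in at least one step.\<close>

definition reach_t :: "('l, 'a) edge list \<Rightarrow> (('l, 'a) edge \<times> ('l, 'a) edge) list timed" where
  "reach_t es =
     do { ps \<leftarrow> product_t es es;
          qs \<leftarrow> filter_t (\<lambda>(e, f). eq_t (tgt e) (src f)) ps;
          trancl_t qs }"

text \<open>In a control flow graph every path between two edges extends to a path from the initial to
  the exit location, so that program order is reachability of edges.\<close>

definition po_t :: "('l, 'a) edge list \<Rightarrow> ('a \<times> 'a) list timed" where
  "po_t es =
     do { rs \<leftarrow> reach_t es;
          ps \<leftarrow> map_t (\<lambda>(e, f). ret (lab e, lab f)) rs;
          qs \<leftarrow> map_t (\<lambda>e. ret (lab e, lab e)) es;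
          union_t ps qs }"

definition atomic_rel_t :: "('a \<times> ('l, 'a) cfg_rep) list \<Rightarrow> ('a \<times> 'a) list timed" where
  "atomic_rel_t bs =
     concat_map_t
       (\<lambda>(\<beta>, h). do { rs \<leftarrow> reach_t (edge_list h); map_t (\<lambda>(e, f). ret (lab f, lab e)) rs }) bs"

definition labels_t :: "('l, 'a) edge list \<Rightarrow> 'a list timed" where
  "labels_t es = do { ls \<leftarrow> map_t (\<lambda>e. ret (lab e)) es; remdups_t ls }"

definition dependence_t :: "'a list \<Rightarrow> ('a \<times> 'a) list \<Rightarrow> ('a \<times> 'a) list timed" where
  "dependence_t ls is =
     do { ps \<leftarrow> product_t ls ls; filter_t (\<lambda>p. do { b \<leftarrow> mem_t p is; ret (\<not> b) }) ps }"

definition arrow_t ::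
    "('l, 'a) cfg_rep \<Rightarrow> ('a \<times> 'a) list \<Rightarrow> ('l, 'a) fusion_rep \<Rightarrow> ('a \<times> 'a) list timed" where
  "arrow_t g is f =
     do { ls \<leftarrow> labels_t (edge_list g);
          D \<leftarrow> dependence_t ls is;
          P \<leftarrow> po_t (edge_list g);
          A \<leftarrow> atomic_rel_t (block_reps f);
          PA \<leftarrow> union_t P A;
          Q \<leftarrow> comp_t PA D;
          Q' \<leftarrow> trancl_t Q;
          comp_t D Q' }"

definition inner_arrow_t ::
    "('l, 'a) cfg_rep \<Rightarrow> ('a \<times> 'a) list \<Rightarrow> ('l, 'a) fusion_rep \<Rightarrow> ('a \<times> 'a) list timed" where
  "inner_arrow_t g is f =
     do { ls \<leftarrow> labels_t (edge_list g);
          D \<leftarrow> dependence_t ls is;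
          P \<leftarrow> po_t (edge_list g);
          A \<leftarrow> atomic_rel_t (block_reps f);
          PA \<leftarrow> union_t P A;
          Q \<leftarrow> comp_t PA D;
          Q' \<leftarrow> trancl_t Q;
          R \<leftarrow> comp_t Q' PA;
          union_t PA R }"

text \<open>An SCC is represented by the list of its edges. In the following functions, \<open>rs\<close> is the
  reachability relation computed by \<open>reach_t\<close>.\<close>

definition reaches_t ::
    "('l, 'a) edge \<Rightarrow> ('l, 'a) edge \<Rightarrow> (('l, 'a) edge \<times> ('l, 'a) edge) list \<Rightarrow> bool timed" where
  "reaches_t e f rs = do { b \<leftarrow> eq_t e f; if b then ret True else mem_t (e, f) rs }"

definition scc_of_t ::
    "('l, 'a) edge list \<Rightarrow> (('l, 'a) edge \<times> ('l, 'a) edge) list \<Rightarrow> ('l, 'a) edge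
       \<Rightarrow> ('l, 'a) edge list timed" where
  "scc_of_t es rs e =
     filter_t (\<lambda>f. do { b \<leftarrow> reaches_t e f rs; c \<leftarrow> reaches_t f e rs; ret (b \<and> c) }) es"

primrec sccs_iter_t ::
    "('l, 'a) edge list \<Rightarrow> (('l, 'a) edge \<times> ('l, 'a) edge) list \<Rightarrow> ('l, 'a) edge list
       \<Rightarrow> ('l, 'a) edge list list timed" where
  "sccs_iter_t es rs [] = do { tick; ret [] }"
| "sccs_iter_t es rs (e # fs) =
     do { tick;
          Ss \<leftarrow> sccs_iter_t es rs fs;
          b \<leftarrow> any_t (mem_t e) Ss;
          if b then ret Ss else do { S \<leftarrow> scc_of_t es rs e; ret (S # Ss) } }"

definition sccs_t ::
    "('l, 'a) edge list \<Rightarrow> (('l, 'a) edge \<times> ('l, 'a) edge) list \<Rightarrow> ('l, 'a) edge list list timed" where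
  "sccs_t es rs = do { es' \<leftarrow> remdups_t es; sccs_iter_t es' rs es' }"

definition scc_le_t ::
    "(('l, 'a) edge \<times> ('l, 'a) edge) list \<Rightarrow> ('l, 'a) edge list \<Rightarrow> ('l, 'a) edge list \<Rightarrow> bool timed" where
  "scc_le_t rs S T = any_t (\<lambda>e. any_t (\<lambda>f. reaches_t e f rs) T) S"

text \<open>SCCs are equal or disjoint, so that two of them are equal if they share an edge.\<close>

definition scc_eq_t :: "('l, 'a) edge list \<Rightarrow> ('l, 'a) edge list \<Rightarrow> bool timed" where
  "scc_eq_t S T = any_t (\<lambda>e. mem_t e T) S"

definition nontrivial_scc_t :: "('l, 'a) edge list \<Rightarrow> bool timed" where
  "nontrivial_scc_t S =
     any_t (\<lambda>e. any_t (\<lambda>f. do { b \<leftarrow> eq_t e f; c \<leftarrow> eq_t (tgt e) (src e); ret (\<not> b \<or> c) }) S) S"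

definition min_sccs_t ::
    "(('l, 'a) edge \<times> ('l, 'a) edge) list \<Rightarrow> ('l, 'a) edge list list \<Rightarrow> ('a \<times> 'a) list \<Rightarrow> 'a
       \<Rightarrow> ('l, 'a) edge list list timed" where
  "min_sccs_t rs Ss is a =
     do { M \<leftarrow> filter_t (any_t (\<lambda>e. do { b \<leftarrow> mem_t (lab e, a) is; ret (\<not> b) })) Ss;
          filter_t (\<lambda>S. do { b \<leftarrow> any_t (\<lambda>T. do { c \<leftarrow> scc_le_t rs T S; d \<leftarrow> scc_eq_t T S;
                                                    ret (c \<and> \<not> d) }) M;
                              ret (\<not> b) }) M }"

definition max_sccs_t ::
    "(('l, 'a) edge \<times> ('l, 'a) edge) list \<Rightarrow> ('l, 'a) edge list list \<Rightarrow> ('a \<times> 'a) list \<Rightarrow> 'a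
       \<Rightarrow> ('l, 'a) edge list list timed" where
  "max_sccs_t rs Ss is a =
     do { M \<leftarrow> filter_t (any_t (\<lambda>e. do { b \<leftarrow> mem_t (a, lab e) is; ret (\<not> b) })) Ss;
          filter_t (\<lambda>S. do { b \<leftarrow> any_t (\<lambda>T. do { c \<leftarrow> scc_le_t rs S T; d \<leftarrow> scc_eq_t T S;
                                                    ret (c \<and> \<not> d) }) M;
                              ret (\<not> b) }) M }"

definition listed_t ::
    "('l, 'a) edge list \<Rightarrow> 'a \<Rightarrow> ('a \<times> ('l, 'a) edge list list) list \<Rightarrow> bool timed" where
  "listed_t S a table =
     any_t (\<lambda>(a', Ts). do { b \<leftarrow> eq_t a a'; if b then any_t (scc_eq_t S) Ts else ret False }) table"

text \<open>Steps 2 to 5 for one block, given the labels of the thread template and the pairs of the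
  relation computed in step 1.\<close>

definition check_block_t ::
    "'a list \<Rightarrow> ('a \<times> 'a) list \<Rightarrow> ('a \<times> 'a) list \<Rightarrow> ('l, 'a) cfg_rep \<Rightarrow> bool timed" where
  "check_block_t ls ar is h =
     do { rs \<leftarrow> reach_t (edge_list h);
          Ss \<leftarrow> sccs_t (edge_list h) rs;
          mins \<leftarrow> map_t (\<lambda>a. do { Ts \<leftarrow> min_sccs_t rs Ss is a; ret (a, Ts) }) ls;
          maxs \<leftarrow> map_t (\<lambda>a. do { Ts \<leftarrow> max_sccs_t rs Ss is a; ret (a, Ts) }) ls;
          any_t (\<lambda>S1. any_t (\<lambda>S2.
            do { le \<leftarrow> scc_le_t rs S1 S2;
                 eq \<leftarrow> scc_eq_t S1 S2;
                 nt \<leftarrow> nontrivial_scc_t S1;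
                 if le \<and> (eq \<longrightarrow> nt)
                 then any_t (\<lambda>(a, b).
                        do { c \<leftarrow> listed_t S1 a mins; d \<leftarrow> listed_t S2 b maxs; ret (c \<and> d) }) ar
                 else ret False }) Ss) Ss }"

text \<open>The result is \<open>True\<close> if the fusion is declared sound. The two versions differ only in the
  graph computed in step 1.\<close>

definition check_blocks_t ::
    "('a \<times> 'a) list \<Rightarrow> ('l, 'a) cfg_rep \<Rightarrow> ('a \<times> 'a) list \<Rightarrow> ('l, 'a) fusion_rep \<Rightarrow> bool timed" where
  "check_blocks_t ar g is f =
     do { ls \<leftarrow> labels_t (edge_list g);
          b \<leftarrow> any_t (\<lambda>(\<beta>, h). check_block_t ls ar is h) (block_reps f);
          ret (\<not> b) }"

definition decide_arrow ::
    "('l, 'a) cfg_rep \<Rightarrow> ('a \<times> 'a) list \<Rightarrow> ('l, 'a) fusion_rep \<Rightarrow> bool timed" where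
  "decide_arrow g is f = do { ar \<leftarrow> arrow_t g is f; check_blocks_t ar g is f }"

definition decide_inner_arrow ::
    "('l, 'a) cfg_rep \<Rightarrow> ('a \<times> 'a) list \<Rightarrow> ('l, 'a) fusion_rep \<Rightarrow> bool timed" where
  "decide_inner_arrow g is f = do { ar \<leftarrow> inner_arrow_t g is f; check_blocks_t ar g is f }"

end

theory Submission
  imports Defs
begin

text \<open>An interleaving can be reordered into one that executes every atomic block without interruption
  iff the graph obtained by contracting the blocks of its dependence order is acyclic: repeatedly move
  a minimal block to the front. A shortest walk around a cycle alternates between conflicts of
  different threads and moves within a thread, the latter going along program order or, inside
  a block, against it. Since conflicts and program order follow the interleaving, some move goes
  backwards in a block from an edge \<open>f\<close> to an edge \<open>e\<close> before it, and the rest of the cycle is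
  a conflict of \<open>e\<close> with some \<open>a\<close>, a chain from \<open>a\<close> to some \<open>b\<close>, and a conflict of \<open>b\<close>
  with \<open>f\<close>. Conversely, for such a chain, interrupt the block between \<open>e\<close> and \<open>f\<close> and run, one
  after the other, one fresh thread per link of the chain: no reordering makes all blocks of
  this interleaving contiguous. Taking \<open>e\<close> in a minimal and \<open>f\<close> in a maximal SCC is
  no restriction, because reachability between \<open>e\<close> and \<open>f\<close> persists.\<close>

section \<open>Paths\<close>

text \<open>Since \<open>I\<close> may be asymmetric, a reordering is constrained only on pairs that
  fail to commute in the order in which the interleaving has them. Conflicts are therefore directed
  from the earlier to the later event, and the chain that shows unsoundness has to be realised by
  threads executed in chain order. Blocks may contain cycles, so one letter can occur several times
  in a block trace; walks are followed over positions of the word and only then translated to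
  labels. That a reordered word is atomic says merely that some fused word exists. Its cuts are
  recovered from the labels: a letter determines its block and its edge there, and as the initial
  location of a block differs from its exit, two consecutive edges of a path in a block cannot
  belong to different atoms. Algorithm and semantics meet in \<open>breaking_chain\<close>, a
  condition on single edges without SCCs. As to running time, repetitions are removed in every
  iteration of the transitive closure, since the bound on the length of the list would otherwise be
  multiplied each time.\<close>

lemma path_Nil_iff [simp]: "path G l [] n \<longleftrightarrow> l = n"
  by (auto elim: path.cases intro: path.intros)

lemma path_Cons_iff [simp]:
  "path G l (a # w) n \<longleftrightarrow> (\<exists>m. (l, a, m) \<in> edges G \<and> path G m w n)"
  by (auto elim: path.cases intro: path.intros)

lemma path_append_iff [simp]:
  "path G l (u @ v) n \<longleftrightarrow> (\<exists>m. path G l u m \<and> path G m v n)"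
  by (induction u arbitrary: l) auto

lemma lab_in_labels: "e \<in> edges G \<Longrightarrow> lab e \<in> labels G"
  by (auto simp: labels_def)

lemma path_labels: "path G l w n \<Longrightarrow> set w \<subseteq> labels G"
  by (induction rule: path.induct) (auto simp: labels_def image_iff intro: bexI[rotated])

lemma traces_labels: "w \<in> traces G \<Longrightarrow> set w \<subseteq> labels G"
  by (auto simp: traces_def dest: path_labels)

lemma traces_not_Nil: "is_cfg G \<Longrightarrow> [] \<notin> traces G"
  by (auto simp: traces_def is_cfg_def)

text \<open>The inner edges of a walk of edges spell a path, the empty path standing for a single
  step. This links the graph whose SCCs are computed to the label words of traces.\<close>

lemma edge_succ_trancl_iff:
  "(e, f) \<in> (edge_succ G)\<^sup>+ \<longleftrightarrow>
     e \<in> edges G \<and> f \<in> edges G \<and> (\<exists>u. path G (tgt e) u (src f))"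
proof
  assume "(e, f) \<in> (edge_succ G)\<^sup>+"
  then show "e \<in> edges G \<and> f \<in> edges G \<and> (\<exists>u. path G (tgt e) u (src f))"
  proof (induction rule: trancl_induct)
    case (base f)
    then show ?case by (auto simp: edge_succ_def intro: path.intros)
  next
    case (step f f')
    then obtain u where "path G (tgt e) u (src f)" by blast
    then have "path G (tgt e) (u @ [lab f]) (src f')"
      using step by (auto simp: edge_succ_def) (metis prod.collapse)
    then show ?case using step by (auto simp: edge_succ_def simp del: path_append_iff)
  qed
next
  assume "e \<in> edges G \<and> f \<in> edges G \<and> (\<exists>u. path G (tgt e) u (src f))"
  then obtain u where "e \<in> edges G" "f \<in> edges G" "path G (tgt e) u (src f)" by blast
  then show "(e, f) \<in> (edge_succ G)\<^sup>+"
  proof (induction u arbitrary: e)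
    case Nil
    then show ?case by (auto simp: edge_succ_def)
  next
    case (Cons a u)
    then obtain m where m: "(tgt e, a, m) \<in> edges G" "path G m u (src f)" by auto
    then have "((tgt e, a, m), f) \<in> (edge_succ G)\<^sup>+" using Cons by auto
    moreover have "(e, (tgt e, a, m)) \<in> edge_succ G" using m Cons by (auto simp: edge_succ_def)
    ultimately show ?case by (meson trancl_into_trancl2)
  qed
qed

lemma path_trancl:
  assumes "path G l (r @ a # u @ b # s) n"
  obtains e f where "lab e = a" "lab f = b" "(e, f) \<in> (edge_succ G)\<^sup>+"
proof -
  obtain l1 l2 l3 l4 where "(l1, a, l2) \<in> edges G" "path G l2 u l3" "(l3, b, l4) \<in> edges G"
    using assms by auto
  then show thesis
    using that[of "(l1, a, l2)" "(l3, b, l4)"] by (auto simp: edge_succ_trancl_iff)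
qed

lemma edge_extends:
  assumes "is_cfg G" "e \<in> edges G"
  obtains r s where "path G (init G) r (src e)" "path G (tgt e) s (exit G)"
proof -
  have "src e \<in> locs G" "tgt e \<in> locs G" using assms by (auto simp: is_cfg_def)
  then show thesis using assms that unfolding is_cfg_def by metis
qed

lemma edge_trace:
  assumes "is_cfg G" "a \<in> labels G"
  obtains r s where "r @ a # s \<in> traces G"
proof -
  obtain e where e: "e \<in> edges G" "lab e = a" using assms by (auto simp: labels_def)
  then obtain r s where "path G (init G) r (src e)" "path G (tgt e) s (exit G)"
    using edge_extends assms by blast
  then show thesis using e that[of r s] by (auto simp: traces_def) (metis prod.collapse)
qed

text \<open>The path behind the walk of edges is prolonged at both ends, as every location is
  reachable from the initial one and reaches the exit.\<close>

lemma trancl_trace: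
  assumes "is_cfg G" "(e, f) \<in> (edge_succ G)\<^sup>+"
  obtains r u s where "r @ lab e # u @ lab f # s \<in> traces G"
proof -
  obtain u where u: "e \<in> edges G" "f \<in> edges G" "path G (tgt e) u (src f)"
    using assms by (auto simp: edge_succ_trancl_iff)
  obtain r where r: "path G (init G) r (src e)" using edge_extends[OF assms(1) u(1)] by blast
  obtain s where s: "path G (tgt f) s (exit G)" using edge_extends[OF assms(1) u(2)] by blast
  have "path G (src e) (lab e # u @ lab f # s) (exit G)"
    using u s by auto (metis prod.collapse)
  then show thesis using r that[of r u s] by (auto simp: traces_def)
qed

text \<open>The diagonal comes from infixes of one letter, the closure from longer ones.\<close>

lemma po_eq:
  assumes "is_cfg G"
  shows "po G = Id_on (labels G) \<union> (\<lambda>(e, f). (lab e, lab f)) ` (edge_succ G)\<^sup>+"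
    (is "_ = ?R")
proof (intro equalityI subrelI)
  fix a b assume "(a, b) \<in> po G"
  then obtain r u s where u: "r @ u @ s \<in> traces G" "u \<noteq> []" "hd u = a" "last u = b"
    by (auto simp: po_def)
  then obtain v where v: "u = a # v" by (cases u) auto
  show "(a, b) \<in> ?R"
  proof (cases "v = []")
    case True
    then show ?thesis using u v traces_labels[OF u(1)] by auto
  next
    case False
    then obtain x where "v = x @ [b]" using u v by (metis append_butlast_last_id last_ConsR)
    then have "path G (init G) (r @ a # x @ b # s) (exit G)"
      using u v by (auto simp: traces_def)
    then obtain e f where "lab e = a" "lab f = b" "(e, f) \<in> (edge_succ G)\<^sup>+" by (rule path_trancl)
    then show ?thesis by force
  qed
next
  fix a b assume "(a, b) \<in> ?R"
  then consider "a = b" "a \<in> labels G"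
    | e f where "lab e = a" "lab f = b" "(e, f) \<in> (edge_succ G)\<^sup>+" by auto
  then show "(a, b) \<in> po G"
  proof cases
    case 1
    then obtain r s where "r @ [a] @ s \<in> traces G" using edge_trace[OF assms] by auto
    then show ?thesis using 1 unfolding po_def by fastforce
  next
    case 2
    obtain r u s where "r @ lab e # u @ lab f # s \<in> traces G"
      using trancl_trace[OF assms 2(3)] by blast
    then have "r @ (a # u @ [b]) @ s \<in> traces G" using 2 by simp
    then show ?thesis unfolding po_def by fastforce
  qed
qed

lemma atomic_rel_eq:
  assumes "\<forall>(\<beta>, H) \<in> set (blocks F). is_cfg H"
  shows "atomic_rel F =
    (\<Union>(\<beta>, H) \<in> set (blocks F). (\<lambda>(e, f). (lab f, lab e)) ` (edge_succ H)\<^sup>+)" (is "_ = ?R")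
proof (intro equalityI subrelI)
  fix a b assume "(a, b) \<in> atomic_rel F"
  then obtain \<beta> H r u s where H: "(\<beta>, H) \<in> set (blocks F)"
    and "r @ [b] @ u @ [a] @ s \<in> traces H" by (auto simp: atomic_rel_def)
  then have "path H (init H) (r @ b # u @ a # s) (exit H)" by (auto simp: traces_def)
  then obtain e f where "lab e = b" "lab f = a" "(e, f) \<in> (edge_succ H)\<^sup>+" by (rule path_trancl)
  then show "(a, b) \<in> ?R" using H by force
next
  fix a b assume "(a, b) \<in> ?R"
  then obtain \<beta> H e f where H: "(\<beta>, H) \<in> set (blocks F)"
    and e: "lab e = b" "lab f = a" "(e, f) \<in> (edge_succ H)\<^sup>+" by auto
  moreover have "is_cfg H" using assms H by auto
  ultimately obtain r u s where "r @ [b] @ u @ [a] @ s \<in> traces H"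
    using trancl_trace[of H e f] by auto
  then show "(a, b) \<in> atomic_rel F" using H unfolding atomic_rel_def by fast
qed

section \<open>Values of the step-counting computations\<close>

lemma val_bind [simp]: "val (bind_timed m f) = val (f (val m))"
  by (auto simp: bind_timed_def split: timed.splits)

lemma steps_bind [simp]: "steps (bind_timed m f) = steps m + steps (f (val m))"
  by (auto simp: bind_timed_def split: timed.splits)

lemma ret_simps [simp]: "val (ret x) = x" "steps (ret x) = 0"
  by (auto simp: ret_def)

lemma tick_simps [simp]: "steps tick = 1"
  by (auto simp: tick_def)

lemma eq_t_simps [simp]: "val (eq_t x y) \<longleftrightarrow> x = y" "steps (eq_t x y) = 1"
  by (auto simp: eq_t_def)

lemma val_any_t [simp]: "val (any_t p xs) \<longleftrightarrow> (\<exists>x\<in>set xs. val (p x))"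
  by (induction xs) auto

lemma val_filter_t [simp]: "val (filter_t p xs) = filter (\<lambda>x. val (p x)) xs"
  by (induction xs) auto

lemma val_map_t [simp]: "val (map_t f xs) = map (\<lambda>x. val (f x)) xs"
  by (induction xs) auto

lemma val_append_t [simp]: "val (append_t xs ys) = xs @ ys"
  by (induction xs) auto

lemma val_concat_map_t [simp]: "val (concat_map_t f xs) = concat (map (\<lambda>x. val (f x)) xs)"
  by (induction xs) auto

lemma val_mem_t [simp]: "val (mem_t x xs) \<longleftrightarrow> x \<in> set xs"
  by (auto simp: mem_t_def)

lemma val_remdups_t [simp]: "val (remdups_t xs) = remdups xs"
  by (induction xs) auto

lemma val_product_t [simp]: "val (product_t xs ys) = List.product xs ys"
  by (simp add: product_t_def product_concat_map)

lemma set_union_t [simp]: "set (val (union_t xs ys)) = set xs \<union> set ys"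
  by (simp add: union_t_def)

lemma set_comp_t [simp]: "set (val (comp_t R Q)) = set R O set Q"
  by (force simp: comp_t_def)

lemma set_trancl_iter_t: "set (val (trancl_iter_t R xs)) = ntrancl (length xs) (set R)"
  by (induction xs) (auto simp: ntrancl_Suc)

lemma set_trancl_t [simp]:
  fixes R :: "('x \<times> 'x) list"
  shows "set (val (trancl_t R)) = (set R)\<^sup>+"
proof (intro equalityI)
  show "set (val (trancl_t R)) \<subseteq> (set R)\<^sup>+"
    unfolding trancl_t_def set_trancl_iter_t by (auto simp: ntrancl_def trancl_power)
  \<comment> \<open>A shortest walk uses each pair of a finite relation at most once, so powers up
    to the number of pairs suffice; \<open>ntrancl n\<close> contains the powers up to
    \<open>n + 1\<close>, whence the subtraction. Repetitions in \<open>R\<close> only add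
    iterations.\<close>
  have "(set R)\<^sup>+ = ntrancl (card (set R) - 1) (set R)"
    by (simp add: finite_trancl_ntranl)
  also have "\<dots> \<subseteq> ntrancl (length R) (set R)"
    using card_length[of R] unfolding ntrancl_def by fastforce
  finally show "(set R)\<^sup>+ \<subseteq> set (val (trancl_t R))"
    by (simp add: trancl_t_def set_trancl_iter_t)
qed

lemma set_reach_t: "set (val (reach_t (edge_list h))) = (edge_succ (cfg_of h))\<^sup>+"
proof -
  have "{x \<in> set (edge_list h) \<times> set (edge_list h). case x of (e, f) \<Rightarrow> tgt e = src f}
     = edge_succ (cfg_of h)"
    by (auto simp: edge_succ_def cfg_of_def)
  then show ?thesis by (simp add: reach_t_def case_prod_unfold)
qed

lemma edges_cfg_of [simp]: "edges (cfg_of g) = set (edge_list g)"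
  by (simp add: cfg_of_def)

lemma set_labels_t [simp]: "set (val (labels_t (edge_list g))) = labels (cfg_of g)"
  by (simp add: labels_t_def labels_def)

lemma set_dependence_t [simp]:
  "set (val (dependence_t ls is)) = set ls \<times> set ls - set is"
  by (auto simp: dependence_t_def)

lemma set_po_t:
  assumes "is_cfg (cfg_of g)"
  shows "set (val (po_t (edge_list g))) = po (cfg_of g)"
  by (auto simp: po_t_def po_eq[OF assms] set_reach_t labels_def Id_on_def case_prod_unfold)

lemma set_blocks_fusion_of:
  "set (blocks (fusion_of f)) = (\<lambda>(\<beta>, h). (\<beta>, cfg_of h)) ` set (block_reps f)"
  by (simp add: fusion_of_def)

lemma set_atomic_rel_t:
  assumes "\<forall>(\<beta>, H) \<in> set (blocks (fusion_of f)). is_cfg H"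
  shows "set (val (atomic_rel_t (block_reps f))) = atomic_rel (fusion_of f)"
  unfolding atomic_rel_eq[OF assms]
  by (simp add: atomic_rel_t_def set_blocks_fusion_of set_reach_t case_prod_unfold image_image)

section \<open>Values of the two graphs of step 1\<close>

context
  fixes g :: "('l, 'a) cfg_rep" and "is" :: "('a \<times> 'a) list" and f :: "('l, 'a) fusion_rep"
  assumes cfg: "is_cfg (cfg_of g)" "\<forall>(\<beta>, H) \<in> set (blocks (fusion_of f)). is_cfg H"
begin

lemma set_arrow_t: "set (val (arrow_t g is f)) = arrow (cfg_of g) (set is) (fusion_of f)"
  by (simp add: arrow_t_def arrow_def dependence_def set_po_t set_atomic_rel_t cfg)

text \<open>The algorithm has no reflexive closure: it joins the chains without a dependence to
  those with at least one. The sliding law of Kleene algebra turns this into the form of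
  \<open>inner_arrow_def\<close>.\<close>

lemma set_inner_arrow_t:
  "set (val (inner_arrow_t g is f)) = inner_arrow (cfg_of g) (set is) (fusion_of f)"
proof -
  have "P \<union> (P O D)\<^sup>+ O P = P O (D O P)\<^sup>*" for P D :: "('a \<times> 'a) set"
  proof -
    have eq: "(P O D)\<^sup>* O P = P O (D O P)\<^sup>*"
    proof (intro equalityI subrelI)
      fix x z assume "(x, z) \<in> (P O D)\<^sup>* O P"
      then obtain y where "(x, y) \<in> (P O D)\<^sup>*" "(y, z) \<in> P" by blast
      then show "(x, z) \<in> P O (D O P)\<^sup>*"
      proof (induction rule: converse_rtrancl_induct)
        case base
        then show ?case by blast
      next
        case (step x y)
        then show ?case by (meson converse_rtrancl_into_rtrancl relcomp.simps)
      qed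
    next
      fix x z assume "(x, z) \<in> P O (D O P)\<^sup>*"
      then obtain y where "(x, y) \<in> P" "(y, z) \<in> (D O P)\<^sup>*" by blast
      from this(2,1) show "(x, z) \<in> (P O D)\<^sup>* O P"
      proof (induction rule: rtrancl_induct)
        case base
        then show ?case by blast
      next
        case (step y z)
        then show ?case by (meson rtrancl.rtrancl_into_rtrancl relcomp.simps)
      qed
    qed
    show ?thesis unfolding eq[symmetric] by (auto simp: rtrancl_eq_or_trancl)
  qed
  then show ?thesis
    by (simp add: inner_arrow_t_def inner_arrow_def dependence_def set_po_t set_atomic_rel_t cfg
        del: relcomp_distrib relcomp_distrib2)
qed

end

section \<open>Strongly connected components\<close>

text \<open>Descent on the number of elements below \<open>S\<close>. The order is a parameter so
  that its converse yields maximal elements.\<close>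

lemma finite_minimal_below:
  assumes "finite M" "S \<in> M"
    and refl: "\<And>T. T \<in> M \<Longrightarrow> le T T"
    and trans: "\<And>T U V. T \<in> M \<Longrightarrow> U \<in> M \<Longrightarrow> V \<in> M \<Longrightarrow> le T U \<Longrightarrow> le U V \<Longrightarrow> le T V"
    and antisym: "\<And>T U. T \<in> M \<Longrightarrow> U \<in> M \<Longrightarrow> le T U \<Longrightarrow> le U T \<Longrightarrow> T = U"
  shows "\<exists>T\<in>M. le T S \<and> (\<forall>U\<in>M. le U T \<longrightarrow> U = T)"
  using \<open>S \<in> M\<close>
proof (induction "card {U \<in> M. le U S}" arbitrary: S rule: less_induct)
  case less
  show ?case
  proof (cases "\<forall>U\<in>M. le U S \<longrightarrow> U = S")
    case True
    then show ?thesis using less.prems refl by blast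
  next
    case False
    then obtain U where U: "U \<in> M" "le U S" "U \<noteq> S" by blast
    then have "S \<notin> {V \<in> M. le V U}" using antisym less.prems by blast
    moreover have "{V \<in> M. le V U} \<subseteq> {V \<in> M. le V S}" using U trans less.prems by blast
    ultimately have "{V \<in> M. le V U} \<subset> {V \<in> M. le V S}"
      using refl less.prems by blast
    then have "card {V \<in> M. le V U} < card {V \<in> M. le V S}"
      using \<open>finite M\<close> by (simp add: psubset_card_mono)
    then obtain T where "T \<in> M" "le T U" "\<forall>U\<in>M. le U T \<longrightarrow> U = T"
      using less.hyps U by blast
    then show ?thesis using trans U less.prems by blast
  qed
qed

definition scc_of :: "('l, 'a) cfg \<Rightarrow> ('l, 'a) edge \<Rightarrow> ('l, 'a) edge set" where
  "scc_of H e = {f \<in> edges H. (e, f) \<in> (edge_succ H)\<^sup>* \<and> (f, e) \<in> (edge_succ H)\<^sup>*}"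

lemma sccs_eq: "sccs H = scc_of H ` edges H"
  by (simp add: sccs_def scc_of_def)

lemma scc_of_self: "e \<in> edges H \<Longrightarrow> e \<in> scc_of H e"
  by (simp add: scc_of_def)

lemma scc_of_eq: "f \<in> scc_of H e \<Longrightarrow> scc_of H f = scc_of H e"
  unfolding scc_of_def by (auto intro: rtrancl_trans)

lemma sccs_scc_of: "S \<in> sccs H \<Longrightarrow> e \<in> S \<Longrightarrow> S = scc_of H e"
  by (auto simp: sccs_eq scc_of_eq)

lemma sccs_edges: "S \<in> sccs H \<Longrightarrow> S \<subseteq> edges H"
  by (auto simp: sccs_eq scc_of_def)

lemma sccs_nonempty: "S \<in> sccs H \<Longrightarrow> S \<noteq> {}"
  by (auto simp: sccs_eq dest: scc_of_self)

text \<open>Edges of one SCC reach each other, so any representatives may replace the witnesses in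
  \<open>scc_le\<close>.\<close>

lemma scc_le_iff:
  assumes "S \<in> sccs H" "T \<in> sccs H" "e \<in> S" "f \<in> T"
  shows "scc_le H S T \<longleftrightarrow> (e, f) \<in> (edge_succ H)\<^sup>*"
proof
  assume "scc_le H S T"
  then obtain e' f' where *: "e' \<in> S" "f' \<in> T" "(e', f') \<in> (edge_succ H)\<^sup>*"
    by (auto simp: scc_le_def)
  have "e' \<in> scc_of H e" "f' \<in> scc_of H f" using sccs_scc_of assms * by blast+
  then show "(e, f) \<in> (edge_succ H)\<^sup>*" using * unfolding scc_of_def by (auto intro: rtrancl_trans)
qed (use assms in \<open>auto simp: scc_le_def\<close>)

lemma scc_le_refl: "S \<in> sccs H \<Longrightarrow> scc_le H S S"
  using sccs_nonempty[of S H] by (auto simp: scc_le_def)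

lemma scc_le_trans:
  assumes "S \<in> sccs H" "T \<in> sccs H" "U \<in> sccs H" "scc_le H S T" "scc_le H T U"
  shows "scc_le H S U"
proof -
  obtain e f g where efg: "e \<in> S" "f \<in> T" "g \<in> U"
    using assms(1-3)[THEN sccs_nonempty] by blast
  have "(e, f) \<in> (edge_succ H)\<^sup>*" "(f, g) \<in> (edge_succ H)\<^sup>*"
    using scc_le_iff[OF assms(1,2) efg(1,2)] scc_le_iff[OF assms(2,3) efg(2,3)] assms(4,5) by blast+
  then show ?thesis unfolding scc_le_iff[OF assms(1,3) efg(1,3)] by (rule rtrancl_trans)
qed

lemma scc_le_antisym:
  assumes "S \<in> sccs H" "T \<in> sccs H" "scc_le H S T" "scc_le H T S"
  shows "S = T"
proof -
  obtain e f where ef: "e \<in> S" "f \<in> T" using assms(1,2)[THEN sccs_nonempty] by blast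
  then have "(e, f) \<in> (edge_succ H)\<^sup>*" "(f, e) \<in> (edge_succ H)\<^sup>*"
    using scc_le_iff[OF assms(1,2) ef] scc_le_iff[OF assms(2,1) ef(2,1)] assms(3,4) by blast+
  then have "f \<in> scc_of H e" using ef sccs_edges[OF assms(2)] by (auto simp: scc_of_def)
  then show ?thesis
    using sccs_scc_of[OF assms(1) ef(1)] sccs_scc_of[OF assms(2) ef(2)] scc_of_eq by blast
qed

text \<open>The form that \<open>nontrivial_scc_t\<close> tests: two different edges or a self-loop,
  without counting.\<close>

lemma nontrivial_scc_iff:
  assumes "finite (edges H)" "S \<in> sccs H"
  shows "nontrivial_scc H S \<longleftrightarrow> (\<exists>e\<in>S. \<exists>f\<in>S. e \<noteq> f \<or> tgt e = src e)"
proof -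
  have S: "finite S" "S \<subseteq> edges H" "S \<noteq> {}"
    using sccs_edges[OF assms(2)] sccs_nonempty[OF assms(2)] finite_subset[OF _ assms(1)] by blast+
  show ?thesis
  proof (cases "\<exists>e. S = {e}")
    case True
    then show ?thesis using S by (auto simp: nontrivial_scc_def edge_succ_def)
  next
    case False
    then have "\<exists>e\<in>S. \<exists>f\<in>S. e \<noteq> f" using S by blast
    moreover have "2 \<le> card S"
    proof -
      have "card S \<noteq> 0" "card S \<noteq> 1" using False S by (auto simp: card_1_singleton_iff)
      then show ?thesis by linarith
    qed
    ultimately show ?thesis unfolding nontrivial_scc_def by blast
  qed
qed

text \<open>A non-trivial SCC has a closed walk of positive length; going from \<open>e\<close> to
  that walk, around it and on to \<open>f\<close> makes the connection non-empty even if
  \<open>e = f\<close>.\<close>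

lemma nontrivial_scc_reach:
  assumes "finite (edges H)" "S \<in> sccs H" "nontrivial_scc H S" "e \<in> S" "f \<in> S"
  shows "(e, f) \<in> (edge_succ H)\<^sup>+"
proof -
  obtain x y where xy: "x \<in> S" "y \<in> S" "x \<noteq> y \<or> tgt x = src x"
    using assms nontrivial_scc_iff by blast
  have r: "(u, v) \<in> (edge_succ H)\<^sup>*" if "u \<in> S" "v \<in> S" for u v
    using scc_le_iff[OF assms(2) assms(2) that] scc_le_refl[OF assms(2)] by blast
  have "(x, x) \<in> (edge_succ H)\<^sup>+"
  proof (cases "x = y")
    case True
    then have "(x, x) \<in> edge_succ H"
      using xy sccs_edges[OF assms(2)] by (auto simp: edge_succ_def)
    then show ?thesis by blast
  next
    case False
    then have "(x, y) \<in> (edge_succ H)\<^sup>+" using r[OF xy(1,2)] by (auto dest: rtranclD)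
    then show ?thesis using r[OF xy(2,1)] by (rule trancl_rtrancl_trancl)
  qed
  then show ?thesis
    using r[OF assms(4) xy(1)] r[OF xy(1) assms(5)]
    by (blast intro: rtrancl_trancl_trancl trancl_rtrancl_trancl)
qed

text \<open>Eliminates the SCCs from step 5 for a fixed pair of actions. Passing to extremal SCCs
  preserves reachability; the delicate point is that the positive length of the walk has to match
  the condition of non-triviality.\<close>

lemma min_max_sccs_iff:
  assumes fin: "finite (edges H)"
  shows "(\<exists>S1\<in>sccs H. \<exists>S2\<in>sccs H. scc_le H S1 S2 \<and> (S1 = S2 \<longrightarrow> nontrivial_scc H S1) \<and>
           S1 \<in> min_sccs H I a \<and> S2 \<in> max_sccs H I b) \<longleftrightarrow>
         (\<exists>(e, f)\<in>(edge_succ H)\<^sup>+. (lab e, a) \<notin> I \<and> (b, lab f) \<notin> I)" (is "?L \<longleftrightarrow> ?R")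
proof
  assume ?L
  then obtain S1 S2 where S: "S1 \<in> sccs H" "S2 \<in> sccs H" "scc_le H S1 S2"
      "S1 = S2 \<longrightarrow> nontrivial_scc H S1"
    and mm: "S1 \<in> min_sccs H I a" "S2 \<in> max_sccs H I b" by blast
  obtain e where e: "e \<in> S1" "(lab e, a) \<notin> I"
    using mm(1) unfolding min_sccs_def Let_def mem_Collect_eq by metis
  obtain f where f: "f \<in> S2" "(b, lab f) \<notin> I"
    using mm(2) unfolding max_sccs_def Let_def mem_Collect_eq by metis
  note ef = e f
  have "(e, f) \<in> (edge_succ H)\<^sup>+"
  proof (cases "S1 = S2")
    case True
    then show ?thesis using nontrivial_scc_reach[OF fin] S ef by blast
  next
    case False
    then have "e \<noteq> f" using sccs_scc_of[OF S(1) ef(1)] sccs_scc_of[OF S(2) ef(3)] by blast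
    moreover have "(e, f) \<in> (edge_succ H)\<^sup>*"
      using scc_le_iff[OF S(1,2) ef(1,3)] S(3) by blast
    ultimately show ?thesis by (auto dest: rtranclD)
  qed
  then show ?R using ef by blast
next
  assume ?R
  then obtain e f where ef: "(e, f) \<in> (edge_succ H)\<^sup>+" "(lab e, a) \<notin> I" "(b, lab f) \<notin> I" by blast
  then have e: "e \<in> edges H" "f \<in> edges H" by (auto simp: edge_succ_trancl_iff)
  define E F where "E = scc_of H e" and "F = scc_of H f"
  have E: "E \<in> sccs H" "F \<in> sccs H" "e \<in> E" "f \<in> F"
    using e by (auto simp: sccs_eq E_def F_def scc_of_self)
  have EF: "scc_le H E F" using ef scc_le_iff[OF E] by simp
  have fin': "finite (sccs H)" using fin by (simp add: sccs_eq)
  let ?M1 = "{S \<in> sccs H. \<exists>e\<in>S. (lab e, a) \<notin> I}" and ?M2 = "{S \<in> sccs H. \<exists>e\<in>S. (b, lab e) \<notin> I}"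
  have "\<exists>S1\<in>?M1. scc_le H S1 E \<and> (\<forall>U\<in>?M1. scc_le H U S1 \<longrightarrow> U = S1)"
  proof (rule finite_minimal_below)
    show "finite ?M1" "E \<in> ?M1" using fin' E ef by auto
  qed (blast intro: scc_le_refl scc_le_trans | blast dest: scc_le_antisym)+
  then obtain S1 where S1: "S1 \<in> sccs H" "S1 \<in> min_sccs H I a" "scc_le H S1 E"
    by (auto simp: min_sccs_def)
  have "\<exists>S2\<in>?M2. scc_le H F S2 \<and> (\<forall>U\<in>?M2. scc_le H S2 U \<longrightarrow> U = S2)"
  \<comment> \<open>Maximal SCCs are the minimal ones of the converse order.\<close>
  proof (rule finite_minimal_below[where le = "\<lambda>S T. scc_le H T S"])
    show "finite ?M2" "F \<in> ?M2" using fin' E ef by auto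
  qed (blast intro: scc_le_refl scc_le_trans | blast dest: scc_le_antisym)+
  then obtain S2 where S2: "S2 \<in> sccs H" "S2 \<in> max_sccs H I b" "scc_le H F S2"
    by (auto simp: max_sccs_def)
  \<comment> \<open>If \<open>S1 = S2\<close>, the chain from \<open>S1\<close> over
    \<open>E\<close> and \<open>F\<close> to \<open>S2\<close> collapses to one SCC. Should
    \<open>e\<close> and \<open>f\<close> coincide as well, the successor of \<open>e\<close> on the
    closed walk is either a second member or \<open>e\<close> itself.\<close>
  have "nontrivial_scc H S1" if "S1 = S2"
  proof -
    have "scc_le H F S1" "scc_le H E S1"
      using that S2(3) scc_le_trans[OF E(1,2) S1(1) EF] by auto
    then have "S1 = E" "E = F"
      using scc_le_antisym[OF S1(1) E(1)] scc_le_antisym[OF E(1,2) EF]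
        scc_le_trans[OF E(2) S1(1) E(1)] S1(3) by blast+
    then have "e \<in> S1" "f \<in> S1" using E by auto
    show ?thesis
    proof (cases "e = f")
      case False
      then show ?thesis
        unfolding nontrivial_scc_iff[OF fin S1(1)] using \<open>e \<in> S1\<close> \<open>f \<in> S1\<close> by blast
    next
      case True
      then obtain g where g: "(e, g) \<in> edge_succ H" "(g, e) \<in> (edge_succ H)\<^sup>*"
        using ef(1) by (auto dest: tranclD)
      then have "g \<in> S1"
        unfolding \<open>S1 = E\<close> E_def scc_of_def by (auto simp: edge_succ_def)
      then show ?thesis
        unfolding nontrivial_scc_iff[OF fin S1(1)]
        using \<open>e \<in> S1\<close> g by (cases "g = e") (auto simp: edge_succ_def)
    qed
  qed
  moreover have "scc_le H S1 S2"
    using scc_le_trans[OF S1(1) E(1,2) S1(3) EF] scc_le_trans[OF S1(1) E(2) S2(1) _ S2(3)] by blast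
  ultimately show ?L using S1 S2 by blast
qed

text \<open>The relation \<open>A\<close> stays arbitrary, so that both graphs of step 1 are
  covered.\<close>

lemma declared_unsound_iff:
  assumes "\<forall>(\<beta>, H) \<in> set (blocks F). is_cfg H"
  shows "declared_unsound A I F \<longleftrightarrow>
    (\<exists>(\<beta>, H)\<in>set (blocks F). \<exists>(e, f)\<in>(edge_succ H)\<^sup>+.
       \<exists>(a, b)\<in>A. (lab e, a) \<notin> I \<and> (b, lab f) \<notin> I)"
proof -
  have "(\<exists>S1\<in>sccs H. \<exists>S2\<in>sccs H. scc_le H S1 S2 \<and> (S1 = S2 \<longrightarrow> nontrivial_scc H S1) \<and>
          (\<exists>(a, b)\<in>A. S1 \<in> min_sccs H I a \<and> S2 \<in> max_sccs H I b)) \<longleftrightarrow>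
        (\<exists>(e, f)\<in>(edge_succ H)\<^sup>+. \<exists>(a, b)\<in>A. (lab e, a) \<notin> I \<and> (b, lab f) \<notin> I)"
    (is "?L \<longleftrightarrow> ?R") if "(\<beta>, H) \<in> set (blocks F)" for \<beta> H
  proof -
    have fin: "finite (edges H)" using that assms by (auto simp: is_cfg_def)
    have "?L \<longleftrightarrow> (\<exists>(a, b)\<in>A. \<exists>S1\<in>sccs H. \<exists>S2\<in>sccs H. scc_le H S1 S2 \<and>
      (S1 = S2 \<longrightarrow> nontrivial_scc H S1) \<and> S1 \<in> min_sccs H I a \<and> S2 \<in> max_sccs H I b)" by blast
    also have "\<dots> \<longleftrightarrow> ?R" unfolding min_max_sccs_iff[OF fin] by blast
    finally show ?thesis .
  qed
  note eq = this
  show ?thesis unfolding declared_unsound_def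
  proof (rule bex_cong[OF refl])
    fix x assume x: "x \<in> set (blocks F)"
    obtain \<beta> H where "x = (\<beta>, H)" by (rule prod.exhaust)
    then show "(case x of (\<beta>, H) \<Rightarrow> \<exists>S1\<in>sccs H. \<exists>S2\<in>sccs H.
        scc_le H S1 S2 \<and> (S1 = S2 \<longrightarrow> nontrivial_scc H S1) \<and>
        (\<exists>(a, b)\<in>A. S1 \<in> min_sccs H I a \<and> S2 \<in> max_sccs H I b)) \<longleftrightarrow>
      (case x of (\<beta>, H) \<Rightarrow> \<exists>(e, f)\<in>(edge_succ H)\<^sup>+.
        \<exists>(a, b)\<in>A. (lab e, a) \<notin> I \<and> (b, lab f) \<notin> I)"
      using eq[of \<beta> H] x by (simp only: split_conv)
  qed
qed

section \<open>Values computed for the SCCs of a block\<close>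

lemma val_if_ret_False: "val (if c then m else ret False) \<longleftrightarrow> c \<and> val m"
  by simp

context
  fixes h :: "('l, 'a) cfg_rep" and rs :: "(('l, 'a) edge \<times> ('l, 'a) edge) list" and H
  assumes rs: "set rs = (edge_succ H)\<^sup>+" and H: "H = cfg_of h"
begin

lemma val_reaches_t: "val (reaches_t e f rs) \<longleftrightarrow> (e, f) \<in> (edge_succ H)\<^sup>*"
  by (auto simp: reaches_t_def rs rtrancl_eq_or_trancl)

lemma val_scc_le_t: "val (scc_le_t rs S T) \<longleftrightarrow> scc_le H (set S) (set T)"
  by (simp add: scc_le_t_def val_reaches_t scc_le_def)

lemma val_scc_eq_t:
  assumes "set S \<in> sccs H" "set T \<in> sccs H"
  shows "val (scc_eq_t S T) \<longleftrightarrow> set S = set T"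
proof -
  have "val (scc_eq_t S T) \<longleftrightarrow> (\<exists>e. e \<in> set S \<and> e \<in> set T)"
    by (auto simp: scc_eq_t_def)
  also have "\<dots> \<longleftrightarrow> set S = set T"
    using sccs_nonempty[OF assms(1)] sccs_scc_of[OF assms(1)] sccs_scc_of[OF assms(2)]
    by (metis ex_in_conv)
  finally show ?thesis .
qed

lemma val_nontrivial_scc_t:
  assumes "set S \<in> sccs H"
  shows "val (nontrivial_scc_t S) \<longleftrightarrow> nontrivial_scc H (set S)"
proof -
  have "finite (edges H)" by (simp add: H)
  then show ?thesis unfolding nontrivial_scc_iff[OF \<open>finite (edges H)\<close> assms]
    by (auto simp: nontrivial_scc_t_def)
qed

lemma set_scc_of_t:
  assumes "set es = edges H"
  shows "set (val (scc_of_t es rs e)) = scc_of H e"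
  using assms by (auto simp: scc_of_t_def scc_of_def val_reaches_t)

lemma set_sccs_iter_t:
  assumes "set es = edges H" "set fs \<subseteq> edges H"
  shows "set ` set (val (sccs_iter_t es rs fs)) = scc_of H ` set fs"
  using assms(2)
proof (induction fs)
  case (Cons e fs)
  then have IH: "set ` set (val (sccs_iter_t es rs fs)) = scc_of H ` set fs" by simp
  \<comment> \<open>An edge that already occurs in a listed SCC may be skipped, because that SCC is
    its own.\<close>
  have "scc_of H e \<in> scc_of H ` set fs" if "S \<in> set (val (sccs_iter_t es rs fs))" "e \<in> set S" for S
  proof -
    have "set S \<in> scc_of H ` set fs" using that IH by blast
    then show ?thesis using that scc_of_eq by fastforce
  qed
  then show ?case using IH by (auto simp: set_scc_of_t[OF assms(1)])
qed simp

lemma set_sccs_t: "set ` set (val (sccs_t (edge_list h) rs)) = sccs H"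
  by (simp add: sccs_t_def set_sccs_iter_t sccs_eq H)

lemma set_min_sccs_t:
  assumes "set ` set Ss = sccs H"
  shows "set ` set (val (min_sccs_t rs Ss is a)) = min_sccs H (set is) a"
proof -
  \<comment> \<open>\<open>?P\<close> depends on the set of edges only. Selecting lists by it
    therefore commutes with passing from lists to the SCCs they represent.\<close>
  let ?P = "\<lambda>X. (\<exists>e\<in>X. (lab e, a) \<notin> set is) \<and>
      (\<forall>T\<in>set Ss. (\<exists>e\<in>set T. (lab e, a) \<notin> set is) \<longrightarrow> scc_le H (set T) X \<longrightarrow> set T = X)"
  have "val (scc_eq_t T S) \<longleftrightarrow> set T = set S" if "T \<in> set Ss" "S \<in> set Ss" for S T
    using that assms by (intro val_scc_eq_t) blast+
  then have "set (val (min_sccs_t rs Ss is a)) = {S \<in> set Ss. ?P (set S)}"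
    by (auto simp: min_sccs_t_def val_scc_le_t)
  then have "set ` set (val (min_sccs_t rs Ss is a)) = {X \<in> set ` set Ss. ?P X}" by blast
  also have "\<dots> = min_sccs H (set is) a"
    unfolding min_sccs_def Let_def assms[symmetric] by blast
  finally show ?thesis .
qed

lemma set_max_sccs_t:
  assumes "set ` set Ss = sccs H"
  shows "set ` set (val (max_sccs_t rs Ss is a)) = max_sccs H (set is) a"
proof -
  let ?P = "\<lambda>X. (\<exists>e\<in>X. (a, lab e) \<notin> set is) \<and>
      (\<forall>T\<in>set Ss. (\<exists>e\<in>set T. (a, lab e) \<notin> set is) \<longrightarrow> scc_le H X (set T) \<longrightarrow> set T = X)"
  have "val (scc_eq_t T S) \<longleftrightarrow> set T = set S" if "T \<in> set Ss" "S \<in> set Ss" for S T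
    using that assms by (intro val_scc_eq_t) blast+
  then have "set (val (max_sccs_t rs Ss is a)) = {S \<in> set Ss. ?P (set S)}"
    by (auto simp: max_sccs_t_def val_scc_le_t)
  then have "set ` set (val (max_sccs_t rs Ss is a)) = {X \<in> set ` set Ss. ?P X}" by blast
  also have "\<dots> = max_sccs H (set is) a"
    unfolding max_sccs_def Let_def assms[symmetric] by blast
  finally show ?thesis .
qed

text \<open>Repeated keys in the table are harmless, since all entries for \<open>a\<close> carry
  the same list.\<close>

lemma val_listed_t:
  assumes "set S \<in> sccs H" "\<And>a. a \<in> set ls \<Longrightarrow> set ` set (f a) \<subseteq> sccs H" "a \<in> set ls"
  shows "val (listed_t S a (map (\<lambda>a. (a, f a)) ls)) \<longleftrightarrow> set S \<in> set ` set (f a)"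
proof -
  have "val (scc_eq_t S T) \<longleftrightarrow> set S = set T" if "T \<in> set (f a)" for T
    using that assms by (intro val_scc_eq_t) blast+
  then show ?thesis using assms(3) by (auto simp: listed_t_def split: if_splits)
qed

end

text \<open>The tables have entries for the actions in \<open>ls\<close> only; this is why the pairs
  of \<open>ar\<close> are required to lie among them.\<close>

lemma val_check_block_t:
  fixes h :: "('l, 'a) cfg_rep"
  assumes H: "H = cfg_of h" and ar: "set ar \<subseteq> set ls \<times> set ls"
  shows "val (check_block_t ls ar is h) \<longleftrightarrow>
    (\<exists>S1 \<in> sccs H. \<exists>S2 \<in> sccs H.
        scc_le H S1 S2 \<and> (S1 = S2 \<longrightarrow> nontrivial_scc H S1) \<and>
        (\<exists>(a, b) \<in> set ar. S1 \<in> min_sccs H (set is) a \<and> S2 \<in> max_sccs H (set is) b))"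
proof -
  have rs': "set (val (reach_t (edge_list h))) = (edge_succ H)\<^sup>+"
    by (simp add: set_reach_t H)
  define rs where "rs = val (reach_t (edge_list h))"
  define Ss where "Ss = val (sccs_t (edge_list h) rs)"
  note rs = rs'[folded rs_def]
  have Ss: "set ` set Ss = sccs H" unfolding Ss_def by (rule set_sccs_t[OF rs H])
  define mi where "mi = (\<lambda>a. val (min_sccs_t rs Ss is a))"
  define ma where "ma = (\<lambda>a. val (max_sccs_t rs Ss is a))"
  have mi: "set ` set (mi a) = min_sccs H (set is) a" for a
    unfolding mi_def by (rule set_min_sccs_t[OF rs H Ss])
  have ma: "set ` set (ma a) = max_sccs H (set is) a" for a
    unfolding ma_def by (rule set_max_sccs_t[OF rs H Ss])
  have sub: "min_sccs H J a \<subseteq> sccs H" "max_sccs H J a \<subseteq> sccs H" for J a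
    unfolding min_sccs_def max_sccs_def Let_def by blast+
  let ?Q = "\<lambda>S1 S2. scc_le H S1 S2 \<and> (S1 = S2 \<longrightarrow> nontrivial_scc H S1) \<and>
        (\<exists>(a, b) \<in> set ar. S1 \<in> min_sccs H (set is) a \<and> S2 \<in> max_sccs H (set is) b)"
  have "val (check_block_t ls ar is h) \<longleftrightarrow>
    (\<exists>S1\<in>set Ss. \<exists>S2\<in>set Ss. val (scc_le_t rs S1 S2) \<and>
       (val (scc_eq_t S1 S2) \<longrightarrow> val (nontrivial_scc_t S1)) \<and>
       (\<exists>(a, b)\<in>set ar. val (listed_t S1 a (map (\<lambda>a. (a, mi a)) ls)) \<and>
                      val (listed_t S2 b (map (\<lambda>a. (a, ma a)) ls))))"
    by (simp add: check_block_t_def val_if_ret_False case_prod_unfold rs_def Ss_def mi_def ma_def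
        split del: if_split)
  also have "\<dots> \<longleftrightarrow> (\<exists>S1\<in>set Ss. \<exists>S2\<in>set Ss. ?Q (set S1) (set S2))"
  proof (intro bex_cong refl)
    fix S1 S2 assume "S1 \<in> set Ss" "S2 \<in> set Ss"
    then have S: "set S1 \<in> sccs H" "set S2 \<in> sccs H" using Ss by blast+
    have "(\<exists>(a, b)\<in>set ar. val (listed_t S1 a (map (\<lambda>a. (a, mi a)) ls)) \<and>
                      val (listed_t S2 b (map (\<lambda>a. (a, ma a)) ls))) \<longleftrightarrow>
          (\<exists>(a, b) \<in> set ar. set S1 \<in> min_sccs H (set is) a \<and> set S2 \<in> max_sccs H (set is) b)"
    proof (intro bex_cong refl)
      fix x assume "x \<in> set ar"
      then obtain a b where x: "x = (a, b)" "a \<in> set ls" "b \<in> set ls" using ar by blast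
      have "val (listed_t S1 a (map (\<lambda>a. (a, mi a)) ls)) \<longleftrightarrow> set S1 \<in> set ` set (mi a)"
        by (rule val_listed_t[OF rs H S(1)]) (use mi sub x in auto)
      moreover have "val (listed_t S2 b (map (\<lambda>a. (a, ma a)) ls)) \<longleftrightarrow> set S2 \<in> set ` set (ma b)"
        by (rule val_listed_t[OF rs H S(2)]) (use ma sub x in auto)
      ultimately show "(case x of (a, b) \<Rightarrow> val (listed_t S1 a (map (\<lambda>a. (a, mi a)) ls)) \<and>
          val (listed_t S2 b (map (\<lambda>a. (a, ma a)) ls))) \<longleftrightarrow>
        (case x of (a, b) \<Rightarrow> set S1 \<in> min_sccs H (set is) a \<and> set S2 \<in> max_sccs H (set is) b)"
        by (simp only: x(1) split_conv mi ma)
    qed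
    then show "(val (scc_le_t rs S1 S2) \<and>
       (val (scc_eq_t S1 S2) \<longrightarrow> val (nontrivial_scc_t S1)) \<and>
       (\<exists>(a, b)\<in>set ar. val (listed_t S1 a (map (\<lambda>a. (a, mi a)) ls)) \<and>
                      val (listed_t S2 b (map (\<lambda>a. (a, ma a)) ls)))) \<longleftrightarrow> ?Q (set S1) (set S2)"
      by (simp only: val_scc_le_t[OF rs H] val_scc_eq_t[OF rs H S] val_nontrivial_scc_t[OF rs H S(1)])
  qed
  also have "\<dots> \<longleftrightarrow> (\<exists>S1\<in>sccs H. \<exists>S2\<in>sccs H. ?Q S1 S2)"
    unfolding Ss[symmetric] by (simp only: bex_simps)
  finally show ?thesis .
qed

lemma val_check_blocks_t:
  fixes f :: "('l, 'a) fusion_rep"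
  assumes "set ar \<subseteq> labels (cfg_of g) \<times> labels (cfg_of g)"
  shows "val (check_blocks_t ar g is f) \<longleftrightarrow> \<not> declared_unsound (set ar) (set is) (fusion_of f)"
proof -
  let ?c = "val (labels_t (edge_list g))"
  have "val (check_block_t ?c ar is h) \<longleftrightarrow> (\<exists>S1 \<in> sccs (cfg_of h). \<exists>S2 \<in> sccs (cfg_of h).
        scc_le (cfg_of h) S1 S2 \<and> (S1 = S2 \<longrightarrow> nontrivial_scc (cfg_of h) S1) \<and>
        (\<exists>(a, b) \<in> set ar. S1 \<in> min_sccs (cfg_of h) (set is) a \<and>
                         S2 \<in> max_sccs (cfg_of h) (set is) b))" for h :: "('l, 'a) cfg_rep"
    using assms by (intro val_check_block_t[OF refl]) simp
  then have "(\<exists>x\<in>set (block_reps f). val (check_block_t ?c ar is (snd x))) \<longleftrightarrow>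
      declared_unsound (set ar) (set is) (fusion_of f)"
    unfolding declared_unsound_def set_blocks_fusion_of case_prod_unfold bex_simps by simp
  then show ?thesis by (simp add: check_blocks_t_def case_prod_unfold)
qed

section \<open>Polynomial bounds on the number of steps\<close>

text \<open>Closure rules for functions of one size parameter take the place of explicit
  coefficients; the polynomial of the final bound is never computed.\<close>

definition polyfun :: "(nat \<Rightarrow> nat) \<Rightarrow> bool" where
  "polyfun f \<longleftrightarrow> (\<exists>p. f = poly p)"

named_theorems polyfun_intros

lemma polyfun_const [polyfun_intros]: "polyfun (\<lambda>n. c)"
  unfolding polyfun_def by (rule exI[of _ "[:c:]"]) auto

lemma polyfun_id [polyfun_intros]: "polyfun (\<lambda>n. n)"
  unfolding polyfun_def by (rule exI[of _ "[:0, 1:]"]) auto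

lemma polyfun_add [polyfun_intros]:
  "polyfun f \<Longrightarrow> polyfun g \<Longrightarrow> polyfun (\<lambda>n. f n + g n)"
  unfolding polyfun_def by (auto simp: fun_eq_iff simp flip: poly_add)

lemma polyfun_mult [polyfun_intros]:
  "polyfun f \<Longrightarrow> polyfun g \<Longrightarrow> polyfun (\<lambda>n. f n * g n)"
  unfolding polyfun_def by (auto simp: fun_eq_iff simp flip: poly_mult)

lemma polyfun_power [polyfun_intros]: "polyfun f \<Longrightarrow> polyfun (\<lambda>n. f n ^ k)"
  unfolding polyfun_def by (auto simp: fun_eq_iff simp flip: poly_power)

text \<open>Each visited cell costs one step besides the test, and the list end one more. A bound
  \<open>n\<close> in place of the length lets later estimates be functions of the input
  size.\<close>

lemma steps_any_t:
  assumes "length xs \<le> n" "\<And>x. x \<in> set xs \<Longrightarrow> steps (p x) \<le> c"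
  shows "steps (any_t p xs) \<le> n * (c + 1) + 1"
proof -
  have "steps (any_t p xs) \<le> length xs * (c + 1) + 1"
    using assms(2)
  proof (induction xs)
    case (Cons x xs)
    then have "steps (p x) \<le> c" "steps (any_t p xs) \<le> length xs * (c + 1) + 1" by auto
    then show ?case by (auto simp: algebra_simps)
  qed simp
  also have "\<dots> \<le> n * (c + 1) + 1" using assms(1) by (intro add_mono mult_right_mono) auto
  finally show ?thesis .
qed

lemma steps_filter_t:
  assumes "length xs \<le> n" "\<And>x. x \<in> set xs \<Longrightarrow> steps (p x) \<le> c"
  shows "steps (filter_t p xs) \<le> n * (c + 1) + 1"
proof -
  have "steps (filter_t p xs) \<le> length xs * (c + 1) + 1"
    using assms(2)
  proof (induction xs)
    case (Cons x xs)
    then have "steps (p x) \<le> c" "steps (filter_t p xs) \<le> length xs * (c + 1) + 1" by auto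
    then show ?case by (auto simp: algebra_simps)
  qed simp
  also have "\<dots> \<le> n * (c + 1) + 1" using assms(1) by (intro add_mono mult_right_mono) auto
  finally show ?thesis .
qed

lemma steps_map_t:
  assumes "length xs \<le> n" "\<And>x. x \<in> set xs \<Longrightarrow> steps (f x) \<le> c"
  shows "steps (map_t f xs) \<le> n * (c + 1) + 1"
proof -
  have "steps (map_t f xs) \<le> length xs * (c + 1) + 1"
    using assms(2)
  proof (induction xs)
    case (Cons x xs)
    then have "steps (f x) \<le> c" "steps (map_t f xs) \<le> length xs * (c + 1) + 1" by auto
    then show ?case by (auto simp: algebra_simps)
  qed simp
  also have "\<dots> \<le> n * (c + 1) + 1" using assms(1) by (intro add_mono mult_right_mono) auto
  finally show ?thesis .
qed

lemma steps_append_t [simp]: "steps (append_t xs ys) = length xs + 1"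
  by (induction xs) auto

text \<open>Per element: one step for the cell, \<open>c\<close> for the call and
  \<open>d + 1\<close> for appending its result.\<close>

lemma steps_concat_map_t:
  assumes "length xs \<le> n"
    and "\<And>x. x \<in> set xs \<Longrightarrow> steps (f x) \<le> c"
    and "\<And>x. x \<in> set xs \<Longrightarrow> length (val (f x)) \<le> d"
  shows "steps (concat_map_t f xs) \<le> n * (c + d + 2) + 1"
    and "length (val (concat_map_t f xs)) \<le> n * d"
proof -
  have "steps (concat_map_t f xs) \<le> length xs * (c + d + 2) + 1"
    using assms(2,3) by (induction xs) (fastforce simp: algebra_simps)+
  also have "\<dots> \<le> n * (c + d + 2) + 1" using assms(1) by (intro add_mono mult_right_mono) auto
  finally show "steps (concat_map_t f xs) \<le> n * (c + d + 2) + 1" .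
  have "length (val (concat_map_t f xs)) \<le> length xs * d"
    using assms(3) by (induction xs) (auto intro!: add_mono)
  also have "\<dots> \<le> n * d" using assms(1) by simp
  finally show "length (val (concat_map_t f xs)) \<le> n * d" .
qed

lemma steps_mem_t: "length xs \<le> n \<Longrightarrow> steps (mem_t x xs) \<le> 2 * n + 1"
  unfolding mem_t_def using steps_any_t[of xs n "eq_t x" 1] by simp

definition remdups_cost :: "nat \<Rightarrow> nat" where
  "remdups_cost n = n * (2 * n + 2) + 1"

lemma remdups_cost_mono: "m \<le> n \<Longrightarrow> remdups_cost m \<le> remdups_cost n"
  unfolding remdups_cost_def by (intro add_mono mult_mono) auto

lemma steps_remdups_t:
  assumes "length xs \<le> n"
  shows "steps (remdups_t xs) \<le> remdups_cost n"
proof -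
  have "steps (remdups_t xs) \<le> remdups_cost (length xs)"
  proof (induction xs)
    case (Cons x xs)
    have "steps (mem_t x xs) \<le> 2 * length xs + 1" by (rule steps_mem_t) simp
    then show ?case using Cons by (simp add: remdups_cost_def algebra_simps)
  qed (simp add: remdups_cost_def)
  then show ?thesis using remdups_cost_mono[OF assms] by linarith
qed

lemma steps_product_t:
  assumes "length xs \<le> n" "length ys \<le> m"
  shows "steps (product_t xs ys) \<le> n * (2 * m + 3) + 1"
proof -
  have "steps (map_t (\<lambda>y. ret (x, y)) ys) \<le> m + 1" for x
    using steps_map_t[OF assms(2), of "\<lambda>y. ret (x, y)" 0] by simp
  then have "steps (product_t xs ys) \<le> n * ((m + 1) + m + 2) + 1"
    unfolding product_t_def using assms by (intro steps_concat_map_t) auto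
  then show ?thesis by (simp add: algebra_simps)
qed

lemma length_product_t:
  assumes "length xs \<le> n" "length ys \<le> m"
  shows "length (val (product_t xs ys)) \<le> n * m"
  using assms by (simp add: mult_mono)

definition union_cost :: "nat \<Rightarrow> nat \<Rightarrow> nat" where
  "union_cost m n = m + 1 + remdups_cost (m + n)"

lemma length_remdups_le: "length xs \<le> n \<Longrightarrow> length (remdups xs) \<le> n"
  using length_remdups_leq le_trans by blast

lemma steps_union_t:
  assumes "length xs \<le> m" "length ys \<le> n"
  shows "steps (union_t xs ys) \<le> union_cost m n" "length (val (union_t xs ys)) \<le> m + n"
  using assms steps_remdups_t[of "xs @ ys" "m + n"]
  by (auto simp: union_t_def union_cost_def intro!: length_remdups_le)

definition comp_cost :: "nat \<Rightarrow> nat \<Rightarrow> nat" where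
  "comp_cost m n = m * (4 * n + 4) + 1 + remdups_cost (m * n)"

lemma steps_comp_t:
  assumes "length R \<le> m" "length Q \<le> n"
  shows "steps (comp_t R Q) \<le> comp_cost m n" "length (val (comp_t R Q)) \<le> m * n"
proof -
  let ?f = "\<lambda>p. do { Q' \<leftarrow> filter_t (\<lambda>q. eq_t (snd p) (fst q)) Q; map_t (\<lambda>q. ret (fst p, snd q)) Q' }"
  have len: "length (filter P Q) \<le> n" for P
    using assms(2) length_filter_le le_trans by blast
  have f: "steps (?f p) \<le> 3 * n + 2" "length (val (?f p)) \<le> n" for p
    using steps_filter_t[OF assms(2), of "\<lambda>q. eq_t (snd p) (fst q)" 1]
      steps_map_t[OF len, of "\<lambda>q. snd p = fst q" "\<lambda>q. ret (fst p, snd q)" 0] len by auto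
  have "steps (concat_map_t ?f R) \<le> m * (3 * n + 2 + n + 2) + 1"
    by (intro steps_concat_map_t assms f)
  then have c: "steps (concat_map_t ?f R) \<le> m * (4 * n + 4) + 1" by (simp add: algebra_simps)
  have l: "length (val (concat_map_t ?f R)) \<le> m * n"
    by (rule steps_concat_map_t(2)[of R m ?f "3 * n + 2" n]) (intro assms f)+
  show "steps (comp_t R Q) \<le> comp_cost m n"
    unfolding comp_t_def steps_bind comp_cost_def by (intro add_mono c steps_remdups_t l)
  show "length (val (comp_t R Q)) \<le> m * n"
    unfolding comp_t_def val_bind val_remdups_t by (intro length_remdups_le l)
qed

definition trancl_cost :: "nat \<Rightarrow> nat" where
  "trancl_cost n = n * (1 + comp_cost (n * n) n + union_cost (n * n) (n * n * n)) + 1"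

text \<open>Estimating iteration by iteration would multiply the length by about \<open>n\<close>
  each time. The bound comes from the contents instead: after an iteration the list has no
  repetitions, and its pairs join a source of \<open>R\<close> to a target of
  \<open>R\<close>.\<close>

lemma length_trancl_iter_t:
  assumes "length R \<le> n"
  shows "length (val (trancl_iter_t R xs)) \<le> n * n"
proof (cases xs)
  case Nil
  \<comment> \<open>Without an iteration the list is \<open>R\<close> itself, possibly with
    repetitions, so that only its length is available.\<close>
  have "n \<le> n * n" by (cases n) auto
  then show ?thesis using Nil assms by (simp add: le_trans)
next
  case (Cons x ys)
  let ?L = "val (trancl_iter_t R xs)"
  have "distinct ?L" unfolding Cons by (simp add: union_t_def)
  then have "length ?L = card (set ?L)" by (simp add: distinct_card)
  also have "\<dots> \<le> card (fst ` set R \<times> snd ` set R)"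
  proof (rule card_mono)
    have "set ?L \<subseteq> (set R)\<^sup>+"
      unfolding set_trancl_iter_t by (auto simp: ntrancl_def trancl_power)
    also have "\<dots> \<subseteq> fst ` set R \<times> snd ` set R"
      by (metis Domain_fst Range_snd mem_Sigma_iff trancl_domain trancl_range subrelI DomainI RangeI)
    finally show "set ?L \<subseteq> fst ` set R \<times> snd ` set R" .
  qed simp
  also have "\<dots> \<le> length R * length R"
    unfolding card_cartesian_product
    by (intro mult_mono) (auto intro: le_trans[OF card_image_le] card_length)
  also have "\<dots> \<le> n * n" using assms by (simp add: mult_mono)
  finally show ?thesis .
qed

lemma steps_trancl_t:
  assumes "length R \<le> n"
  shows "steps (trancl_t R) \<le> trancl_cost n" "length (val (trancl_t R)) \<le> n * n"
proof -
  let ?c = "1 + comp_cost (n * n) n + union_cost (n * n) (n * n * n)"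
  have "steps (trancl_iter_t R xs) \<le> length xs * ?c + 1" for xs :: "'b list"
  proof (induction xs)
    case (Cons x xs)
    let ?Q = "val (trancl_iter_t R xs)"
    have Q: "length ?Q \<le> n * n" by (rule length_trancl_iter_t[OF assms])
    have "steps (comp_t ?Q R) \<le> comp_cost (n * n) n"
      "length (val (comp_t ?Q R)) \<le> n * n * n"
      using steps_comp_t[OF Q assms] by auto
    moreover from this have "steps (union_t ?Q (val (comp_t ?Q R))) \<le> union_cost (n * n) (n * n * n)"
      by (intro steps_union_t Q)
    ultimately show ?case using Cons by simp
  qed simp
  then have "steps (trancl_t R) \<le> length R * ?c + 1" unfolding trancl_t_def .
  also have "\<dots> \<le> trancl_cost n" unfolding trancl_cost_def using assms by (intro add_mono mult_mono) auto
  finally show "steps (trancl_t R) \<le> trancl_cost n" .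
  show "length (val (trancl_t R)) \<le> n * n"
    unfolding trancl_t_def by (rule length_trancl_iter_t[OF assms])
qed

definition reach_cost :: "nat \<Rightarrow> nat" where
  "reach_cost n = n * (2 * n + 3) + 1 + (n * n * 2 + 1) + trancl_cost (n * n)"

lemma steps_reach_t:
  assumes "length es \<le> n"
  shows "steps (reach_t es) \<le> reach_cost n" "length (val (reach_t es)) \<le> n * n * (n * n)"
proof -
  let ?P = "val (product_t es es)" and ?p = "\<lambda>(e, f). eq_t (tgt e) (src f)"
  have P: "length ?P \<le> n * n" by (rule length_product_t[OF assms assms])
  have "steps (filter_t ?p ?P) \<le> n * n * (1 + 1) + 1" by (rule steps_filter_t[OF P]) auto
  moreover have l: "length (val (filter_t ?p ?P)) \<le> n * n"
    unfolding val_filter_t by (rule le_trans[OF length_filter_le P])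
  ultimately show "steps (reach_t es) \<le> reach_cost n"
    using steps_trancl_t(1)[OF l] steps_product_t[OF assms assms]
    unfolding reach_t_def steps_bind val_bind reach_cost_def by simp
  show "length (val (reach_t es)) \<le> n * n * (n * n)"
    using steps_trancl_t(2)[OF l] unfolding reach_t_def val_bind .
qed

lemma polyfun_remdups_cost [polyfun_intros]:
  "polyfun f \<Longrightarrow> polyfun (\<lambda>n. remdups_cost (f n))"
  unfolding remdups_cost_def by (intro polyfun_intros)

lemma polyfun_union_cost [polyfun_intros]:
  "polyfun f \<Longrightarrow> polyfun g \<Longrightarrow> polyfun (\<lambda>n. union_cost (f n) (g n))"
  unfolding union_cost_def by (intro polyfun_intros)

lemma polyfun_comp_cost [polyfun_intros]:
  "polyfun f \<Longrightarrow> polyfun g \<Longrightarrow> polyfun (\<lambda>n. comp_cost (f n) (g n))"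
  unfolding comp_cost_def by (intro polyfun_intros)

lemma polyfun_trancl_cost [polyfun_intros]:
  "polyfun f \<Longrightarrow> polyfun (\<lambda>n. trancl_cost (f n))"
  unfolding trancl_cost_def by (intro polyfun_intros)

lemma polyfun_reach_cost [polyfun_intros]:
  "polyfun f \<Longrightarrow> polyfun (\<lambda>n. reach_cost (f n))"
  unfolding reach_cost_def by (intro polyfun_intros)

definition po_cost :: "nat \<Rightarrow> nat" where
  "po_cost n = reach_cost n + (n ^ 4 * 1 + 1) + (n * 1 + 1) + union_cost (n ^ 4) n"

lemma steps_reach_t':
  "length es \<le> n \<Longrightarrow> length (val (reach_t es)) \<le> n ^ 4"
  using steps_reach_t(2)[of es n] by (simp add: power4_eq_xxxx mult.assoc)

lemma steps_po_t:
  assumes "length es \<le> n"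
  shows "steps (po_t es) \<le> po_cost n" "length (val (po_t es)) \<le> n ^ 4 + n"
proof -
  let ?r = "val (reach_t es)"
  let ?P = "map_t (\<lambda>(e, f). ret (lab e, lab f)) ?r" and ?Q = "map_t (\<lambda>e. ret (lab e, lab e)) es"
  note r = steps_reach_t'[OF assms]
  have "steps ?P \<le> n ^ 4 * (0 + 1) + 1" by (rule steps_map_t[OF r]) auto
  moreover have "steps ?Q \<le> n * (0 + 1) + 1" by (rule steps_map_t[OF assms]) auto
  moreover have l: "length (val ?P) \<le> n ^ 4" "length (val ?Q) \<le> n" using r assms by auto
  ultimately show "steps (po_t es) \<le> po_cost n"
    using steps_union_t(1)[OF l] steps_reach_t(1)[OF assms]
    unfolding po_t_def steps_bind val_bind po_cost_def by simp
  show "length (val (po_t es)) \<le> n ^ 4 + n"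
    using steps_union_t(2)[OF l] unfolding po_t_def val_bind .
qed

definition atomic_cost :: "nat \<Rightarrow> nat" where
  "atomic_cost n = n * (reach_cost n + (n ^ 4 * 1 + 1) + n ^ 4 + 2) + 1"

lemma steps_atomic_rel_t:
  assumes "length bs \<le> n" "\<forall>x\<in>set bs. length (edge_list (snd x)) \<le> n"
  shows "steps (atomic_rel_t bs) \<le> atomic_cost n" "length (val (atomic_rel_t bs)) \<le> n * n ^ 4"
proof -
  let ?f = "\<lambda>(\<beta>, h). do { rs \<leftarrow> reach_t (edge_list h); map_t (\<lambda>(e, f). ret (lab f, lab e)) rs }"
  have f: "steps (?f x) \<le> reach_cost n + (n ^ 4 * 1 + 1) \<and> length (val (?f x)) \<le> n ^ 4"
    if x: "x \<in> set bs" for x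
  proof -
    obtain \<beta> h where h: "x = (\<beta>, h)" by (rule prod.exhaust)
    have len: "length (edge_list h) \<le> n" using assms(2) x h by force
    have "steps (map_t (\<lambda>(e, f). ret (lab f, lab e)) (val (reach_t (edge_list h)))) \<le> n ^ 4 * (0 + 1) + 1"
      by (rule steps_map_t[OF steps_reach_t'[OF len]]) auto
    then show ?thesis using steps_reach_t(1)[OF len] steps_reach_t'[OF len] by (simp add: h)
  qed
  note * = steps_concat_map_t[of bs n ?f "reach_cost n + (n ^ 4 * 1 + 1)" "n ^ 4", OF assms(1)]
  show "steps (atomic_rel_t bs) \<le> atomic_cost n"
    unfolding atomic_rel_t_def atomic_cost_def using f by (intro *(1)) blast+
  show "length (val (atomic_rel_t bs)) \<le> n * n ^ 4"
    unfolding atomic_rel_t_def using f by (intro *(2)) blast+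
qed

lemma steps_labels_t:
  assumes "length es \<le> n"
  shows "steps (labels_t es) \<le> n + 1 + remdups_cost n" "length (val (labels_t es)) \<le> n"
proof -
  have "steps (map_t (\<lambda>e. ret (lab e)) es) \<le> n * (0 + 1) + 1" by (rule steps_map_t[OF assms]) auto
  then show "steps (labels_t es) \<le> n + 1 + remdups_cost n"
    using assms unfolding labels_t_def steps_bind by (intro add_mono steps_remdups_t) auto
  show "length (val (labels_t es)) \<le> n"
    using assms by (auto simp: labels_t_def intro!: length_remdups_le)
qed

definition dependence_cost :: "nat \<Rightarrow> nat" where
  "dependence_cost n = n * (2 * n + 3) + 1 + (n * n * (2 * n + 1 + 1) + 1)"

lemma steps_dependence_t:
  assumes "length ls \<le> n" "length is \<le> n"
  shows "steps (dependence_t ls is) \<le> dependence_cost n" "length (val (dependence_t ls is)) \<le> n * n"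
proof -
  let ?P = "val (product_t ls ls)" and ?p = "\<lambda>p. do { b \<leftarrow> mem_t p is; ret (\<not> b) }"
  have P: "length ?P \<le> n * n" by (rule length_product_t[OF assms(1) assms(1)])
  have "steps (filter_t ?p ?P) \<le> n * n * (2 * n + 1 + 1) + 1"
    by (rule steps_filter_t[OF P]) (simp add: steps_mem_t[OF assms(2), simplified])
  then show "steps (dependence_t ls is) \<le> dependence_cost n"
    using steps_product_t[OF assms(1) assms(1)]
    unfolding dependence_t_def steps_bind dependence_cost_def by (intro add_mono)
  show "length (val (dependence_t ls is)) \<le> n * n"
    unfolding dependence_t_def val_bind val_filter_t by (rule le_trans[OF length_filter_le P])
qed

text \<open>\<open>n ^ 4\<close> bounds a reachability list: at most \<open>n * n\<close> pairs of
  consecutive edges, squared by the closure. The summand \<open>n\<close> is the diagonal of program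
  order, and the last one stems from up to \<open>n\<close> blocks. As an input abbreviation it is
  plain arithmetic for \<open>polyfun_intros\<close>.\<close>

abbreviation (input) pa_len :: "nat \<Rightarrow> nat" where
  "pa_len n \<equiv> n ^ 4 + n + n * n ^ 4"

definition base_cost :: "nat \<Rightarrow> nat" where
  "base_cost n = (n + 1 + remdups_cost n) + dependence_cost n + po_cost n + atomic_cost n
     + union_cost (n ^ 4 + n) (n * n ^ 4) + comp_cost (pa_len n) (n * n)
     + trancl_cost (pa_len n * (n * n))"

abbreviation (input) chain_len :: "nat \<Rightarrow> nat" where
  "chain_len n \<equiv> pa_len n * (n * n) * (pa_len n * (n * n))"

definition arrow_cost :: "nat \<Rightarrow> nat" where
  "arrow_cost n = base_cost n + comp_cost (n * n) (chain_len n)"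

definition inner_arrow_cost :: "nat \<Rightarrow> nat" where
  "inner_arrow_cost n = base_cost n + comp_cost (chain_len n) (pa_len n)
     + union_cost (pa_len n) (chain_len n * pa_len n)"

context
  fixes g :: "('l, 'a) cfg_rep" and "is" :: "('a \<times> 'a) list" and f :: "('l, 'a) fusion_rep"
    and n :: nat
  assumes len: "length (edge_list g) \<le> n" "length is \<le> n" "length (block_reps f) \<le> n"
    "\<forall>x\<in>set (block_reps f). length (edge_list (snd x)) \<le> n"
begin

private abbreviation "D \<equiv> dependence_t (val (labels_t (edge_list g))) is"
private abbreviation "P \<equiv> po_t (edge_list g)"
private abbreviation "A \<equiv> atomic_rel_t (block_reps f)"
private abbreviation "PA \<equiv> union_t (val P) (val A)"
private abbreviation "Q \<equiv> comp_t (val PA) (val D)"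
private abbreviation "Q' \<equiv> trancl_t (val Q)"

private lemma lens:
  "length (val D) \<le> n * n" "length (val PA) \<le> pa_len n" "length (val Q') \<le> chain_len n"
  and base: "steps (labels_t (edge_list g)) + steps D + steps P + steps A + steps PA + steps Q
    + steps Q' \<le> base_cost n"
proof -
  note L = steps_labels_t[OF len(1)]
  note D = steps_dependence_t[OF L(2) len(2)]
  note P = steps_po_t[OF len(1)]
  note A = steps_atomic_rel_t[OF len(3,4)]
  note PA = steps_union_t[OF P(2) A(2)]
  note Q = steps_comp_t[OF PA(2) D(2)]
  note Q' = steps_trancl_t[OF Q(2)]
  show "length (val D) \<le> n * n" "length (val PA) \<le> pa_len n" "length (val Q') \<le> chain_len n"
    by (fact D PA Q')+
  show "steps (labels_t (edge_list g)) + steps D + steps P + steps A + steps PA + steps Q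
    + steps Q' \<le> base_cost n"
    unfolding base_cost_def by (intro add_mono L D P A PA Q Q')
qed

lemma steps_arrow_t:
  "steps (arrow_t g is f) \<le> arrow_cost n" "length (val (arrow_t g is f)) \<le> n * n * chain_len n"
proof -
  note * = steps_comp_t[OF lens(1,3)]
  show "steps (arrow_t g is f) \<le> arrow_cost n"
    using base *(1) unfolding arrow_t_def steps_bind val_bind arrow_cost_def by linarith
  show "length (val (arrow_t g is f)) \<le> n * n * chain_len n"
    using *(2) unfolding arrow_t_def val_bind .
qed

lemma steps_inner_arrow_t:
  "steps (inner_arrow_t g is f) \<le> inner_arrow_cost n"
  "length (val (inner_arrow_t g is f)) \<le> pa_len n + chain_len n * pa_len n"
proof -
  note R = steps_comp_t[OF lens(3,2)]
  note U = steps_union_t[OF lens(2) R(2)]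
  show "steps (inner_arrow_t g is f) \<le> inner_arrow_cost n"
    using base R(1) U(1) unfolding inner_arrow_t_def steps_bind val_bind inner_arrow_cost_def
    by linarith
  show "length (val (inner_arrow_t g is f)) \<le> pa_len n + chain_len n * pa_len n"
    using U(2) unfolding inner_arrow_t_def val_bind .
qed

end

lemma polyfun_arrow_costs [polyfun_intros]: "polyfun (\<lambda>n. arrow_cost n)" "polyfun (\<lambda>n. inner_arrow_cost n)"
  unfolding arrow_cost_def inner_arrow_cost_def base_cost_def dependence_cost_def po_cost_def
    atomic_cost_def
  by (intro polyfun_intros)+

section \<open>Cost of steps 2 to 5\<close>

definition reaches_cost :: "nat \<Rightarrow> nat" where
  "reaches_cost r = 2 * r + 2"

lemma steps_reaches_t: "length rs \<le> r \<Longrightarrow> steps (reaches_t e f rs) \<le> reaches_cost r"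
  using steps_mem_t[of rs r "(e, f)"] by (simp add: reaches_t_def reaches_cost_def)

definition any2_cost :: "nat \<Rightarrow> nat \<Rightarrow> nat" where
  "any2_cost n c = n * (n * (c + 1) + 1 + 1) + 1"

lemma steps_any2_t:
  assumes "length xs \<le> n" "length ys \<le> n" "\<And>x y. x \<in> set xs \<Longrightarrow> y \<in> set ys \<Longrightarrow> steps (p x y) \<le> c"
  shows "steps (any_t (\<lambda>x. any_t (p x) ys) xs) \<le> any2_cost n c"
  unfolding any2_cost_def using assms by (intro steps_any_t)

lemma steps_scc_le_t:
  assumes "length rs \<le> r" "length S \<le> n" "length T \<le> n"
  shows "steps (scc_le_t rs S T) \<le> any2_cost n (reaches_cost r)"
  unfolding scc_le_t_def using assms by (intro steps_any2_t steps_reaches_t)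

definition mem2_cost :: "nat \<Rightarrow> nat" where
  "mem2_cost n = n * (2 * n + 1 + 1) + 1"

lemma steps_scc_eq_t:
  assumes "length S \<le> n" "length T \<le> n"
  shows "steps (scc_eq_t S T) \<le> mem2_cost n"
  unfolding scc_eq_t_def mem2_cost_def using assms by (intro steps_any_t steps_mem_t)

lemma steps_nontrivial_scc_t:
  assumes "length S \<le> n"
  shows "steps (nontrivial_scc_t S) \<le> any2_cost n 2"
  unfolding nontrivial_scc_t_def using assms by (intro steps_any2_t) auto

definition scc_of_cost :: "nat \<Rightarrow> nat \<Rightarrow> nat" where
  "scc_of_cost n r = n * (2 * reaches_cost r + 1) + 1"

lemma steps_scc_of_t:
  assumes "length rs \<le> r" "length es \<le> n"
  shows "steps (scc_of_t es rs e) \<le> scc_of_cost n r" "length (val (scc_of_t es rs e)) \<le> n"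
proof -
  have "steps (reaches_t e f rs) + steps (reaches_t f e rs) \<le> 2 * reaches_cost r" for f
    using steps_reaches_t[OF assms(1), of e f] steps_reaches_t[OF assms(1), of f e] by linarith
  then show "steps (scc_of_t es rs e) \<le> scc_of_cost n r"
    unfolding scc_of_t_def scc_of_cost_def using assms by (intro steps_filter_t) auto
  show "length (val (scc_of_t es rs e)) \<le> n"
    unfolding scc_of_t_def val_filter_t by (rule le_trans[OF length_filter_le assms(2)])
qed

definition sccs_cost :: "nat \<Rightarrow> nat \<Rightarrow> nat" where
  "sccs_cost n r = remdups_cost n + (n * (1 + mem2_cost n + scc_of_cost n r) + 1)"

lemma steps_sccs_iter_t:
  assumes "length rs \<le> r" "length es \<le> n"
  shows "length fs \<le> n \<Longrightarrow> steps (sccs_iter_t es rs fs) \<le>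
      length fs * (1 + mem2_cost n + scc_of_cost n r) + 1 \<and>
    length (val (sccs_iter_t es rs fs)) \<le> length fs \<and>
    (\<forall>S\<in>set (val (sccs_iter_t es rs fs)). length S \<le> n)"
proof (induction fs)
  case (Cons e fs)
  let ?Ss = "val (sccs_iter_t es rs fs)"
  have IH: "steps (sccs_iter_t es rs fs) \<le> length fs * (1 + mem2_cost n + scc_of_cost n r) + 1"
    "length ?Ss \<le> length fs" "\<And>S. S \<in> set ?Ss \<Longrightarrow> length S \<le> n"
    using Cons by auto
  have "steps (any_t (mem_t e) ?Ss) \<le> mem2_cost n"
    unfolding mem2_cost_def using IH Cons.prems by (intro steps_any_t steps_mem_t) auto
  then show ?case using IH steps_scc_of_t[OF assms, of e] by auto
qed simp

lemma steps_sccs_t: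
  assumes "length rs \<le> r" "length es \<le> n"
  shows "steps (sccs_t es rs) \<le> sccs_cost n r" "length (val (sccs_t es rs)) \<le> n"
    "\<And>S. S \<in> set (val (sccs_t es rs)) \<Longrightarrow> length S \<le> n"
proof -
  have l: "length (remdups es) \<le> n" by (rule length_remdups_le[OF assms(2)])
  note * = steps_sccs_iter_t[OF assms(1) l l]
  have "length (remdups es) * (1 + mem2_cost n + scc_of_cost n r) + 1 \<le>
      n * (1 + mem2_cost n + scc_of_cost n r) + 1"
    using l by (intro add_mono mult_right_mono) auto
  then show "steps (sccs_t es rs) \<le> sccs_cost n r"
    using * steps_remdups_t[OF assms(2)]
    unfolding sccs_t_def steps_bind val_remdups_t sccs_cost_def by linarith
  show "length (val (sccs_t es rs)) \<le> n"
    using * l unfolding sccs_t_def val_bind val_remdups_t by linarith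
  show "\<And>S. S \<in> set (val (sccs_t es rs)) \<Longrightarrow> length S \<le> n"
    using * unfolding sccs_t_def val_bind val_remdups_t by blast
qed

definition minmax_cost :: "nat \<Rightarrow> nat \<Rightarrow> nat" where
  "minmax_cost n r = n * (mem2_cost n + 1) + 1 +
     any2_cost n (any2_cost n (reaches_cost r) + mem2_cost n)"

text \<open>The computations of minimal and of maximal SCCs share this shape: select the dependent
  SCCs, then drop those beaten by another selected one.\<close>

lemma filter_filter_cost:
  assumes "length Ss \<le> n"
    and "\<And>S. S \<in> set Ss \<Longrightarrow> steps (p S) \<le> c"
    and "\<And>S T. S \<in> set Ss \<Longrightarrow> T \<in> set Ss \<Longrightarrow> steps (q S T) \<le> d"
  shows "steps (do { M \<leftarrow> filter_t p Ss;
      filter_t (\<lambda>S. do { b \<leftarrow> any_t (q S) M; ret (\<not> b) }) M }) \<le>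
    n * (c + 1) + 1 + any2_cost n d"
    and "length (val (do { M \<leftarrow> filter_t p Ss;
      filter_t (\<lambda>S. do { b \<leftarrow> any_t (q S) M; ret (\<not> b) }) M })) \<le> n"
proof -
  let ?M = "val (filter_t p Ss)"
  have M: "length ?M \<le> n" "set ?M \<subseteq> set Ss"
    using le_trans[OF length_filter_le assms(1)] by auto
  have "steps (any_t (q S) ?M) \<le> n * (d + 1) + 1" if "S \<in> set ?M" for S
    using assms(3) that M by (intro steps_any_t) blast+
  then have "steps (filter_t (\<lambda>S. do { b \<leftarrow> any_t (q S) ?M; ret (\<not> b) }) ?M) \<le> any2_cost n d"
    unfolding any2_cost_def using M by (intro steps_filter_t) auto
  then show "steps (do { M \<leftarrow> filter_t p Ss;
      filter_t (\<lambda>S. do { b \<leftarrow> any_t (q S) M; ret (\<not> b) }) M }) \<le> n * (c + 1) + 1 + any2_cost n d"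
    unfolding steps_bind[of "filter_t p Ss"] using assms by (intro add_mono steps_filter_t) auto
  show "length (val (do { M \<leftarrow> filter_t p Ss;
      filter_t (\<lambda>S. do { b \<leftarrow> any_t (q S) M; ret (\<not> b) }) M })) \<le> n"
    unfolding val_bind[of "filter_t p Ss"] val_filter_t[of _ ?M]
    by (rule le_trans[OF length_filter_le M(1)])
qed

context
  fixes rs :: "(('l, 'a) edge \<times> ('l, 'a) edge) list" and Ss :: "('l, 'a) edge list list"
    and "is" :: "('a \<times> 'a) list" and n r :: nat
  assumes len: "length rs \<le> r" "length Ss \<le> n" "\<And>S. S \<in> set Ss \<Longrightarrow> length S \<le> n" "length is \<le> n"
begin

private lemma le_eq:
  assumes "S \<in> set Ss" "T \<in> set Ss" "S' \<in> set Ss" "T' \<in> set Ss"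
  shows "steps (do { c \<leftarrow> scc_le_t rs S T; d \<leftarrow> scc_eq_t S' T'; ret (c \<and> \<not> d) }) \<le>
      any2_cost n (reaches_cost r) + mem2_cost n"
  using steps_scc_le_t[OF len(1), of S n T] steps_scc_eq_t[of S' n T'] len(3) assms by simp

private lemma dep:
  assumes "S \<in> set Ss"
  shows "steps (any_t (\<lambda>e. do { b \<leftarrow> mem_t (u e) is; ret (\<not> b) }) S) \<le> mem2_cost n"
  unfolding mem2_cost_def using steps_mem_t[OF len(4)] len(3)[OF assms] by (intro steps_any_t) auto

lemma steps_min_sccs_t:
  "steps (min_sccs_t rs Ss is a) \<le> minmax_cost n r"
  "length (val (min_sccs_t rs Ss is a)) \<le> n"
proof -
  show "steps (min_sccs_t rs Ss is a) \<le> minmax_cost n r"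
    unfolding min_sccs_t_def minmax_cost_def by (intro filter_filter_cost len dep le_eq)
  show "length (val (min_sccs_t rs Ss is a)) \<le> n"
    unfolding min_sccs_t_def by (rule filter_filter_cost(2)[OF len(2) dep le_eq])
qed

lemma steps_max_sccs_t:
  "steps (max_sccs_t rs Ss is a) \<le> minmax_cost n r"
  "length (val (max_sccs_t rs Ss is a)) \<le> n"
proof -
  show "steps (max_sccs_t rs Ss is a) \<le> minmax_cost n r"
    unfolding max_sccs_t_def minmax_cost_def by (intro filter_filter_cost len dep le_eq)
  show "length (val (max_sccs_t rs Ss is a)) \<le> n"
    unfolding max_sccs_t_def by (rule filter_filter_cost(2)[OF len(2) dep le_eq])
qed

end

definition listed_cost :: "nat \<Rightarrow> nat" where
  "listed_cost n = n * (1 + (n * (mem2_cost n + 1) + 1) + 1) + 1"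

lemma steps_listed_t:
  assumes "length S \<le> n" "length table \<le> n"
    and "\<And>a Ts. (a, Ts) \<in> set table \<Longrightarrow> length Ts \<le> n \<and> (\<forall>T\<in>set Ts. length T \<le> n)"
  shows "steps (listed_t S a table) \<le> listed_cost n"
  unfolding listed_t_def listed_cost_def
proof (rule steps_any_t[OF assms(2)])
  fix x assume x: "x \<in> set table"
  obtain a' Ts where eq: "x = (a', Ts)" by (rule prod.exhaust)
  have "steps (any_t (scc_eq_t S) Ts) \<le> n * (mem2_cost n + 1) + 1"
    using assms(3) x assms(1) unfolding eq by (intro steps_any_t steps_scc_eq_t) blast+
  then show "steps (case x of (a', Ts) \<Rightarrow>
      do { b \<leftarrow> eq_t a a'; if b then any_t (scc_eq_t S) Ts else ret False }) \<le>
    1 + (n * (mem2_cost n + 1) + 1)"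
    by (simp add: eq)
qed

text \<open>\<open>k\<close> bounds the number of pairs found in step 1. It is kept apart from
  \<open>n\<close> because the two versions of step 1 have different bounds.\<close>

definition check_block_cost :: "nat \<Rightarrow> nat \<Rightarrow> nat" where
  "check_block_cost n k = reach_cost n + sccs_cost n (n ^ 4) +
     2 * (n * (minmax_cost n (n ^ 4) + 1) + 1) +
     any2_cost n (any2_cost n (reaches_cost (n ^ 4)) + mem2_cost n + any2_cost n 2 +
       (k * (2 * listed_cost n + 1) + 1))"

lemma set_val_min_max_sccs_t:
  "set (val (min_sccs_t rs Ss is a)) \<subseteq> set Ss" "set (val (max_sccs_t rs Ss is a)) \<subseteq> set Ss"
  by (auto simp: min_sccs_t_def max_sccs_t_def)

lemma steps_check_block_t:
  assumes "length (edge_list h) \<le> n" "length ls \<le> n" "length is \<le> n" "length ar \<le> k"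
  shows "steps (check_block_t ls ar is h) \<le> check_block_cost n k"
proof -
  define rs where "rs = val (reach_t (edge_list h))"
  define Ss where "Ss = val (sccs_t (edge_list h) rs)"
  define mi where "mi = (\<lambda>a. do { Ts \<leftarrow> min_sccs_t rs Ss is a; ret (a, Ts) })"
  define ma where "ma = (\<lambda>a. do { Ts \<leftarrow> max_sccs_t rs Ss is a; ret (a, Ts) })"
  have rs: "length rs \<le> n ^ 4" unfolding rs_def by (rule steps_reach_t'[OF assms(1)])
  note S = steps_sccs_t[OF rs assms(1), folded Ss_def]
  note mm = steps_min_sccs_t[OF rs S(2,3) assms(3)] steps_max_sccs_t[OF rs S(2,3) assms(3)]
  have mins: "steps (map_t mi ls) \<le> n * (minmax_cost n (n ^ 4) + 1) + 1"
    using mm unfolding mi_def by (intro steps_map_t assms) auto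
  have maxs: "steps (map_t ma ls) \<le> n * (minmax_cost n (n ^ 4) + 1) + 1"
    using mm unfolding ma_def by (intro steps_map_t assms) auto
  let ?body = "\<lambda>S1 S2. do { le \<leftarrow> scc_le_t rs S1 S2; eq \<leftarrow> scc_eq_t S1 S2; nt \<leftarrow> nontrivial_scc_t S1;
    if le \<and> (eq \<longrightarrow> nt)
    then any_t (\<lambda>(a, b). do { c \<leftarrow> listed_t S1 a (val (map_t mi ls));
                             d \<leftarrow> listed_t S2 b (val (map_t ma ls)); ret (c \<and> d) }) ar
    else ret False }"
  have body: "steps (?body S1 S2) \<le> any2_cost n (reaches_cost (n ^ 4)) + mem2_cost n + any2_cost n 2 +
       (k * (2 * listed_cost n + 1) + 1)" if "S1 \<in> set Ss" "S2 \<in> set Ss" for S1 S2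
  proof -
    have l: "length S1 \<le> n" "length S2 \<le> n" using S(3) that by auto
    have "length Ts \<le> n \<and> (\<forall>T\<in>set Ts. length T \<le> n)"
      if "(a, Ts) \<in> set (val (map_t mi ls))" for a Ts
      using that mm(2) S(3) set_val_min_max_sccs_t(1)[of rs Ss "is"] by (auto simp: mi_def)
    then have c1: "steps (listed_t S1 a (val (map_t mi ls))) \<le> listed_cost n" for a
      by (intro steps_listed_t l) (use assms(2) in auto)
    have "length Ts \<le> n \<and> (\<forall>T\<in>set Ts. length T \<le> n)"
      if "(a, Ts) \<in> set (val (map_t ma ls))" for a Ts
      using that mm(4) S(3) set_val_min_max_sccs_t(2)[of rs Ss "is"] by (auto simp: ma_def)
    then have c2: "steps (listed_t S2 a (val (map_t ma ls))) \<le> listed_cost n" for a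
      by (intro steps_listed_t l) (use assms(2) in auto)
    have "steps (any_t (\<lambda>(a, b). do { c \<leftarrow> listed_t S1 a (val (map_t mi ls));
        d \<leftarrow> listed_t S2 b (val (map_t ma ls)); ret (c \<and> d) }) ar) \<le> k * (2 * listed_cost n + 1) + 1"
    proof (rule steps_any_t[OF assms(4)])
      fix x
      show "steps (case x of (a, b) \<Rightarrow> do { c \<leftarrow> listed_t S1 a (val (map_t mi ls));
        d \<leftarrow> listed_t S2 b (val (map_t ma ls)); ret (c \<and> d) }) \<le> 2 * listed_cost n"
        using c1[of "fst x"] c2[of "snd x"] by (simp add: case_prod_unfold)
    qed
    then show ?thesis
      using steps_scc_le_t[OF rs l] steps_scc_eq_t[OF l] steps_nontrivial_scc_t[OF l(1)]
      unfolding steps_bind by (simp del: val_map_t)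
  qed
  have "steps (any_t (\<lambda>S1. any_t (?body S1) Ss) Ss) \<le>
    any2_cost n (any2_cost n (reaches_cost (n ^ 4)) + mem2_cost n + any2_cost n 2 +
       (k * (2 * listed_cost n + 1) + 1))"
    by (intro steps_any2_t S(2) body)
  moreover have "steps (check_block_t ls ar is h) = steps (reach_t (edge_list h)) +
      (steps (sccs_t (edge_list h) rs) + (steps (map_t mi ls) + (steps (map_t ma ls) +
        steps (any_t (\<lambda>S1. any_t (?body S1) Ss) Ss))))"
    unfolding check_block_t_def steps_bind val_bind rs_def Ss_def mi_def ma_def ..
  ultimately have "steps (check_block_t ls ar is h) \<le> reach_cost n + (sccs_cost n (n ^ 4) +
      ((n * (minmax_cost n (n ^ 4) + 1) + 1) + ((n * (minmax_cost n (n ^ 4) + 1) + 1) +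
        any2_cost n (any2_cost n (reaches_cost (n ^ 4)) + mem2_cost n + any2_cost n 2 +
          (k * (2 * listed_cost n + 1) + 1)))))"
    using steps_reach_t(1)[OF assms(1)] S(1) mins maxs by (simp only: add_mono)
  then show ?thesis by (simp only: check_block_cost_def mult_2 add.assoc)
qed

definition check_cost :: "nat \<Rightarrow> nat \<Rightarrow> nat" where
  "check_cost n k = (n + 1 + remdups_cost n) + (n * (check_block_cost n k + 1) + 1)"

lemma polyfun_check_cost [polyfun_intros]:
  assumes "polyfun f" "polyfun g"
  shows "polyfun (\<lambda>n. check_cost (f n) (g n))"
  unfolding check_cost_def check_block_cost_def listed_cost_def minmax_cost_def sccs_cost_def
    scc_of_cost_def mem2_cost_def any2_cost_def reaches_cost_def
  by (intro polyfun_intros assms)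

section \<open>Total cost of the two versions\<close>

context
  fixes g :: "('l, 'a) cfg_rep" and "is" :: "('a \<times> 'a) list" and f :: "('l, 'a) fusion_rep"
    and n :: nat
  assumes len: "length (edge_list g) \<le> n" "length is \<le> n" "length (block_reps f) \<le> n"
    "\<forall>x\<in>set (block_reps f). length (edge_list (snd x)) \<le> n"
begin

lemma steps_check_blocks_t:
  assumes "length ar \<le> k"
  shows "steps (check_blocks_t ar g is f) \<le> check_cost n k"
proof -
  note L = steps_labels_t[OF len(1)]
  have "steps (any_t (\<lambda>(\<beta>, h). check_block_t (val (labels_t (edge_list g))) ar is h) (block_reps f)) \<le>
    n * (check_block_cost n k + 1) + 1"
  proof (rule steps_any_t[OF len(3)])
    fix x assume "x \<in> set (block_reps f)"
    then have "length (edge_list (snd x)) \<le> n" using len(4) by blast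
    then show "steps (case x of (\<beta>, h) \<Rightarrow> check_block_t (val (labels_t (edge_list g))) ar is h) \<le>
      check_block_cost n k"
      using steps_check_block_t[OF _ L(2) len(2) assms] by (simp add: case_prod_unfold)
  qed
  then show ?thesis using L(1) unfolding check_blocks_t_def check_cost_def by simp
qed

lemma steps_decide_arrow:
  "steps (decide_arrow g is f) \<le> arrow_cost n + check_cost n (n * n * chain_len n)"
  using steps_arrow_t(1)[OF len] steps_check_blocks_t[OF steps_arrow_t(2)[OF len]]
  unfolding decide_arrow_def by simp

lemma steps_decide_inner_arrow:
  "steps (decide_inner_arrow g is f) \<le>
     inner_arrow_cost n + check_cost n (pa_len n + chain_len n * pa_len n)"
  using steps_inner_arrow_t(1)[OF len] steps_check_blocks_t[OF steps_inner_arrow_t(2)[OF len]]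
  unfolding decide_inner_arrow_def by simp

end

lemma input_size_bounds:
  "length (edge_list g) \<le> input_size g is f" "length is \<le> input_size g is f"
  "length (block_reps f) \<le> input_size g is f"
  "\<forall>x\<in>set (block_reps f). length (edge_list (snd x)) \<le> input_size g is f"
proof -
  let ?s = "\<Sum>(\<beta>, h) \<leftarrow> block_reps f. cfg_size h + 1"
  have s: "?s \<le> input_size g is f" by (simp add: input_size_def)
  have "length xs \<le> (\<Sum>(\<beta>, h) \<leftarrow> xs. cfg_size h + 1)" for xs :: "('b \<times> ('c, 'd) cfg_rep) list"
    by (induction xs) auto
  then show "length (block_reps f) \<le> input_size g is f" using s le_trans by blast
  show "\<forall>x\<in>set (block_reps f). length (edge_list (snd x)) \<le> input_size g is f"
  proof
    fix x assume "x \<in> set (block_reps f)"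
    then have "cfg_size (snd x) + 1 \<in> set (map (\<lambda>(\<beta>, h). cfg_size h + 1) (block_reps f))"
      unfolding set_map by (rule image_eqI[rotated]) (simp add: case_prod_unfold)
    then have "cfg_size (snd x) + 1 \<le> ?s" by (rule member_le_sum_list) simp
    then show "length (edge_list (snd x)) \<le> input_size g is f" using s by (simp add: cfg_size_def)
  qed
qed (simp_all add: input_size_def cfg_size_def)

lemma polynomial_time:
  "\<exists>p. \<forall>(g :: ('l, 'a) cfg_rep) is (f :: ('l, 'a) fusion_rep).
     steps (decide_inner_arrow g is f) \<le> poly p (input_size g is f) \<and>
     steps (decide_arrow g is f) \<le> poly p (input_size g is f)"
proof -
  \<comment> \<open>The sum of both costs serves as a common bound.\<close>
  have "polyfun (\<lambda>n. (arrow_cost n + check_cost n (n * n * chain_len n)) +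
    (inner_arrow_cost n + check_cost n (pa_len n + chain_len n * pa_len n)))"
    by (intro polyfun_intros)
  then obtain p where p: "poly p = (\<lambda>n. (arrow_cost n + check_cost n (n * n * chain_len n)) +
    (inner_arrow_cost n + check_cost n (pa_len n + chain_len n * pa_len n)))"
    unfolding polyfun_def by metis
  show ?thesis
  proof (intro exI[of _ p] allI conjI; unfold p)
    fix g :: "('l, 'a) cfg_rep" and "is" :: "('a \<times> 'a) list" and f :: "('l, 'a) fusion_rep"
    let ?n = "input_size g is f"
    show "steps (decide_inner_arrow g is f) \<le>
      (arrow_cost ?n + check_cost ?n (?n * ?n * chain_len ?n)) +
      (inner_arrow_cost ?n + check_cost ?n (pa_len ?n + chain_len ?n * pa_len ?n))"
      by (rule le_trans[OF steps_decide_inner_arrow[OF input_size_bounds] le_add2])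
    show "steps (decide_arrow g is f) \<le>
      (arrow_cost ?n + check_cost ?n (?n * ?n * chain_len ?n)) +
      (inner_arrow_cost ?n + check_cost ?n (pa_len ?n + chain_len ?n * pa_len ?n))"
      by (rule le_trans[OF steps_decide_arrow[OF input_size_bounds] le_add1])
  qed
qed

section \<open>Words and reorderings\<close>

lemma proj_simps [simp]:
  "proj i [] = []"
  "proj i (x # w) = (if snd x = i then fst x # proj i w else proj i w)"
  "proj i (u @ v) = proj i u @ proj i v"
  by (auto simp: proj_def)

lemma proj_index [simp]: "proj i (index j u) = (if i = j then u else [])"
  by (induction u) (auto simp: index_def)

lemma index_simps [simp]:
  "index i [] = []" "index i (a # u) = (a, i) # index i u" "index i (u @ v) = index i u @ index i v"
  "length (index i u) = length u"
  by (auto simp: index_def)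

lemma nth_index: "k < length t \<Longrightarrow> index i t ! k = (t ! k, i)"
  by (simp add: index_def)

lemma morph_word_iff:
  "w \<in> morph_word \<mu> xs \<longleftrightarrow> (\<exists>us. w = concat us \<and> list_all2 (\<lambda>u x. u \<in> \<mu> x) us xs)"
proof (induction xs arbitrary: w)
  case (Cons x xs)
  show ?case
  proof
    assume "w \<in> morph_word \<mu> (x # xs)"
    then obtain u us where "w = concat (u # us)" "list_all2 (\<lambda>u x. u \<in> \<mu> x) (u # us) (x # xs)"
      using Cons by auto
    then show "\<exists>us. w = concat us \<and> list_all2 (\<lambda>u x. u \<in> \<mu> x) us (x # xs)" by blast
  next
    assume "\<exists>us. w = concat us \<and> list_all2 (\<lambda>u x. u \<in> \<mu> x) us (x # xs)"
    then obtain u us where "w = concat (u # us)" "u \<in> \<mu> x" "list_all2 (\<lambda>u x. u \<in> \<mu> x) us xs"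
      by (auto simp: list_all2_Cons2)
    then show "w \<in> morph_word \<mu> (x # xs)" using Cons by auto
  qed
qed simp

text \<open>The image of an indexed action lies in a single thread, so a projection keeps or erases
  it as a whole.\<close>

lemma proj_morph_word:
  "u \<in> morph_word (indexed_morph \<mu>) w \<Longrightarrow> proj i u \<in> morph_word \<mu> (proj i w)"
proof (induction w arbitrary: u)
  case (Cons x w)
  then obtain v u' where u: "u = index (snd x) v @ u'" "v \<in> \<mu> (fst x)"
    "u' \<in> morph_word (indexed_morph \<mu>) w"
    unfolding morph_word.simps by (auto simp: indexed_morph_def[of \<mu> x])
  then show ?case using Cons.IH[OF u(3)] by auto
qed simp

text \<open>A relation on values, not on positions: with repetitions it may hold in both directions
  and even between a value and itself. In exchange it obeys simple laws for filters, maps and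
  concatenations.\<close>

primrec before :: "'c list \<Rightarrow> 'c \<Rightarrow> 'c \<Rightarrow> bool" where
  "before [] x y \<longleftrightarrow> False"
| "before (z # zs) x y \<longleftrightarrow> x = z \<and> y \<in> set zs \<or> before zs x y"

lemma before_set: "before zs x y \<Longrightarrow> x \<in> set zs \<and> y \<in> set zs"
  by (induction zs) auto

lemma before_filter: "before (filter P zs) x y \<longleftrightarrow> before zs x y \<and> P x \<and> P y"
  by (induction zs) (auto dest: before_set)

lemma before_append:
  "before (us @ vs) x y \<longleftrightarrow> before us x y \<or> before vs x y \<or> x \<in> set us \<and> y \<in> set vs"
  by (induction us) auto

lemma before_map: "before zs x y \<Longrightarrow> before (map f zs) (f x) (f y)"
  by (induction zs) auto

lemma before_nth: "p < q \<Longrightarrow> q < length zs \<Longrightarrow> before zs (zs ! p) (zs ! q)"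
proof (induction zs arbitrary: p q)
  case (Cons z zs)
  then show ?case by (cases p; cases q) auto
qed simp

lemma before_nthE:
  assumes "before zs x y"
  obtains p q where "p < q" "q < length zs" "zs ! p = x" "zs ! q = y"
  using assms
proof (induction zs arbitrary: thesis)
  case (Cons z zs)
  show ?case
  proof (cases "before zs x y")
    case True
    then obtain p q where "p < q" "q < length zs" "zs ! p = x" "zs ! q = y" using Cons.IH by blast
    then show ?thesis using Cons.prems(1)[of "Suc p" "Suc q"] by simp
  next
    case False
    then obtain q where "q < length zs" "zs ! q = y" "x = z"
      using Cons.prems(2) by (auto simp: in_set_conv_nth)
    then show ?thesis using Cons.prems(1)[of 0 "Suc q"] by simp
  qed
qed simp

lemma before_split:
  assumes "before zs x y"
  obtains r u s where "zs = r @ x # u @ y # s"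
  using assms
proof (induction zs arbitrary: thesis)
  case (Cons z zs)
  show ?case
  proof (cases "before zs x y")
    case True
    then obtain r u s where "zs = r @ x # u @ y # s" using Cons.IH by blast
    then show ?thesis using Cons.prems(1)[of "z # r" u s] by simp
  next
    case False
    then have "x = z" "y \<in> set zs" using Cons.prems(2) by auto
    then obtain u s where "zs = u @ y # s" by (auto simp: in_set_conv_decomp)
    then show ?thesis using Cons.prems(1)[of "[]" u s] \<open>x = z\<close> by simp
  qed
qed simp

lemma before_distinct: "distinct zs \<Longrightarrow> before zs x y \<Longrightarrow> x \<noteq> y"
  by (induction zs) auto

lemma sorted_wrt_before: "sorted_wrt R zs \<longleftrightarrow> (\<forall>x y. before zs x y \<longrightarrow> R x y)"
  by (induction zs) auto

lemma before_proj: "before (proj i W) t t' \<Longrightarrow> before W (t, i) (t', i)"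
proof (induction W)
  case (Cons z W)
  have "(t', i) \<in> set W" if "t' \<in> set (proj i W)"
    using that by (auto simp: proj_def)
  then show ?case using Cons by (cases z) (auto split: if_splits)
qed simp

lemma proj_before: "before W (t, i) (t', i) \<Longrightarrow> before (proj i W) t t'"
proof (induction W)
  case (Cons z W)
  have "t' \<in> set (proj i W)" if "(t', i) \<in> set W"
    using that by (force simp: proj_def)
  then show ?case using Cons by auto
qed simp

lemma lift_interleaving:
  assumes "\<And>i. map f (T i) = proj i w"
  obtains W where "map (map_prod f id) W = w" "\<And>i. proj i W = T i"
  using assms
proof (induction w arbitrary: T thesis)
  case Nil
  then show ?case using Nil(1)[of "[]"] by simp
next
  case (Cons x w)
  obtain a j where x: "x = (a, j)" by (rule prod.exhaust)
  from Cons.prems(2)[of j] obtain t ts where T: "T j = t # ts" "f t = a" "map f ts = proj j w"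
    by (auto simp: x)
  have "map f ((T(j := ts)) i) = proj i w" for i
    using T Cons.prems(2)[of i] by (auto simp: x)
  then obtain W where W: "map (map_prod f id) W = w" "\<And>i. proj i W = (T(j := ts)) i"
    using Cons.IH by blast
  have "map (map_prod f id) ((t, j) # W) = x # w" using W T by (simp add: x)
  moreover have "proj i ((t, j) # W) = T i" for i using W T by (cases "i = j") auto
  ultimately show ?case by (rule Cons.prems(1))
qed

section \<open>Moving letters past independent ones\<close>

definition indep :: "('a \<times> 'a) set \<Rightarrow> 'a \<times> nat \<Rightarrow> 'a \<times> nat \<Rightarrow> bool" where
  "indep I x y \<longleftrightarrow> (fst x, fst y) \<in> I \<and> snd x \<noteq> snd y"

lemma swap_iff: "swap I u v \<longleftrightarrow> (\<exists>r x y s. indep I x y \<and> u = r @ x # y # s \<and> v = r @ y # x # s)"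
  by (fastforce simp: swap.simps indep_def)

lemma reorder_le_refl [simp]: "reorder_le I w w"
  by (simp add: reorder_le_def)

lemma reorder_le_trans: "reorder_le I u v \<Longrightarrow> reorder_le I v w \<Longrightarrow> reorder_le I u w"
  unfolding reorder_le_def by (rule rtranclp_trans)

lemma swap_append: "swap I u v \<Longrightarrow> swap I (r @ u @ s) (r @ v @ s)"
  unfolding swap_iff by (metis append.assoc append_Cons)

lemma reorder_le_append: "reorder_le I u v \<Longrightarrow> reorder_le I (r @ u @ s) (r @ v @ s)"
  unfolding reorder_le_def
  by (induction rule: rtranclp_induct) (auto intro: rtranclp.rtrancl_into_rtrancl swap_append)

lemma reorder_move:
  "\<forall>y\<in>set ys. indep I x y \<Longrightarrow> reorder_le I (x # ys @ zs) (ys @ x # zs)"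
proof (induction ys)
  case (Cons y ys)
  have "swap I (x # y # ys @ zs) (y # x # ys @ zs)"
    unfolding swap_iff using Cons.prems
    by (intro exI[of _ "[]"] exI[of _ x] exI[of _ y] exI[of _ "ys @ zs"]) auto
  then have "reorder_le I (x # y # ys @ zs) (y # x # ys @ zs)" by (auto simp: reorder_le_def)
  moreover have "reorder_le I ([y] @ (x # ys @ zs) @ []) ([y] @ (ys @ x # zs) @ [])"
    by (intro reorder_le_append Cons.IH) (use Cons.prems in auto)
  ultimately show ?case by (auto intro: reorder_le_trans)
qed simp

text \<open>A stable partition: once the letters satisfying \<open>P\<close> stand at the front of
  the tail, a first letter violating \<open>P\<close> only has to pass these.\<close>

lemma reorder_filter:
  assumes "\<And>x y. before W x y \<Longrightarrow> \<not> P x \<Longrightarrow> P y \<Longrightarrow> indep I (s x) (s y)"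
  shows "reorder_le I (map s W) (map s (filter P W @ filter (\<lambda>x. \<not> P x) W))"
  using assms
proof (induction W)
  case (Cons x W)
  let ?v = "map s (filter P W @ filter (\<lambda>x. \<not> P x) W)"
  have "reorder_le I (map s W) ?v" using Cons by simp
  then have "reorder_le I ([s x] @ map s W @ []) ([s x] @ ?v @ [])" by (rule reorder_le_append)
  then have step: "reorder_le I (s x # map s W) (s x # ?v)" by simp
  show ?case
  proof (cases "P x")
    case True
    then show ?thesis using step by simp
  next
    case False
    then have "\<forall>y\<in>set (map s (filter P W)). indep I (s x) y" using Cons.prems by auto
    from reorder_move[OF this, of "map s (filter (\<lambda>x. \<not> P x) W)"] show ?thesis
      using False step by (auto intro: reorder_le_trans)
  qed
qed simp

text \<open>The dependence order of \<open>W\<close> with every fibre of \<open>\<nu>\<close>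
  contracted to a vertex, without loops. Letters of one thread are never independent, so the order
  within a thread is included.\<close>

definition node_graph ::
    "('a \<times> 'a) set \<Rightarrow> ('c \<Rightarrow> 'a \<times> nat) \<Rightarrow> ('c \<Rightarrow> 'n) \<Rightarrow> 'c list \<Rightarrow> ('n \<times> 'n) set" where
  "node_graph I s \<nu> W =
     {(\<nu> x, \<nu> y) | x y. before W x y \<and> \<nu> x \<noteq> \<nu> y \<and> \<not> indep I (s x) (s y)}"

lemma node_graphI:
  "before W x y \<Longrightarrow> \<nu> x \<noteq> \<nu> y \<Longrightarrow> \<not> indep I (s x) (s y) \<Longrightarrow> (\<nu> x, \<nu> y) \<in> node_graph I s \<nu> W"
  unfolding node_graph_def by blast

lemma node_graphE:
  assumes "(M, N) \<in> node_graph I s \<nu> W"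
  obtains x y where "M = \<nu> x" "N = \<nu> y" "before W x y" "M \<noteq> N" "\<not> indep I (s x) (s y)"
  using assms unfolding node_graph_def by blast

lemma finite_node_graph: "finite (node_graph I s \<nu> W)"
proof (rule finite_subset)
  show "node_graph I s \<nu> W \<subseteq> \<nu> ` set W \<times> \<nu> ` set W"
    by (auto simp: node_graph_def dest: before_set)
qed simp

text \<open>The third property says that \<open>ns\<close> is a topological order. It is recorded
  because it later yields that the atoms of a thread keep their order in the fused word.\<close>

lemma reorder_topological:
  assumes "acyclic (node_graph I s \<nu> W)"
  obtains ns where "distinct ns" "set ns = \<nu> ` set W"
    "\<And>M N. before ns M N \<Longrightarrow> (N, M) \<notin> node_graph I s \<nu> W"
    "reorder_le I (map s W) (map s (concat (map (\<lambda>N. filter (\<lambda>x. \<nu> x = N) W) ns)))"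
  using assms
proof (induction "length W" arbitrary: W thesis rule: less_induct)
  case less
  show ?case
  proof (cases "W = []")
    case True
    then show ?thesis using less.prems(1)[of "[]"] by simp
  next
    case False
    have "wf (node_graph I s \<nu> W)"
      using less.prems(2) by (intro finite_acyclic_wf finite_node_graph)
    moreover have "\<nu> (hd W) \<in> \<nu> ` set W" using False by simp
    ultimately obtain N where N: "N \<in> \<nu> ` set W"
      "\<And>M. (M, N) \<in> node_graph I s \<nu> W \<Longrightarrow> M \<notin> \<nu> ` set W"
      by (metis wfE_min)
    have min: "(M, N) \<notin> node_graph I s \<nu> W" for M
      using N(2)[of M] by (auto simp: node_graph_def dest: before_set)
    let ?V = "filter (\<lambda>x. \<nu> x \<noteq> N) W"
    \<comment> \<open>Deleting a whole fibre removes exactly the edges at its vertex; hence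
      acyclicity passes to the rest, and the absence of edges between other vertices passes
      back.\<close>
    have E: "node_graph I s \<nu> ?V =
        {e \<in> node_graph I s \<nu> W. fst e \<noteq> N \<and> snd e \<noteq> N}"
    proof (intro equalityI subrelI)
      fix M M' assume "(M, M') \<in> node_graph I s \<nu> ?V"
      then show "(M, M') \<in> {e \<in> node_graph I s \<nu> W. fst e \<noteq> N \<and> snd e \<noteq> N}"
        by (rule node_graphE) (auto simp: before_filter intro: node_graphI)
    next
      fix M M' assume *: "(M, M') \<in> {e \<in> node_graph I s \<nu> W. fst e \<noteq> N \<and> snd e \<noteq> N}"
      then have "(M, M') \<in> node_graph I s \<nu> W" by simp
      then show "(M, M') \<in> node_graph I s \<nu> ?V"
        by (rule node_graphE) (use * in \<open>auto simp: before_filter intro: node_graphI\<close>)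
    qed
    have "length ?V < length W" using N(1) by (auto intro: length_filter_less)
    moreover have "acyclic (node_graph I s \<nu> ?V)"
      using less.prems(2) by (rule acyclic_subset) (auto simp: E)
    ultimately obtain ns where ns: "distinct ns" "set ns = \<nu> ` set ?V"
      "\<And>M N. before ns M N \<Longrightarrow> (N, M) \<notin> node_graph I s \<nu> ?V"
      "reorder_le I (map s ?V) (map s (concat (map (\<lambda>N. filter (\<lambda>x. \<nu> x = N) ?V) ns)))"
      using less.hyps by blast
    have notin: "N \<notin> set ns" unfolding ns by auto
    have blocks: "map (\<lambda>M. filter (\<lambda>x. \<nu> x = M) ?V) ns = map (\<lambda>M. filter (\<lambda>x. \<nu> x = M) W) ns"
      using notin by (auto intro!: filter_cong)
    have "reorder_le I (map s W)
        (map s (filter (\<lambda>x. \<nu> x = N) W @ filter (\<lambda>x. \<not> \<nu> x = N) W))"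
    proof (rule reorder_filter)
      fix x y assume "before W x y" "\<nu> x \<noteq> N" "\<nu> y = N"
      then show "indep I (s x) (s y)" using min[of "\<nu> x"] unfolding node_graph_def by blast
    qed
    moreover have "reorder_le I
        (map s (filter (\<lambda>x. \<nu> x = N) W) @ map s ?V @ [])
        (map s (filter (\<lambda>x. \<nu> x = N) W) @
         map s (concat (map (\<lambda>N. filter (\<lambda>x. \<nu> x = N) ?V) ns)) @ [])"
      by (rule reorder_le_append[OF ns(4)])
    ultimately have reorder: "reorder_le I (map s W)
        (map s (concat (map (\<lambda>N. filter (\<lambda>x. \<nu> x = N) W) (N # ns))))"
      unfolding blocks by (auto intro: reorder_le_trans)
    show ?thesis
    proof (rule less.prems(1)[of "N # ns"])
      show "distinct (N # ns)" using ns notin by simp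
      show "set (N # ns) = \<nu> ` set W" using N(1) ns(2) by auto
      show "(M', M) \<notin> node_graph I s \<nu> W" if "before (N # ns) M M'" for M M'
      proof (cases "M = N")
        case True
        then show ?thesis using min by blast
      next
        case False
        then have b: "before ns M M'" using that by simp
        then have "M' \<noteq> N" using notin before_set by metis
        then show ?thesis using ns(3)[OF b] False by (simp add: E)
      qed
    qed (rule reorder)
  qed
qed

section \<open>Atomic fusions\<close>

lemma inserted_block_labels:
  assumes "inserted G F" "(\<beta>, H) \<in> set (blocks F)"
  shows "labels H \<subseteq> labels G"
proof -
  obtain k where k: "k < length (blocks F)" "blocks F ! k = (\<beta>, H)"
    using assms(2) by (auto simp: in_set_conv_nth)
  have "\<exists>h g. edges G = rename_edges h {e \<in> edges (fused_cfg F). lab e \<notin> block_actions F} \<union>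
     (\<Union>k<length (blocks F). rename_edges (g k) (edges (snd (blocks F ! k))))"
    using assms(1) unfolding inserted_def Let_def by (elim exE conjE) (intro exI)
  then obtain h g where "edges G = rename_edges h {e \<in> edges (fused_cfg F). lab e \<notin> block_actions F} \<union>
     (\<Union>k<length (blocks F). rename_edges (g k) (edges (snd (blocks F ! k))))" by auto
  then have "rename_edges (g k) (edges H) \<subseteq> edges G" using k by fastforce
  then show ?thesis unfolding labels_def rename_edges_def by force
qed

text \<open>Together with the disjointness of different blocks, this lets a letter determine the
  block it stems from.\<close>

lemma inserted_kept_labels:
  assumes "inserted G F" "(\<beta>, H) \<in> set (blocks F)"
    and "a \<in> labels (fused_cfg F)" "a \<notin> block_actions F"
  shows "a \<notin> labels H"
proof -
  obtain k where k: "k < length (blocks F)" "blocks F ! k = (\<beta>, H)"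
    using assms(2) by (auto simp: in_set_conv_nth)
  have "\<forall>k<length (blocks F). labels (snd (blocks F ! k)) \<inter>
      (\<lambda>e. lab e) ` {e \<in> edges (fused_cfg F). lab e \<notin> block_actions F} = {}"
    using assms(1) unfolding inserted_def Let_def by (elim exE conjE)
  then have "labels H \<inter> (\<lambda>e. lab e) ` {e \<in> edges (fused_cfg F). lab e \<notin> block_actions F} = {}"
    using k by force
  moreover have "a \<in> (\<lambda>e. lab e) ` {e \<in> edges (fused_cfg F). lab e \<notin> block_actions F}"
    using assms(3,4) by (auto simp: labels_def)
  ultimately show ?thesis by blast
qed

lemma inserted_blocks_disjoint:
  assumes "inserted G F" "(\<beta>, H) \<in> set (blocks F)" "(\<beta>', H') \<in> set (blocks F)"
    and "a \<in> labels H" "a \<in> labels H'"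
  shows "H = H'"
proof -
  obtain j k where k: "j < length (blocks F)" "blocks F ! j = (\<beta>, H)"
    "k < length (blocks F)" "blocks F ! k = (\<beta>', H')"
    using assms(2,3) by (auto simp: in_set_conv_nth)
  have "\<forall>j<length (blocks F). \<forall>k<length (blocks F). j \<noteq> k \<longrightarrow>
      labels (snd (blocks F ! j)) \<inter> labels (snd (blocks F ! k)) = {}"
    using assms(1) unfolding inserted_def Let_def by (elim exE conjE)
  then have "j = k" using k assms(4,5) by fastforce
  then show ?thesis using k by simp
qed

locale fusion =
  fixes G :: "('l, 'a) cfg" and F :: "('l, 'a) fusion"
  assumes cfg: "is_cfg G" and fusion: "atomic_fusion F G"
begin

abbreviation "G' \<equiv> fused_cfg F"
abbreviation "\<mu> \<equiv> fusion_morph F"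

lemma cfg_fused: "is_cfg G'"
  and inserted: "inserted G F"
  and traces_G: "traces G = morph_lang \<mu> (traces G')"
  and block_actions: "block_actions F \<subseteq> labels G'"
  and distinct_blocks: "distinct (map fst (blocks F))"
  using fusion by (auto simp: atomic_fusion_def)

lemma block_cfg:
  assumes "(\<beta>, H) \<in> set (blocks F)"
  shows "is_cfg H" "traces H \<noteq> {}" "labels H \<subseteq> labels G"
  using fusion assms inserted_block_labels[OF inserted assms] by (auto simp: atomic_fusion_def)

lemma blocks_cfg: "\<forall>(\<beta>, H)\<in>set (blocks F). is_cfg H"
  using block_cfg by blast

lemma morph_cases:
  assumes "u \<in> \<mu> x"
  obtains "x \<notin> block_actions F" "u = [x]"
  | H where "(x, H) \<in> set (blocks F)" "u \<in> traces H"
proof (cases "map_of (blocks F) x")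
  case None
  then have "u = [x]" using assms by (simp add: fusion_morph_def)
  moreover have "x \<notin> block_actions F"
    using None by (simp add: block_actions_def map_of_eq_None_iff)
  ultimately show ?thesis using that by blast
next
  case (Some H)
  then show ?thesis using assms that map_of_SomeD[OF Some] by (auto simp: fusion_morph_def)
qed

lemma morph_block: "(\<beta>, H) \<in> set (blocks F) \<Longrightarrow> \<mu> \<beta> = traces H"
  using distinct_blocks by (simp add: fusion_morph_def)

lemma morph_nonempty: "\<mu> x \<noteq> {}"
  using block_cfg(2) by (auto simp: fusion_morph_def split: option.splits dest: map_of_SomeD)

text \<open>A block trace leads from the initial location to a different one. Every atom therefore
  has a letter, by which it can be seen in an interleaving.\<close>

lemma morph_not_Nil: "[] \<notin> \<mu> x"
proof
  assume "[] \<in> \<mu> x"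
  then show False by (rule morph_cases) (auto dest: block_cfg(1) traces_not_Nil)
qed

lemma morph_word_nonempty: "morph_word \<mu> w \<noteq> {}"
proof (induction w)
  case (Cons x w)
  then obtain u v where "u \<in> \<mu> x" "v \<in> morph_word \<mu> w" using morph_nonempty by blast
  then show ?case by auto
qed simp

lemma morph_lang_interleavings:
  "morph_lang (indexed_morph \<mu>) (interleavings G') \<subseteq> interleavings G"
proof
  fix u assume "u \<in> morph_lang (indexed_morph \<mu>) (interleavings G')"
  then obtain w where w: "w \<in> interleavings G'" "u \<in> morph_word (indexed_morph \<mu>) w"
    by (auto simp: morph_lang_def)
  show "u \<in> interleavings G"
    unfolding interleavings_def
  proof (intro CollectI allI)
    fix i
    have "proj i u \<in> morph_word \<mu> (proj i w)" using w(2) by (rule proj_morph_word)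
    moreover have "proj i w \<in> traces G' \<union> {[]}" using w(1) by (auto simp: interleavings_def)
    ultimately show "proj i u \<in> traces G \<union> {[]}" by (auto simp: traces_G morph_lang_def)
  qed
qed

end

section \<open>Threads cut into numbered atoms\<close>

primrec tag :: "nat \<Rightarrow> 'a list list \<Rightarrow> ('a \<times> nat) list" where
  "tag k [] = []"
| "tag k (u # us) = map (\<lambda>a. (a, k)) u @ tag (Suc k) us"

lemma map_fst_tag: "map fst (tag k us) = concat us"
  by (induction us arbitrary: k) (auto simp: comp_def)

lemma tag_ge: "(a, m) \<in> set (tag k us) \<Longrightarrow> k \<le> m"
proof (induction us arbitrary: k)
  case (Cons u us)
  then show ?case by (auto dest!: Cons.IH)
qed simp

lemma filter_tag:
  "filter (\<lambda>t. snd t = k + m) (tag k us) = (if m < length us then map (\<lambda>a. (a, k + m)) (us ! m) else [])"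
proof (induction us arbitrary: k m)
  case (Cons u us)
  show ?case
  proof (cases m)
    case 0
    have "filter (\<lambda>t. snd t = k) (tag (Suc k) us) = []"
      by (auto simp: filter_empty_conv dest: tag_ge)
    then show ?thesis using 0 by simp
  next
    case (Suc n)
    then show ?thesis using Cons[of "Suc k" n] by (simp add: filter_False)
  qed
qed simp

lemma before_tag_le: "before (tag k us) s t \<Longrightarrow> snd s \<le> snd t"
proof (induction us arbitrary: k)
  case (Cons u us)
  have "snd s = k \<and> snd t = k" if "before (map (\<lambda>a. (a, k)) u) s t"
    using before_set[OF that] by auto
  then show ?case using Cons tag_ge[of "fst t" "snd t" "Suc k" us] by (auto simp: before_append)
qed simp

lemma in_tagI: "m < length us \<Longrightarrow> a \<in> set (us ! m) \<Longrightarrow> (a, k + m) \<in> set (tag k us)"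
proof (induction us arbitrary: k m)
  case (Cons u us)
  then show ?case using Cons.IH[of "m - 1" "Suc k"] by (cases m) auto
qed simp

lemma in_tagD: "(a, m) \<in> set (tag k us) \<Longrightarrow> m < k + length us"
proof (induction us arbitrary: k)
  case (Cons u us)
  then show ?case by (fastforce dest: Cons.IH)
qed simp

lemma before_tagI:
  "m < n \<Longrightarrow> n < length us \<Longrightarrow> a \<in> set (us ! m) \<Longrightarrow> b \<in> set (us ! n) \<Longrightarrow>
     before (tag k us) (a, k + m) (b, k + n)"
proof (induction us arbitrary: k m n)
  case (Cons u us)
  obtain n' where n: "n = Suc n'" using Cons.prems by (cases n) auto
  show ?case
  proof (cases m)
    case 0
    have "(b, Suc k + n') \<in> set (tag (Suc k) us)" by (rule in_tagI) (use Cons.prems n in auto)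
    then show ?thesis using 0 n Cons.prems by (auto simp: before_append)
  next
    case (Suc m')
    have "before (tag (Suc k) us) (a, Suc k + m') (b, Suc k + n')"
      by (rule Cons.IH) (use Cons.prems n Suc in auto)
    then show ?thesis using n Suc by (simp add: before_append)
  qed
qed simp

text \<open>Meant for closed walks: they avoid \<open>B\<close>, or can be rotated to begin with a
  step of \<open>B\<close>.\<close>

lemma trancl_Un_cases:
  "(x, y) \<in> (A \<union> B)\<^sup>+ \<Longrightarrow>
     (x, y) \<in> A\<^sup>+ \<or> (\<exists>u v. (u, v) \<in> B \<and> (x, u) \<in> (A \<union> B)\<^sup>* \<and> (v, y) \<in> (A \<union> B)\<^sup>*)"
proof (induction rule: trancl_induct)
  case (base y)
  then show ?case by auto
next
  case (step y z)
  then show ?case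
    by (meson Un_iff rtrancl.rtrancl_refl rtrancl.rtrancl_into_rtrancl trancl_into_rtrancl
        trancl.trancl_into_trancl)
qed

section \<open>Acyclic interleavings can be reordered\<close>

context fusion
begin

abbreviation "PA \<equiv> po G \<union> atomic_rel F"

lemma inner_arrow_labels:
  "inner_arrow G I F \<subseteq> labels G \<times> labels G"
proof -
  have "po G \<subseteq> labels G \<times> labels G"
    unfolding po_eq[OF cfg] by (force simp: edge_succ_trancl_iff labels_def)
  moreover have "atomic_rel F \<subseteq> labels G \<times> labels G"
    unfolding atomic_rel_eq[OF blocks_cfg]
    using block_cfg(3) by (fastforce simp: edge_succ_trancl_iff labels_def)
  ultimately have PA: "PA \<subseteq> labels G \<times> labels G" by blast
  have "(a, b) \<in> labels G \<times> labels G" if ab: "(a, b) \<in> PA O (dependence G I O PA)\<^sup>*" for a b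
  proof -
    obtain c where "(a, c) \<in> PA" "(c, b) \<in> (dependence G I O PA)\<^sup>*" using ab by blast
    from this(2,1) show ?thesis
      by (induction rule: rtrancl_induct) (use PA in blast)+
  qed
  then show ?thesis unfolding inner_arrow_def by blast
qed

text \<open>The test of step 5 for \<open>inner_arrow\<close> with single edges instead of SCCs. It
  is what the semantic argument shows to be equivalent to unsoundness.\<close>

definition breaking_chain :: "('a \<times> 'a) set \<Rightarrow> bool" where
  "breaking_chain I \<longleftrightarrow> (\<exists>(\<beta>, H)\<in>set (blocks F). \<exists>(e, f)\<in>(edge_succ H)\<^sup>+.
     \<exists>(a, b)\<in>inner_arrow G I F. (lab e, a) \<notin> I \<and> (b, lab f) \<notin> I)"

text \<open>An atom with two letters comes from a block, because a kept action is an atom of length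
  one.\<close>

lemma atom_split:
  assumes "before u b a" "u \<in> \<mu> x"
  obtains \<beta> H e f where "(\<beta>, H) \<in> set (blocks F)" "(e, f) \<in> (edge_succ H)\<^sup>+" "lab e = b" "lab f = a"
  using assms(2)
proof (cases rule: morph_cases)
  case 1
  then show ?thesis using assms(1) by simp
next
  case (2 H)
  obtain r v s where "u = r @ b # v @ a # s" using assms(1) by (rule before_split)
  then have "path H (init H) (r @ b # v @ a # s) (exit H)" using 2 by (simp add: traces_def)
  then show ?thesis using that 2 by (metis path_trancl)
qed

lemma trace_before_po: "before t a b \<Longrightarrow> t \<in> traces G \<Longrightarrow> (a, b) \<in> po G"
proof (erule before_split)
  fix r u s assume "t = r @ a # u @ b # s" "t \<in> traces G"
  then have "r @ (a # u @ [b]) @ s \<in> traces G" by simp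
  then show "(a, b) \<in> po G" unfolding po_def by fastforce
qed

lemma atom_before_atomic_rel: "before u b a \<Longrightarrow> u \<in> \<mu> x \<Longrightarrow> (a, b) \<in> atomic_rel F"
  by (erule (1) atom_split) (force simp: atomic_rel_eq[OF blocks_cfg])

end

text \<open>In an annotated interleaving \<open>W\<close>, a letter \<open>((a, k), i)\<close> is an occurrence of \<open>a\<close> in the
  \<open>k\<close>-th atom \<open>U i ! k\<close> of thread \<open>i\<close>, which refines the letter \<open>X i ! k\<close> of the fused program.\<close>

locale annotated = fusion G F for G :: "('l, 'a) cfg" and F :: "('l, 'a) fusion" +
  fixes I :: "('a \<times> 'a) set" and W :: "(('a \<times> nat) \<times> nat) list"
    and X :: "nat \<Rightarrow> 'a list" and U :: "nat \<Rightarrow> 'a list list"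
  assumes X: "X i \<in> traces G' \<union> {[]}"
    and U: "list_all2 (\<lambda>u x. u \<in> \<mu> x) (U i) (X i)"
    and W: "proj i W = tag 0 (U i)"
begin

abbreviation "thr z \<equiv> snd z"
abbreviation "lvl z \<equiv> snd (fst z)"
abbreviation "act z \<equiv> fst (fst z)"
abbreviation "node z \<equiv> (thr z, lvl z)"
abbreviation "strip \<equiv> map_prod fst id"

lemma length_U: "length (U i) = length (X i)"
  using U by (rule list_all2_lengthD)

lemma atom: "k < length (X i) \<Longrightarrow> U i ! k \<in> \<mu> (X i ! k)"
  using list_all2_nthD2[OF U] by blast

lemma thread_trace: "z \<in> set W \<Longrightarrow> concat (U (thr z)) \<in> traces G"
proof -
  assume z: "z \<in> set W"
  let ?i = "thr z"
  have "fst z \<in> set (tag 0 (U ?i))" unfolding W[symmetric] using z by (force simp: proj_def)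
  then have "U ?i \<noteq> []" by auto
  then have "X ?i \<in> traces G'" using X[of ?i] length_U[of ?i] by auto
  moreover have "concat (U ?i) \<in> morph_word \<mu> (X ?i)" using U morph_word_iff by blast
  ultimately show ?thesis unfolding traces_G morph_lang_def by blast
qed

lemma map_fst_proj: "map fst (proj i W) = concat (U i)"
  by (simp add: W map_fst_tag)

lemma same_thread:
  assumes "before W y z" "thr y = thr z"
  shows "lvl y \<le> lvl z" "(act y, act z) \<in> po G"
    "lvl y = lvl z \<Longrightarrow> k = lvl z \<Longrightarrow> before (U (thr z) ! k) (act y) (act z) \<and> k < length (X (thr z))"
proof -
  have b: "before (proj (thr z) W) (fst y) (fst z)"
    using assms by (intro proj_before) (metis prod.collapse)
  then show "lvl y \<le> lvl z" unfolding W by (rule before_tag_le)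
  have "before (concat (U (thr z))) (act y) (act z)"
    using before_map[OF b, of fst] unfolding map_fst_proj .
  then show "(act y, act z) \<in> po G"
    using trace_before_po thread_trace before_set[OF assms(1)] by blast
  assume k: "lvl y = lvl z" "k = lvl z"
  then have "before (filter (\<lambda>t. snd t = 0 + k) (tag 0 (U (thr z)))) (fst y) (fst z)"
    using b unfolding before_filter W by simp
  then have *: "k < length (U (thr z))" "before (map (\<lambda>a. (a, k)) (U (thr z) ! k)) (fst y) (fst z)"
    unfolding filter_tag by (auto split: if_splits)
  from before_map[OF *(2), of fst] have "before (U (thr z) ! k) (act y) (act z)"
    by (simp add: comp_def)
  then show "before (U (thr z) ! k) (act y) (act z) \<and> k < length (X (thr z))"
    using * length_U by simp
qed

lemma act_label: "z \<in> set W \<Longrightarrow> act z \<in> labels G"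
proof -
  assume z: "z \<in> set W"
  have "fst z \<in> set (proj (thr z) W)" using z by (force simp: proj_def)
  then have "act z \<in> set (concat (U (thr z)))" unfolding map_fst_proj[symmetric] by force
  then show ?thesis using traces_labels[OF thread_trace[OF z]] by blast
qed

section \<open>Walks over positions of an annotated interleaving\<close>

definition D :: "(nat \<times> nat) set" where
  "D = {(p, q). p < q \<and> q < length W \<and> \<not> indep I (strip (W ! p)) (strip (W ! q)) \<and>
         thr (W ! p) \<noteq> thr (W ! q)}"

text \<open>A move leads to any letter of the same or a later atom of the thread, hence possibly
  backwards inside an atom. Being transitive, \<open>Q\<close> merges adjacent moves, so that a walk
  over atoms alternates between \<open>Q\<close> and the conflicts \<open>D\<close> of different
  threads.\<close>

definition Q :: "(nat \<times> nat) set" where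
  "Q = {(p, q). p < length W \<and> q < length W \<and> thr (W ! p) = thr (W ! q) \<and>
         lvl (W ! p) \<le> lvl (W ! q)}"

lemma D_dependence: "(p, q) \<in> D \<Longrightarrow> (act (W ! p), act (W ! q)) \<in> dependence G I"
  by (auto simp: D_def dependence_def indep_def intro!: act_label)

text \<open>Atom numbers do not decrease along a thread, so a move to a smaller position cannot
  leave the atom.\<close>

lemma back_step:
  assumes "(p, q) \<in> Q" "q < p"
  shows "node (W ! p) = node (W ! q)"
    "before (U (thr (W ! p)) ! lvl (W ! p)) (act (W ! q)) (act (W ! p))"
    "lvl (W ! p) < length (X (thr (W ! p)))"
proof -
  have b: "before W (W ! q) (W ! p)" "thr (W ! q) = thr (W ! p)"
    using assms by (auto simp: Q_def intro: before_nth)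
  have l: "lvl (W ! q) = lvl (W ! p)" using same_thread(1)[OF b] assms by (auto simp: Q_def)
  show "node (W ! p) = node (W ! q)" using l b by simp
  show "before (U (thr (W ! p)) ! lvl (W ! p)) (act (W ! q)) (act (W ! p))"
    "lvl (W ! p) < length (X (thr (W ! p)))" using same_thread(3)[OF b l refl] by auto
qed

text \<open>Standing still is program order by an infix of one letter, a forward move is program
  order, and a backward move runs against it inside a block.\<close>

lemma Q_PA: "(p, q) \<in> Q \<Longrightarrow> (act (W ! p), act (W ! q)) \<in> PA"
proof -
  assume pq: "(p, q) \<in> Q"
  consider "p = q" | "p < q" | "q < p" by linarith
  then show ?thesis
  proof cases
    case 1
    then have "act (W ! p) \<in> labels G" using pq by (auto simp: Q_def intro!: act_label)
    then show ?thesis using 1 by (auto simp: po_eq[OF cfg])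
  next
    case 2
    then have "before W (W ! p) (W ! q)" using pq by (auto simp: Q_def intro: before_nth)
    then show ?thesis using same_thread(2) pq by (auto simp: Q_def)
  next
    case 3
    show ?thesis using atom_before_atomic_rel[OF back_step(2)[OF pq 3] atom[OF back_step(3)[OF pq 3]]]
      by blast
  qed
qed

text \<open>The first and the last conflict are split off, and the labels between them form a chain.
  A single conflict has no such middle part and remains a separate case.\<close>

lemma chain_labels:
  assumes "(y, u) \<in> D O (Q O D)\<^sup>*"
  shows "(y, u) \<in> D \<or> (\<exists>a b. (act (W ! y), a) \<in> dependence G I \<and> (a, b) \<in> inner_arrow G I F \<and>
    (b, act (W ! u)) \<in> dependence G I)"
proof -
  obtain v where v: "(y, v) \<in> D" "(v, u) \<in> (Q O D)\<^sup>*" using assms by blast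
  from v(2) have "v = u \<or> (\<exists>b. (act (W ! v), b) \<in> inner_arrow G I F \<and>
    (b, act (W ! u)) \<in> dependence G I)"
  proof (induction rule: rtrancl_induct)
    case (step u u')
    then obtain z where z: "(u, z) \<in> Q" "(z, u') \<in> D" by blast
    have d: "(act (W ! z), act (W ! u')) \<in> dependence G I" by (rule D_dependence[OF z(2)])
    from step.IH show ?case
    proof
      assume "v = u"
      then have "(act (W ! v), act (W ! z)) \<in> inner_arrow G I F"
        using Q_PA[OF z(1)] unfolding inner_arrow_def by blast
      then show ?thesis using d by blast
    next
      assume "\<exists>b. (act (W ! v), b) \<in> inner_arrow G I F \<and> (b, act (W ! u)) \<in> dependence G I"
      then obtain b where b: "(act (W ! v), b) \<in> inner_arrow G I F"
        "(b, act (W ! u)) \<in> dependence G I" by blast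
      then obtain c where "(act (W ! v), c) \<in> PA" "(c, b) \<in> (dependence G I O PA)\<^sup>*"
        unfolding inner_arrow_def by blast
      moreover have "(b, act (W ! z)) \<in> dependence G I O PA" using b(2) Q_PA[OF z(1)] by blast
      ultimately have "(act (W ! v), act (W ! z)) \<in> inner_arrow G I F"
        unfolding inner_arrow_def by (meson relcomp.relcompI rtrancl.rtrancl_into_rtrancl)
      then show ?thesis using d by blast
    qed
  qed simp
  then show ?thesis using v(1) D_dependence[OF v(1)] by blast
qed

lemma no_back_chain:
  assumes "\<not> breaking_chain I" "(u, y) \<in> Q" "y < u"
  shows "(y, u) \<notin> D O (Q O D)\<^sup>*"
proof
  assume "(y, u) \<in> D O (Q O D)\<^sup>*"
  \<comment> \<open>A single conflict would join two events of one thread.\<close>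
  moreover have "(y, u) \<notin> D" using assms(2) by (auto simp: D_def Q_def)
  ultimately obtain a b where ab: "(act (W ! y), a) \<in> dependence G I" "(a, b) \<in> inner_arrow G I F"
    "(b, act (W ! u)) \<in> dependence G I" using chain_labels by blast
  obtain \<beta> H e f where H: "(\<beta>, H) \<in> set (blocks F)" "(e, f) \<in> (edge_succ H)\<^sup>+"
    "lab e = act (W ! y)" "lab f = act (W ! u)"
    using atom_split[OF back_step(2)[OF assms(2,3)] atom[OF back_step(3)[OF assms(2,3)]]] .
  have "(lab e, a) \<notin> I" "(b, lab f) \<notin> I" using ab H by (auto simp: dependence_def)
  then have "breaking_chain I" unfolding breaking_chain_def using H(1,2) ab(2) by blast
  then show False using assms(1) by blast
qed

lemma acyclic_QD:
  assumes "\<not> breaking_chain I"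
  shows "acyclic (Q O D)"
proof (rule acyclicI, intro allI notI)
  fix x assume x: "(x, x) \<in> (Q O D)\<^sup>+"
  define A where "A = {(p, q) \<in> Q. p \<le> q} O D"
  define B where "B = {(p, q) \<in> Q. q < p} O D"
  have AB: "Q O D = A \<union> B" unfolding A_def B_def by force
  \<comment> \<open>Without backward moves positions strictly increase, because conflicts point
    forward.\<close>
  have "(p, q) \<in> A\<^sup>+ \<Longrightarrow> p < q" for p q
    by (induction rule: trancl_induct) (auto simp: A_def D_def)
  then have "(x, x) \<notin> A\<^sup>+" by blast
  then obtain u v where "(u, v) \<in> B" "(x, u) \<in> (Q O D)\<^sup>*" "(v, x) \<in> (Q O D)\<^sup>*"
    using trancl_Un_cases[of x x A B] x unfolding AB by blast
  moreover from this(1) obtain y where "(u, y) \<in> Q" "y < u" "(y, v) \<in> D" unfolding B_def by blast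
  ultimately have "(y, u) \<in> D O (Q O D)\<^sup>*" by (meson relcomp.relcompI rtrancl_trans)
  then show False using no_back_chain[OF assms] \<open>(u, y) \<in> Q\<close> \<open>y < u\<close> by blast
qed

text \<open>The inequalities on levels absorb the moves within a thread before the first and after
  the last conflict; only the conflicts and the moves between them are kept as positions.\<close>

lemma node_graph_trancl:
  assumes "(M, N) \<in> (node_graph I strip node W)\<^sup>+"
  shows "fst M = fst N \<and> snd M < snd N \<or>
    (\<exists>p q. (p, q) \<in> D O (Q O D)\<^sup>* \<and> p < length W \<and> q < length W \<and>
       thr (W ! p) = fst M \<and> snd M \<le> lvl (W ! p) \<and> thr (W ! q) = fst N \<and> lvl (W ! q) \<le> snd N)"
proof -
  have edge: "fst M = fst N \<and> snd M < snd N \<or>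
      (\<exists>p q. (p, q) \<in> D \<and> p < length W \<and> q < length W \<and> node (W ! p) = M \<and> node (W ! q) = N)"
    if MN: "(M, N) \<in> node_graph I strip node W" for M N
  proof -
    obtain y z where yz: "M = node y" "N = node z" "before W y z" "M \<noteq> N" "\<not> indep I (strip y) (strip z)"
      using MN by (rule node_graphE)
    obtain p q where pq: "p < q" "q < length W" "W ! p = y" "W ! q = z"
      using yz(3) by (rule before_nthE)
    show ?thesis
    proof (cases "thr y = thr z")
      case True
      then show ?thesis using same_thread(1)[OF yz(3)] yz(1,2,4) by auto
    next
      case False
      then have "(p, q) \<in> D" using pq yz by (auto simp: D_def)
      moreover have "p < length W" "node (W ! p) = M" "node (W ! q) = N" using pq yz by auto
      ultimately show ?thesis using pq(2) by blast
    qed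
  qed
  from assms show ?thesis
  proof (induction rule: trancl_induct)
    case (base N)
    from edge[OF base] show ?case
    proof
      assume "\<exists>p q. (p, q) \<in> D \<and> p < length W \<and> q < length W \<and> node (W ! p) = M \<and> node (W ! q) = N"
      then obtain p q where "(p, q) \<in> D" "p < length W" "q < length W" "node (W ! p) = M" "node (W ! q) = N"
        by blast
      then show ?thesis by (intro disjI2 exI[of _ p] exI[of _ q]) auto
    qed blast
  next
    case (step N N')
    from edge[OF step.hyps(2)] show ?case
    proof
      assume N: "fst N = fst N' \<and> snd N < snd N'"
      from step.IH show ?thesis
      proof
        assume "fst M = fst N \<and> snd M < snd N"
        then show ?thesis using N by auto
      next
        assume "\<exists>p q. (p, q) \<in> D O (Q O D)\<^sup>* \<and> p < length W \<and> q < length W \<and>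
          thr (W ! p) = fst M \<and> snd M \<le> lvl (W ! p) \<and> thr (W ! q) = fst N \<and> lvl (W ! q) \<le> snd N"
        then obtain p q where "(p, q) \<in> D O (Q O D)\<^sup>*" "p < length W" "q < length W"
          "thr (W ! p) = fst M" "snd M \<le> lvl (W ! p)" "thr (W ! q) = fst N" "lvl (W ! q) \<le> snd N"
          by blast
        then show ?thesis using N by (intro disjI2 exI[of _ p] exI[of _ q]) auto
      qed
    next
      assume "\<exists>p q. (p, q) \<in> D \<and> p < length W \<and> q < length W \<and> node (W ! p) = N \<and> node (W ! q) = N'"
      then obtain p' q' where D: "(p', q') \<in> D" "p' < length W" "q' < length W"
        "node (W ! p') = N" "node (W ! q') = N'" by blast
      from step.IH show ?thesis
      proof
        assume "fst M = fst N \<and> snd M < snd N"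
        then show ?thesis using D by (intro disjI2 exI[of _ p'] exI[of _ q']) auto
      next
        assume "\<exists>p q. (p, q) \<in> D O (Q O D)\<^sup>* \<and> p < length W \<and> q < length W \<and>
          thr (W ! p) = fst M \<and> snd M \<le> lvl (W ! p) \<and> thr (W ! q) = fst N \<and> lvl (W ! q) \<le> snd N"
        then obtain p q where p: "(p, q) \<in> D O (Q O D)\<^sup>*" "p < length W" "q < length W"
          "thr (W ! p) = fst M" "snd M \<le> lvl (W ! p)" "thr (W ! q) = fst N" "lvl (W ! q) \<le> snd N"
          by blast
        have "(q, p') \<in> Q" using p D by (auto simp: Q_def)
        then have "(q, q') \<in> Q O D" using D by blast
        then have "(p, q') \<in> D O (Q O D)\<^sup>*" using p(1) by (meson relcomp.simps rtrancl.rtrancl_into_rtrancl)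
        then show ?thesis using p D by (intro disjI2 exI[of _ p] exI[of _ q']) auto
      qed
    qed
  qed
qed

lemma acyclic_nodes:
  assumes "\<not> breaking_chain I"
  shows "acyclic (node_graph I strip node W)"
proof (rule acyclicI, intro allI notI)
  fix N assume "(N, N) \<in> (node_graph I strip node W)\<^sup>+"
  from node_graph_trancl[OF this] obtain p q where pq: "(p, q) \<in> D O (Q O D)\<^sup>*"
    "p < length W" "q < length W" "thr (W ! p) = fst N" "snd N \<le> lvl (W ! p)"
    "thr (W ! q) = fst N" "lvl (W ! q) \<le> snd N" by blast
  \<comment> \<open>Both ends lie in the thread of \<open>N\<close>, and the level of
    \<open>N\<close> is between theirs; this move closes the walk.\<close>
  have "(q, p) \<in> Q" using pq by (auto simp: Q_def)
  moreover obtain v where "(p, v) \<in> D" "(v, q) \<in> (Q O D)\<^sup>*" using pq(1) by blast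
  ultimately have "(q, q) \<in> (Q O D)\<^sup>+" by (meson relcomp.relcompI rtrancl_into_trancl2)
  then show False using acyclic_QD[OF assms] by (auto simp: acyclic_def)
qed

end

section \<open>The fused word given by a topological order of the atoms\<close>

context annotated
begin

lemma node_image: "(i, k) \<in> node ` set W \<longleftrightarrow> k < length (X i)"
proof
  assume "(i, k) \<in> node ` set W"
  then obtain z where z: "z \<in> set W" "i = thr z" "k = lvl z" by auto
  then have "fst z \<in> set (proj i W)" by (force simp: proj_def)
  then have "(act z, lvl z) \<in> set (tag 0 (U i))" by (simp add: W)
  then show "k < length (X i)" using in_tagD z(3) length_U by fastforce
next
  assume k: "k < length (X i)"
  then have "U i ! k \<noteq> []" using atom morph_not_Nil by metis
  then have "(hd (U i ! k), 0 + k) \<in> set (proj i W)"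
    unfolding W by (intro in_tagI) (use k length_U in auto)
  then have "((hd (U i ! k), k), i) \<in> set W" by (auto simp: proj_def)
  then show "(i, k) \<in> node ` set W" by force
qed

lemma node_word:
  assumes "k < length (X i)"
  shows "map strip (filter (\<lambda>z. node z = (i, k)) W) = index i (U i ! k)"
proof -
  have "map fst (filter (\<lambda>z. node z = (i, k)) W) = filter (\<lambda>t. snd t = 0 + k) (proj i W)"
    by (induction W) auto
  also have "\<dots> = map (\<lambda>a. (a, k)) (U i ! k)"
    unfolding W filter_tag using assms length_U by simp
  finally have "map (\<lambda>t. (fst t, i)) (map fst (filter (\<lambda>z. node z = (i, k)) W)) = index i (U i ! k)"
    by (simp add: index_def comp_def)
  moreover have "map strip (filter (\<lambda>z. node z = (i, k)) W) =
      map (\<lambda>t. (fst t, i)) (map fst (filter (\<lambda>z. node z = (i, k)) W))"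
    by (auto simp: map_prod_def split: prod.splits)
  ultimately show ?thesis by simp
qed

text \<open>The nodes in topological order spell a fused word, and their fibres spell its
  refinement. The point to check is that every thread of this fused word is \<open>X i\<close>
  again.\<close>

lemma reorderable:
  assumes "\<not> breaking_chain I"
  shows "\<exists>w'\<in>morph_lang (indexed_morph \<mu>) (interleavings G'). reorder_le I (map strip W) w'"
proof -
  obtain ns where ns: "distinct ns" "set ns = node ` set W"
    "\<And>M N. before ns M N \<Longrightarrow> (N, M) \<notin> node_graph I strip node W"
    "reorder_le I (map strip W) (map strip (concat (map (\<lambda>N. filter (\<lambda>x. node x = N) W) ns)))"
    by (rule reorder_topological[OF acyclic_nodes[OF assms]]) (rule that)
  have mem: "(i, k) \<in> set ns \<longleftrightarrow> k < length (X i)" for i k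
    unfolding ns(2) by (rule node_image)
  let ?u = "\<lambda>(i, k). index i (U i ! k)" and ?x = "\<lambda>(i, k). (X i ! k, i)"
  have "map strip (concat (map (\<lambda>N. filter (\<lambda>x. node x = N) W) ns)) =
      concat (map (\<lambda>N. map strip (filter (\<lambda>x. node x = N) W)) ns)"
    by (simp add: map_concat comp_def)
  also have "map (\<lambda>N. map strip (filter (\<lambda>x. node x = N) W)) ns = map ?u ns"
    using mem by (auto simp: node_word[simplified])
  finally have eq: "map strip (concat (map (\<lambda>N. filter (\<lambda>x. node x = N) W) ns)) = concat (map ?u ns)" .
  have "list_all2 (\<lambda>u x. u \<in> indexed_morph \<mu> x) (map ?u ns) (map ?x ns)"
    using mem by (auto simp: list_all2_conv_all_nth indexed_morph_def split: prod.splits)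
      (metis atom imageI nth_mem)
  then have atomic: "concat (map ?u ns) \<in> morph_word (indexed_morph \<mu>) (map ?x ns)"
    unfolding morph_word_iff by blast
  have "proj i (map ?x ns) = X i" for i
  proof -
    let ?l = "map snd (filter (\<lambda>N. fst N = i) ns)"
    have "k < k'" if b: "before ns (i, k) (i, k')" for k k'
    proof (rule ccontr)
      assume "\<not> k < k'"
      moreover have "k \<noteq> k'"
        using before_distinct[OF ns(1) b] by simp
      ultimately have "k' < k" by simp
      have k: "k < length (X i)" "k' < length (X i)" using before_set[OF b] mem by auto
      then have "U i ! k \<noteq> []" "U i ! k' \<noteq> []" using atom morph_not_Nil by metis+
      then obtain a a' where a: "a \<in> set (U i ! k)" "a' \<in> set (U i ! k')"
        by (meson hd_in_set)
      \<comment> \<open>Letters of one thread never commute, so the earlier atom has an edge to the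
        later one, against the order of \<open>ns\<close>. The letters exist because atoms are not
        empty.\<close>
      have "before (proj i W) (a', 0 + k') (a, 0 + k)"
        unfolding W using \<open>k' < k\<close> k a length_U by (intro before_tagI) auto
      then have "before W ((a', k'), i) ((a, k), i)" by (auto intro: before_proj)
      from node_graphI[OF this, of node I strip] \<open>k' < k\<close>
      have "((i, k'), (i, k)) \<in> node_graph I strip node W" by (simp add: indep_def)
      then show False using ns(3)[OF b] by blast
    qed
    then have "sorted_wrt (\<lambda>M N. snd M < snd N) (filter (\<lambda>N. fst N = i) ns)"
      unfolding sorted_wrt_before before_filter by auto
    then have "sorted_wrt (<) ?l" by (simp add: sorted_wrt_map)
    moreover have "set ?l = set [0..<length (X i)]" using mem by force
    ultimately have "?l = [0..<length (X i)]"
      by (intro strict_sorted_equal) (auto simp: strict_sorted_iff)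
    moreover have "proj i (map ?x ns) = map (\<lambda>k. X i ! k) ?l"
      by (induction ns) auto
    ultimately show ?thesis by (simp add: map_nth)
  qed
  then have "map ?x ns \<in> interleavings G'" using X by (simp add: interleavings_def)
  then have "concat (map ?u ns) \<in> morph_lang (indexed_morph \<mu>) (interleavings G')"
    using atomic unfolding morph_lang_def by blast
  then show ?thesis using ns(4) unfolding eq by blast
qed

end

context fusion
begin

lemma no_breaking_chain_sound:
  assumes "\<not> breaking_chain I"
  shows "sound_fusion G I F"
  unfolding sound_fusion_def mazurkiewicz_reduction_def
proof (intro conjI ballI)
  show "morph_lang (indexed_morph \<mu>) (interleavings G') \<subseteq> interleavings G"
    by (rule morph_lang_interleavings)
next
  fix w assume w: "w \<in> interleavings G"
  have "\<exists>xs us. xs \<in> traces G' \<union> {[]} \<and> list_all2 (\<lambda>u x. u \<in> \<mu> x) us xs \<and> concat us = proj i w" for i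
  proof (cases "proj i w = []")
    case True
    then show ?thesis by (intro exI[of _ "[]"]) auto
  next
    case False
    then have "proj i w \<in> traces G" using w by (auto simp: interleavings_def)
    then obtain xs where "xs \<in> traces G'" "proj i w \<in> morph_word \<mu> xs"
      unfolding traces_G morph_lang_def by blast
    moreover from this(2) obtain us where "proj i w = concat us" "list_all2 (\<lambda>u x. u \<in> \<mu> x) us xs"
      unfolding morph_word_iff by auto
    ultimately show ?thesis by (intro exI[of _ xs] exI[of _ us]) simp
  qed
  then obtain X U where XU: "\<And>i. X i \<in> traces G' \<union> {[]}"
    "\<And>i. list_all2 (\<lambda>u x. u \<in> \<mu> x) (U i) (X i)" "\<And>i. concat (U i) = proj i w"
    by metis
  have "map fst (tag 0 (U i)) = proj i w" for i by (simp add: map_fst_tag XU)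
  then obtain W where strip_W: "map (map_prod fst id) W = w" and proj_W: "\<And>i. proj i W = tag 0 (U i)"
    using lift_interleaving[of fst "\<lambda>i. tag 0 (U i)" w] by blast
  interpret annotated G F I W X U
    by unfold_locales (use XU proj_W in auto)
  show "\<exists>w'\<in>morph_lang (indexed_morph \<mu>) (interleavings G'). reorder_le I w w'"
    using reorderable[OF assms] strip_W by simp
qed

end

section \<open>Reorderings as permutations of positions\<close>

text \<open>Follows occurrences, since letters may repeat. It is a necessary condition for
  \<open>reorder_le\<close>; dependence is read in the order of \<open>w\<close>, as
  \<open>I\<close> may be asymmetric.\<close>

definition reordering ::
    "('a \<times> 'a) set \<Rightarrow> ('a \<times> nat) list \<Rightarrow> ('a \<times> nat) list \<Rightarrow> (nat \<Rightarrow> nat) \<Rightarrow> bool" where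
  "reordering I w w' \<sigma> \<longleftrightarrow> length w' = length w \<and> bij_betw \<sigma> {..<length w} {..<length w} \<and>
     (\<forall>p<length w. w' ! \<sigma> p = w ! p) \<and>
     (\<forall>p q. p < q \<longrightarrow> q < length w \<longrightarrow> \<not> indep I (w ! p) (w ! q) \<longrightarrow> \<sigma> p < \<sigma> q)"

text \<open>The transposition \<open>\<tau>\<close> reverses a single pair of positions, whose
  letters are independent in the order before the swap.\<close>

lemma reordering_swap:
  assumes \<sigma>: "reordering I w u \<sigma>" and "swap I u v"
  shows "\<exists>\<sigma>. reordering I w v \<sigma>"
proof -
  obtain r x y s where uv: "indep I x y" "u = r @ x # y # s" "v = r @ y # x # s"
    using assms(2) swap_iff by metis
  define m where "m = length r"
  define \<tau> where "\<tau> k = (if k = m then m + 1 else if k = m + 1 then m else k)" for k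
  have len: "length v = length u" "length u = length w" "m + 1 < length u"
    using \<sigma> uv by (auto simp: reordering_def m_def)
  have "bij_betw \<tau> {..<length w} {..<length w}"
    by (rule bij_betw_byWitness[where f' = \<tau>]) (use len in \<open>auto simp: \<tau>_def\<close>)
  then have bij: "bij_betw (\<tau> \<circ> \<sigma>) {..<length w} {..<length w}"
    using \<sigma> by (auto simp: reordering_def intro: bij_betw_trans)
  have nth: "v ! \<tau> k = u ! k" for k
    by (auto simp: \<tau>_def uv m_def nth_append nth_Cons' Suc_diff_le)
  have uxy: "u ! m = x" "u ! (m + 1) = y" by (auto simp: uv m_def nth_append)
  have "reordering I w v (\<tau> \<circ> \<sigma>)"
    unfolding reordering_def
  proof (intro conjI allI impI bij)
    fix p q assume pq: "p < q" "q < length w" "\<not> indep I (w ! p) (w ! q)"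
    then have less: "\<sigma> p < \<sigma> q" using \<sigma> by (simp add: reordering_def)
    have "u ! \<sigma> p = w ! p" "u ! \<sigma> q = w ! q" using \<sigma> pq by (auto simp: reordering_def)
    then have "\<not> (\<sigma> p = m \<and> \<sigma> q = m + 1)" using pq(3) uv(1) uxy by auto
    then show "(\<tau> \<circ> \<sigma>) p < (\<tau> \<circ> \<sigma>) q" using less by (auto simp: \<tau>_def)
  qed (use len \<sigma> nth in \<open>auto simp: reordering_def\<close>)
  then show ?thesis by blast
qed

lemma reorder_le_reordering: "reorder_le I w w' \<Longrightarrow> \<exists>\<sigma>. reordering I w w' \<sigma>"
  unfolding reorder_le_def
proof (induction rule: rtranclp_induct)
  case base
  show ?case by (rule exI[of _ "\<lambda>p. p"]) (auto simp: reordering_def bij_betw_def)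
next
  case (step u v)
  then show ?case using reordering_swap by blast
qed

lemma reorder_le_proj:
  assumes "reorder_le I w w'" shows "proj i w' = proj i w"
proof -
  have "proj i u = proj i v" if "swap I u v" for u v
    using that by (auto simp: swap_iff indep_def)
  with assms show ?thesis
    unfolding reorder_le_def by (induction rule: rtranclp_induct) auto
qed

lemma length_proj_take:
  assumes "p \<le> length w"
  shows "length (proj i (take p w)) = card {q. q < p \<and> snd (w ! q) = i}"
proof -
  have "length (proj i (take p w)) = card {q. q < length (take p w) \<and> snd (take p w ! q) = i}"
    by (simp add: proj_def length_filter_conv_card)
  also have "{q. q < length (take p w) \<and> snd (take p w ! q) = i} = {q. q < p \<and> snd (w ! q) = i}"
    using assms by auto
  finally show ?thesis .
qed

section \<open>Numbering of the events of a thread under a reordering\<close>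

context
  fixes I :: "('a \<times> 'a) set" and w w' :: "('a \<times> nat) list" and \<sigma>
  assumes \<sigma>: "reordering I w w' \<sigma>"
begin

lemma reordering_less: "p < length w \<Longrightarrow> \<sigma> p < length w"
  using \<sigma> by (auto simp: reordering_def bij_betw_def)

lemma reordering_nth: "p < length w \<Longrightarrow> w' ! \<sigma> p = w ! p"
  using \<sigma> by (auto simp: reordering_def)

lemma reordering_dep: "p < q \<Longrightarrow> q < length w \<Longrightarrow> \<not> indep I (w ! p) (w ! q) \<Longrightarrow> \<sigma> p < \<sigma> q"
  using \<sigma> by (auto simp: reordering_def)

lemma reordering_thread: "p < q \<Longrightarrow> q < length w \<Longrightarrow> snd (w ! p) = snd (w ! q) \<Longrightarrow> \<sigma> p < \<sigma> q"
  by (rule reordering_dep) (auto simp: indep_def)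

lemma reordering_neq: "p < length w \<Longrightarrow> q < length w \<Longrightarrow> p \<noteq> q \<Longrightarrow> \<sigma> p \<noteq> \<sigma> q"
  using \<sigma> by (auto simp: reordering_def bij_betw_def inj_on_def)

text \<open>On the events of one thread \<open>\<sigma>\<close> is monotone, so the number of
  earlier events of that thread is invariant. This locates an event of \<open>w\<close> within the
  threads of \<open>w'\<close>.\<close>

lemma reordering_count:
  assumes p: "p < length w" "snd (w ! p) = i"
  shows "length (proj i (take (\<sigma> p) w')) = length (proj i (take p w))"
proof -
  have len: "length w' = length w" using \<sigma> by (simp add: reordering_def)
  have "\<sigma> ` {q. q < p \<and> snd (w ! q) = i} = {q. q < \<sigma> p \<and> snd (w' ! q) = i}"
  proof (intro equalityI subsetI)
    fix q' assume "q' \<in> \<sigma> ` {q. q < p \<and> snd (w ! q) = i}"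
    then show "q' \<in> {q. q < \<sigma> p \<and> snd (w' ! q) = i}"
      using p reordering_thread reordering_nth by auto
  next
    fix q' assume q': "q' \<in> {q. q < \<sigma> p \<and> snd (w' ! q) = i}"
    then have "q' < length w" using reordering_less[OF p(1)] by auto
    then obtain q where q: "q < length w" "\<sigma> q = q'"
      using \<sigma> unfolding reordering_def bij_betw_def by (metis imageE lessThan_iff)
    then have "snd (w ! q) = i" using q' reordering_nth by auto
    moreover have "q < p"
      using reordering_thread[of p q] q q' p \<open>snd (w ! q) = i\<close> by (cases p q rule: linorder_cases) auto
    ultimately show "q' \<in> \<sigma> ` {q. q < p \<and> snd (w ! q) = i}" using q by auto
  qed
  moreover have "inj_on \<sigma> {q. q < p \<and> snd (w ! q) = i}"
    using \<sigma> p unfolding reordering_def bij_betw_def by (auto elim!: inj_on_subset)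
  ultimately have "card {q. q < \<sigma> p \<and> snd (w' ! q) = i} = card {q. q < p \<and> snd (w ! q) = i}"
    using card_image by force
  then show ?thesis
    using p reordering_less[OF p(1)] len by (simp add: length_proj_take)
qed

text \<open>Events are compared with the contiguous factor by their numbers in the thread. A lower
  bound for \<open>p\<close> and an upper bound for \<open>q\<close> suffice, as \<open>z\<close>
  lies between their images.\<close>

lemma contiguous_between:
  assumes w': "w' = R @ index i c @ S"
    and p: "p < length w" "snd (w ! p) = i" "length (proj i R) \<le> length (proj i (take p w))"
    and q: "q < length w" "snd (w ! q) = i"
      "length (proj i (take q w)) < length (proj i R) + length c"
    and z: "\<sigma> p < z" "z < \<sigma> q"
  shows "snd (w' ! z) = i"
proof -
  have len: "length w' = length w" using \<sigma> by (simp add: reordering_def)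
  have "length R \<le> \<sigma> p"
  proof (rule ccontr)
    assume "\<not> length R \<le> \<sigma> p"
    then have "\<sigma> p < length R" by simp
    then have "R = take (\<sigma> p) w' @ w' ! \<sigma> p # drop (Suc (\<sigma> p)) R"
      by (simp add: w' nth_append id_take_nth_drop[symmetric])
    then have "proj i R = proj i (take (\<sigma> p) w') @ proj i (w' ! \<sigma> p # drop (Suc (\<sigma> p)) R)"
      by (metis proj_simps(3))
    then have "length (proj i (take (\<sigma> p) w')) < length (proj i R)"
      using reordering_nth[OF p(1)] p(2) by simp
    then show False using reordering_count[OF p(1,2)] p(3) by simp
  qed
  moreover have "\<sigma> q < length R + length c"
  proof (rule ccontr)
    assume "\<not> \<sigma> q < length R + length c"
    then have "take (\<sigma> q) w' = R @ index i c @ take (\<sigma> q - length R - length c) S"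
      by (simp add: w' index_def)
    then have "length (proj i R) + length c \<le> length (proj i (take (\<sigma> q) w'))" by simp
    then show False using reordering_count[OF q(1,2)] q(3) by simp
  qed
  ultimately have "\<not> z < length R" "z - length R < length c" using z by linarith+
  then show ?thesis by (simp add: w' nth_append index_def)
qed

end

section \<open>Interleavings that cannot be reordered\<close>

context fusion
begin

text \<open>Disjointness of labels makes both atoms traces of \<open>H\<close>. One ends at the exit
  and the other begins at the initial location; as labels determine edges, \<open>m\<close> would be
  both.\<close>

lemma atom_boundary:
  assumes "u \<in> \<mu> x" "x \<in> labels G'" "u' \<in> \<mu> x'" "x' \<in> labels G'"
    and H: "(\<beta>, H) \<in> set (blocks F)" "(l, last u, m) \<in> edges H" "(m, hd u', n) \<in> edges H"
  shows False
proof -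
  have labels: "last u \<in> labels H" "hd u' \<in> labels H" using H by (force simp: labels_def)+
  have unique: "e = f" if "e \<in> edges H" "f \<in> edges H" "lab e = lab f" for e f
    using block_cfg(1)[OF H(1)] that unfolding is_cfg_def by blast
  have atom_trace: "v \<in> traces H" if v: "v \<in> \<mu> y" "y \<in> labels G'" "a \<in> set v" "a \<in> labels H" for v y a
    using v(1)
  proof (cases rule: morph_cases)
    case 1
    then show ?thesis using inserted_kept_labels[OF inserted H(1) v(2)] v(3,4) by simp
  next
    case (2 H')
    then have "a \<in> labels H'" using traces_labels v(3) by blast
    then show ?thesis using inserted_blocks_disjoint[OF inserted H(1) 2(1) v(4)] 2(2) by simp
  qed
  have ne: "u \<noteq> []" "u' \<noteq> []" using assms(1,3) morph_not_Nil by metis+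
  have "u \<in> traces H" "u' \<in> traces H"
    using atom_trace[OF assms(1,2) _ labels(1)] atom_trace[OF assms(3,4) _ labels(2)] ne by auto
  then have "path H (init H) (butlast u @ [last u]) (exit H)" "path H (init H) (hd u' # tl u') (exit H)"
    using ne by (auto simp: traces_def)
  then obtain l' n' where "(l', last u, exit H) \<in> edges H" "(init H, hd u', n') \<in> edges H" by auto
  then have "m = exit H" "m = init H" using unique H(2,3) by fastforce+
  then show False using block_cfg(1)[OF H(1)] by (simp add: is_cfg_def)
qed

lemma first_letter:
  assumes "w \<in> morph_word (indexed_morph \<mu>) v" "fst ` set v \<subseteq> labels G'" "proj i w \<noteq> []"
  obtains x u where "x \<in> labels G'" "u \<in> \<mu> x" "hd (proj i w) = hd u"
  using assms
proof (induction v arbitrary: w thesis)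
  case (Cons y v)
  then obtain u w' where w: "w = index (snd y) u @ w'" "u \<in> \<mu> (fst y)" "w' \<in> morph_word (indexed_morph \<mu>) v"
    unfolding morph_word.simps by (auto simp: indexed_morph_def[of \<mu> y])
  show ?case
  proof (cases "snd y = i")
    case True
    moreover have "u \<noteq> []" using w(2) morph_not_Nil by metis
    ultimately show ?thesis using Cons.prems(1)[of "fst y" u] Cons.prems(3) w by simp
  next
    case False
    then show ?thesis using Cons.IH[OF _ w(3)] Cons.prems w(1) by auto
  qed
qed simp

text \<open>A path in a block graph cannot cross a border between atoms of a thread, so
  \<open>c\<close> lies in a single atom and is copied into \<open>w\<close> as a whole.\<close>

lemma atomic_contiguous:
  assumes "w \<in> morph_word (indexed_morph \<mu>) v" "fst ` set v \<subseteq> labels G'"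
    and H: "(\<beta>, H) \<in> set (blocks F)" "path H l c m" and "c \<noteq> []" "proj i w = r @ c @ s"
  shows "\<exists>R S. w = R @ index i c @ S \<and> proj i R = r"
  using assms(1,2,6)
proof (induction v arbitrary: w r)
  case Nil
  then show ?case using \<open>c \<noteq> []\<close> by simp
next
  case (Cons y v)
  then obtain u w' where w: "w = index (snd y) u @ w'" "u \<in> \<mu> (fst y)" "w' \<in> morph_word (indexed_morph \<mu>) v"
    unfolding morph_word.simps by (auto simp: indexed_morph_def[of \<mu> y])
  have v: "fst ` set v \<subseteq> labels G'" "fst y \<in> labels G'" using Cons.prems(2) by auto
  note IH = Cons.IH[OF w(3) v(1)]
  show ?case
  proof (cases "snd y = i")
    case False
    then obtain R S where "w' = R @ index i c @ S" "proj i R = r" using IH[of r] Cons.prems(3) w(1) by auto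
    then show ?thesis using False w(1) by (intro exI[of _ "index (snd y) u @ R"] exI[of _ S]) auto
  next
    case True
    then have "u @ proj i w' = r @ (c @ s)" using Cons.prems(3) w(1) by simp
    \<comment> \<open>Either the first atom belongs to \<open>r\<close> altogether, or
      \<open>c\<close> begins inside it.\<close>
    then consider r' where "r = u @ r'" "proj i w' = r' @ c @ s"
      | z where "u = r @ z" "z \<noteq> []" "z @ proj i w' = c @ s"
      unfolding append_eq_append_conv2 by force
    then show ?thesis
    proof cases
      case 1
      obtain R S where "w' = R @ index i c @ S" "proj i R = r'" using IH 1(2) by blast
      then show ?thesis using 1 True w(1) by (intro exI[of _ "index i u @ R"] exI[of _ S]) auto
    next
      case (2 z)
      from 2(3) consider z' where "z = c @ z'" | c' where "c = z @ c'" "c' \<noteq> []" "proj i w' = c' @ s"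
        unfolding append_eq_append_conv2 by force
      then show ?thesis
      proof cases
        case (1 z')
        then show ?thesis using 2 True w(1)
          by (intro exI[of _ "index i r"] exI[of _ "index i z' @ w'"]) auto
      next
        \<comment> \<open>Here \<open>c\<close> would continue in the next atom of the
          thread.\<close>
        case (2 c')
        then obtain x u' where u': "x \<in> labels G'" "u' \<in> \<mu> x" "hd (proj i w') = hd u'"
          using first_letter[OF w(3) v(1), of i] by auto
        have "last u = last z" "hd c' = hd u'" using \<open>u = r @ z\<close> \<open>z \<noteq> []\<close> 2 u'(3) by auto
        moreover have "c = butlast z @ last z # hd c' # tl c'" using \<open>z \<noteq> []\<close> 2 by simp
        ultimately have "path H l (butlast z @ last u # hd u' # tl c') m" using H(2) by simp
        then obtain l1 l2 l3 where "(l1, last u, l2) \<in> edges H" "(l2, hd u', l3) \<in> edges H" by auto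
        then show ?thesis using atom_boundary[OF w(2) v(2) u'(2,1) H(1)] by blast
      qed
    qed
  qed
qed

end

section \<open>Chains of fresh threads\<close>

context fusion
begin

definition atomic :: "('a \<times> nat) list \<Rightarrow> bool" where
  "atomic w \<longleftrightarrow> w \<in> morph_lang (indexed_morph \<mu>) (interleavings G')"

lemma atomic_between:
  assumes "atomic w'" and \<sigma>: "reordering I w w' \<sigma>" and proj: "proj i w' = r @ c @ s"
    and H: "(\<beta>, H) \<in> set (blocks F)" "path H l c m"
    and p: "p < length w" "snd (w ! p) = i" "length r \<le> length (proj i (take p w))"
    and q: "q < length w" "snd (w ! q) = i" "length (proj i (take q w)) < length r + length c"
    and z: "\<sigma> p < z" "z < \<sigma> q"
  shows "snd (w' ! z) = i"
proof (cases "c = []")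
  case True
  \<comment> \<open>With this, the bounds on \<open>p\<close> and \<open>q\<close> contradict each
    other for empty \<open>c\<close>.\<close>
  have "p < q"
    using reordering_thread[OF \<sigma>, of q p] p(1,2) q(2) z by (cases p q rule: linorder_cases) auto
  then have "take q w = take p w @ drop p (take q w)" by (metis append_take_drop_id min.absorb1 less_imp_le take_take)
  then have "length (proj i (take p w)) \<le> length (proj i (take q w))"
    by (metis proj_simps(3) length_append le_add1)
  then show ?thesis using True p(3) q(3) by simp
next
  case False
  obtain v where v: "v \<in> interleavings G'" "w' \<in> morph_word (indexed_morph \<mu>) v"
    using assms(1) by (auto simp: atomic_def morph_lang_def)
  have "fst ` set v \<subseteq> labels G'"
  proof clarify
    fix a j assume "(a, j) \<in> set v"
    then have a: "a \<in> set (proj j v)" by (force simp: proj_def)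
    moreover have "proj j v \<in> traces G' \<union> {[]}" using v(1) by (auto simp: interleavings_def)
    ultimately have "proj j v \<in> traces G'" by auto
    then show "fst (a, j) \<in> labels G'" using a traces_labels by fastforce
  qed
  from atomic_contiguous[OF v(2) this H False proj]
  obtain R S where "w' = R @ index i c @ S" "proj i R = r" by blast
  then show ?thesis using contiguous_between[OF \<sigma> _ p(1,2) _ q(1,2) _ z] p(3) q(3) by blast
qed

text \<open>The action of the block lies on a trace of the fused graph, and the other actions of
  that trace can be refined because no block has an empty set of traces.\<close>

lemma block_extends:
  assumes "(\<beta>, H) \<in> set (blocks F)" "t \<in> traces H"
  obtains r s where "r @ t @ s \<in> traces G"
proof -
  have "\<beta> \<in> labels G'" using assms(1) block_actions by (force simp: block_actions_def)
  then obtain r' s' where rs': "r' @ \<beta> # s' \<in> traces G'" using edge_trace[OF cfg_fused] by blast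
  obtain r s where "r \<in> morph_word \<mu> r'" "s \<in> morph_word \<mu> s'" using morph_word_nonempty by blast
  moreover have "r @ v \<in> morph_word \<mu> (r' @ x)" if "r \<in> morph_word \<mu> r'" "v \<in> morph_word \<mu> x" for r v r' x
    using that by (induction r' arbitrary: r) fastforce+
  moreover have "t @ s \<in> morph_word \<mu> (\<beta> # s')"
    using assms morph_block \<open>s \<in> morph_word \<mu> s'\<close> by auto
  ultimately have "r @ t @ s \<in> morph_word \<mu> (r' @ \<beta> # s')" by blast
  then show thesis using that rs' unfolding traces_G morph_lang_def by blast
qed

text \<open>A step from position \<open>kx\<close> to \<open>ky\<close> of a thread in a chain: either along program order, or
  possibly backwards within one atomic block.\<close>

definition serves :: "'a list \<Rightarrow> nat \<Rightarrow> nat \<Rightarrow> bool" where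
  "serves t kx ky \<longleftrightarrow> kx < length t \<and> ky < length t \<and> (kx \<le> ky \<or>
     (\<exists>\<beta> H l c m r s. (\<beta>, H) \<in> set (blocks F) \<and> path H l c m \<and> t = r @ c @ s \<and>
        length r \<le> ky \<and> kx < length r + length c))"

lemma PA_serves:
  assumes "(x, y) \<in> PA"
  obtains t kx ky where "t \<in> traces G" "serves t kx ky" "t ! kx = x" "t ! ky = y"
  using assms
proof
  assume "(x, y) \<in> po G"
  then obtain r u s where u: "r @ u @ s \<in> traces G" "u \<noteq> []" "hd u = x" "last u = y"
    by (auto simp: po_def)
  have "(r @ u @ s) ! length r = x" "(r @ u @ s) ! (length r + (length u - 1)) = y"
    using u(2-4) by (auto simp: nth_append hd_conv_nth last_conv_nth)
  moreover have "serves (r @ u @ s) (length r) (length r + (length u - 1))"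
    using u(2) by (cases u) (auto simp: serves_def)
  ultimately show thesis using that u(1) by blast
next
  assume "(x, y) \<in> atomic_rel F"
  then obtain \<beta> H r u s where H: "(\<beta>, H) \<in> set (blocks F)" "r @ [y] @ u @ [x] @ s \<in> traces H"
    by (auto simp: atomic_rel_def)
  let ?c = "r @ y # u @ x # s"
  have "?c \<in> traces H" using H(2) by simp
  then obtain r' s' where t: "r' @ ?c @ s' \<in> traces G" using block_extends[OF H(1)] by blast
  have "path H (init H) ?c (exit H)" using H(2) by (simp add: traces_def)
  \<comment> \<open>The first component of a pair in \<open>atomic_rel\<close> is the later one in
    the block, so \<open>kx\<close> is the larger position; the \<open>1\<close> steps over
    \<open>y\<close>.\<close>
  then have "serves (r' @ ?c @ s') (length r' + length r + 1 + length u) (length r' + length r)"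
    unfolding serves_def using H(1)
    by (intro conjI disjI2 exI[of _ \<beta>] exI[of _ H] exI[of _ "init H"] exI[of _ ?c]
        exI[of _ "exit H"] exI[of _ r'] exI[of _ s']) simp_all
  moreover have "(r' @ ?c @ s') ! (length r' + length r) = y"
    "(r' @ ?c @ s') ! (length r' + length r + 1 + length u) = x"
    by (simp_all add: nth_append)
  ultimately show thesis using that t by blast
qed

text \<open>If \<open>ky\<close> precedes \<open>kx\<close> in a block, then no event of another thread fits between the two, so that
  whatever is executed before \<open>kx\<close> is also executed before \<open>ky\<close>.\<close>

lemma serves_order:
  assumes "atomic w'" and \<sigma>: "reordering I w w' \<sigma>" and proj: "proj j w' = t"
    and w: "w = u @ index j t @ v" "proj j u = []"
    and q: "q < length w" "snd (w ! q) \<noteq> j"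
    and st: "serves t kx ky" and less: "\<sigma> q < \<sigma> (length u + kx)"
  shows "\<sigma> q < \<sigma> (length u + ky)"
proof -
  let ?x = "length u + kx" and ?y = "length u + ky"
  have k: "kx < length t" "ky < length t" using st by (auto simp: serves_def)
  have thr: "snd (w ! (length u + k)) = j" if "k < length t" for k
    using that by (simp add: w(1) nth_append index_def)
  \<comment> \<open>Thread \<open>j\<close> has no event in \<open>u\<close>, so positions in
    \<open>t\<close> are numbers of events of \<open>j\<close>.\<close>
  have cnt: "length (proj j (take (length u + k) w)) = k" if "k < length t" for k
  proof -
    have "take (length u + k) w = u @ index j (take k t)"
      using that by (simp add: w(1) index_def take_map)
    then show ?thesis using w(2) that by simp
  qed
  have len: "?x < length w" "?y < length w" using k w(1) by auto
  consider "kx = ky" | "kx < ky" | "ky < kx" by linarith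
  then show ?thesis
  proof cases
    case 1
    then show ?thesis using less by simp
  next
    case 2
    then have "\<sigma> ?x < \<sigma> ?y" by (intro reordering_thread[OF \<sigma>]) (use thr k len in auto)
    then show ?thesis using less by simp
  next
    case 3
    then obtain \<beta> H l c m r s where H: "(\<beta>, H) \<in> set (blocks F)" "path H l c m" "t = r @ c @ s"
      "length r \<le> ky" "kx < length r + length c" using st by (auto simp: serves_def)
    show ?thesis
    proof (rule ccontr)
      assume "\<not> \<sigma> q < \<sigma> ?y"
      moreover have "\<sigma> q \<noteq> \<sigma> ?y"
        using reordering_neq[OF \<sigma> q(1) len(2)] q(2) thr[OF k(2)] by auto
      ultimately have "snd (w' ! \<sigma> q) = j"
        by (intro atomic_between[OF assms(1) \<sigma> proj[unfolded H(3)] H(1,2) len(2) _ _ len(1)])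
          (use thr k cnt H less in auto)
      then show False using reordering_nth[OF \<sigma> q(1)] q(2) by simp
    qed
  qed
qed

text \<open>The inserted threads \<open>M\<close> run one after the other, between a prefix \<open>p0\<close> and the rest of
  thread \<open>0\<close>. An atomic reordering keeps the last event of \<open>p0\<close> before the first event of the
  chain, hence moves all of the block of thread \<open>0\<close> before it, and so on along the chain.\<close>

definition forced :: "('a \<times> 'a) set \<Rightarrow> 'a list \<Rightarrow> ('a \<times> nat) list \<Rightarrow> nat \<Rightarrow> bool" where
  "forced I p0 M m \<longleftrightarrow> (\<forall>S w w' \<sigma> q. w = index 0 p0 @ M @ S \<longrightarrow> atomic w' \<longrightarrow>
     reordering I w w' \<sigma> \<longrightarrow> (\<forall>i. proj i w' = proj i w) \<longrightarrow> snd ` set M \<inter> snd ` set S = {} \<longrightarrow>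
     q < length w \<longrightarrow> snd (w ! q) = 0 \<longrightarrow>
     (\<forall>z. \<sigma> (length p0 - 1) < z \<longrightarrow> z < \<sigma> q \<longrightarrow> snd (w' ! z) = 0) \<longrightarrow>
     \<sigma> q < \<sigma> (length p0 + m))"

text \<open>Each link becomes a thread whose trace contains both ends of the link.
  \<open>forced\<close> leaves the rest \<open>S\<close> open because the next link is appended to
  \<open>M\<close>.\<close>

lemma chain_word:
  assumes "(a, b) \<in> inner_arrow G I F" and p0: "p0 \<noteq> []" "(last p0, a) \<notin> I"
  shows "\<exists>M m. proj 0 M = [] \<and> (\<forall>i. proj i M \<in> traces G \<union> {[]}) \<and> m < length M \<and>
    fst (M ! m) = b \<and> forced I p0 M m"
proof -
  have proj_Nil: "proj j M = []" if "j \<notin> snd ` set M" for j and M :: "('a \<times> nat) list"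
    using that by (auto simp: proj_def filter_empty_conv)
  have notin: "j \<notin> snd ` set M" if "proj j M = []" for j and M :: "('a \<times> nat) list"
    using that by (auto simp: proj_def filter_empty_conv)
  obtain c where "(a, c) \<in> PA" "(c, b) \<in> (dependence G I O PA)\<^sup>*"
    using assms(1) unfolding inner_arrow_def by blast
  from this(2) show ?thesis
  proof (induction rule: rtrancl_induct)
    case base
    obtain t kx ky where t: "t \<in> traces G" "serves t kx ky" "t ! kx = a" "t ! ky = c"
      using PA_serves[OF \<open>(a, c) \<in> PA\<close>] .
    have k: "kx < length t" "ky < length t" using t(2) by (auto simp: serves_def)
    show ?case
    proof (intro exI[of _ "index 1 t"] exI[of _ ky] conjI)
      show "forced I p0 (index 1 t) ky"
        unfolding forced_def
      proof (intro allI impI)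
        fix S w w' \<sigma> q
        assume w: "w = index 0 p0 @ index 1 t @ S" and w': "atomic w'" and \<sigma>: "reordering I w w' \<sigma>"
          and proj: "\<forall>i. proj i w' = proj i w"
          and fresh: "snd ` set (index 1 t) \<inter> snd ` set S = {}"
          and q: "q < length w" "snd (w ! q) = 0"
          and block: "\<forall>z. \<sigma> (length p0 - 1) < z \<longrightarrow> z < \<sigma> q \<longrightarrow> snd (w' ! z) = 0"
        let ?x = "length p0 + kx"
        have x: "?x < length w" "w ! ?x = (a, 1)"
          using k t(3) by (auto simp: w nth_append index_def)
        have "w ! (length p0 - 1) = (last p0, 0)"
          using p0(1) by (simp add: w nth_append index_def last_conv_nth)
        then have "\<not> indep I (w ! (length p0 - 1)) (w ! ?x)" using x p0(2) by (simp add: indep_def)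
        moreover have "length p0 - 1 < ?x" using p0(1) by (cases p0) auto
        ultimately have "\<sigma> (length p0 - 1) < \<sigma> ?x" using x(1) by (intro reordering_dep[OF \<sigma>])
        moreover have "\<sigma> q \<noteq> \<sigma> ?x" using reordering_neq[OF \<sigma> q(1) x(1)] q(2) x(2) by (cases "q = ?x") auto
        moreover have "snd (w' ! \<sigma> ?x) \<noteq> 0" using reordering_nth[OF \<sigma> x(1)] x(2) by simp
        \<comment> \<open>Only thread \<open>0\<close> runs between the images of the end of
          \<open>p0\<close> and of \<open>q\<close>; an event of another thread behind the former is
          behind the latter.\<close>
        ultimately have "\<sigma> q < \<sigma> ?x" using block by (meson linorder_neqE_nat)
        moreover have "proj 1 S = []"
        proof (rule proj_Nil)
          have "1 \<in> snd ` set (index 1 t)" using k by (cases t) auto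
          then show "1 \<notin> snd ` set S" using fresh by blast
        qed
        ultimately show "\<sigma> q < \<sigma> (length p0 + ky)"
          using serves_order[OF w' \<sigma>, of 1 t "index 0 p0" S q kx ky] proj w q t(2) by simp
      qed
    qed (use t k in \<open>auto simp: nth_index\<close>)
  next
    case (step y z)
    then obtain M m where M: "proj 0 M = []" "\<And>i. proj i M \<in> traces G \<union> {[]}" "m < length M"
      "fst (M ! m) = y" "forced I p0 M m" by blast
    obtain x where x: "(y, x) \<in> dependence G I" "(x, z) \<in> PA" using step.hyps(2) by blast
    obtain t kx ky where t: "t \<in> traces G" "serves t kx ky" "t ! kx = x" "t ! ky = z"
      using PA_serves[OF x(2)] .
    have k: "kx < length t" "ky < length t" using t(2) by (auto simp: serves_def)
    obtain j where "j \<notin> insert 0 (snd ` set M)"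
      using ex_new_if_finite[OF infinite_UNIV_nat] by (metis finite_imageI finite_insert finite_set)
    then have j: "j \<noteq> 0" "proj j M = []" "j \<notin> snd ` set M" using proj_Nil by auto
    have "forced I p0 (M @ index j t) (length M + ky)"
      unfolding forced_def
    proof (intro allI impI)
      fix S w w' \<sigma> q
      assume w: "w = index 0 p0 @ (M @ index j t) @ S" and w': "atomic w'"
        and \<sigma>: "reordering I w w' \<sigma>" and proj: "\<forall>i. proj i w' = proj i w"
        and fresh: "snd ` set (M @ index j t) \<inter> snd ` set S = {}"
        and q: "q < length w" "snd (w ! q) = 0"
        and block: "\<forall>z. \<sigma> (length p0 - 1) < z \<longrightarrow> z < \<sigma> q \<longrightarrow> snd (w' ! z) = 0"
      have "snd ` set (index j t) \<subseteq> {j}" by (auto simp: index_def)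
      then have "snd ` set M \<inter> snd ` set (index j t @ S) = {}"
        using fresh j(3) \<open>snd ` set (index j t) \<subseteq> {j}\<close>
        unfolding set_append image_Un by blast
      moreover have "w = index 0 p0 @ M @ index j t @ S" using w by simp
      ultimately have 1: "\<sigma> q < \<sigma> (length p0 + m)"
        using M(5) w' \<sigma> proj q block unfolding forced_def by blast
      let ?x = "length p0 + length M + kx"
      have "?x < length w" "w ! ?x = (x, j)" "w ! (length p0 + m) = M ! m"
        using k t(3) M(3) by (auto simp: w nth_append index_def)
      moreover have "(y, x) \<notin> I" using x(1) by (auto simp: dependence_def)
      \<comment> \<open>The end of the chain so far and the start of the new link conflict in the
        order in which \<open>w\<close> has them.\<close>
      ultimately have 2: "\<sigma> (length p0 + m) < \<sigma> ?x"
        using M(3,4) by (intro reordering_dep[OF \<sigma>]) (auto simp: indep_def)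
      have "proj j S = []"
      proof (rule proj_Nil)
        have "j \<in> snd ` set (index j t)" using k by (cases t) auto
        then show "j \<notin> snd ` set S" using fresh by auto
      qed
      then show "\<sigma> q < \<sigma> (length p0 + (length M + ky))"
        using serves_order[OF w' \<sigma>, of j t "index 0 p0 @ M" S q kx ky] proj w q t(2) j 1 2
        by (simp add: add.assoc)
    qed
    then show ?case
      using M(1,2) j t k
      by (intro exI[of _ "M @ index j t"] exI[of _ "length M + ky"]) (auto simp: nth_index nth_append)
  qed
qed

text \<open>In \<open>w\<close> the end of the chain precedes the event of \<open>f\<close> and
  conflicts with it, so reorderings keep this order; \<open>forced\<close> demands the opposite of
  an atomic one.\<close>

lemma breaking_chain_unsound:
  assumes "breaking_chain I"
  shows "\<not> sound_fusion G I F"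
proof
  assume sound: "sound_fusion G I F"
  obtain \<beta> H e f a b where H: "(\<beta>, H) \<in> set (blocks F)" "(e, f) \<in> (edge_succ H)\<^sup>+"
    and ab: "(a, b) \<in> inner_arrow G I F" "(lab e, a) \<notin> I" "(b, lab f) \<notin> I"
    using assms unfolding breaking_chain_def by blast
  obtain r u s where c: "r @ lab e # u @ lab f # s \<in> traces H"
    using trancl_trace[OF block_cfg(1)[OF H(1)] H(2)] .
  let ?c = "r @ lab e # u @ lab f # s"
  obtain r' s' where t: "r' @ ?c @ s' \<in> traces G" using block_extends[OF H(1) c] .
  \<comment> \<open>\<open>p0\<close> ends with an occurrence of \<open>e\<close> and
    \<open>s0\<close> continues right after it, so the chain is executed inside the block.\<close>
  define p0 where "p0 = r' @ r @ [lab e]"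
  define s0 where "s0 = u @ lab f # s @ s'"
  have p0: "p0 \<noteq> []" "last p0 = lab e" by (auto simp: p0_def)
  have t': "p0 @ s0 = r' @ ?c @ s'" by (simp add: p0_def s0_def)
  obtain M m where M: "proj 0 M = []" "\<And>i. proj i M \<in> traces G \<union> {[]}" "m < length M"
    "fst (M ! m) = b" "forced I p0 M m"
    using chain_word[OF ab(1) p0(1)] ab(2) p0(2) by auto
  define w where "w = index 0 p0 @ M @ index 0 s0"
  have "proj i w = (if i = 0 then p0 @ s0 else proj i M)" for i using M(1) by (simp add: w_def)
  then have "w \<in> interleavings G" using M(2) t t' by (simp add: interleavings_def)
  then obtain w' where w': "atomic w'" "reorder_le I w w'"
    using sound unfolding sound_fusion_def mazurkiewicz_reduction_def atomic_def by blast
  obtain \<sigma> where \<sigma>: "reordering I w w' \<sigma>" using reorder_le_reordering[OF w'(2)] by blast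
  have proj: "proj i w' = proj i w" for i using reorder_le_proj[OF w'(2)] .
  define q where "q = length p0 + length M + length u"
  have q: "q < length w" "w ! q = (lab f, 0)"
    by (auto simp: q_def w_def s0_def nth_append index_def)
  have p: "length p0 - 1 < length w" "w ! (length p0 - 1) = (lab e, 0)"
    by (auto simp: p0_def w_def nth_append index_def)
  have "take (length p0 - 1) w = index 0 (r' @ r)" by (simp add: w_def p0_def)
  then have count_p: "length (proj 0 (take (length p0 - 1) w)) = length r' + length r" by simp
  have "take q w = index 0 p0 @ M @ index 0 u" by (simp add: w_def q_def s0_def index_def)
  then have count_q: "length (proj 0 (take q w)) = length r' + length r + 1 + length u"
    using M(1) by (simp add: p0_def)
  have proj0: "proj 0 w' = r' @ ?c @ s'" using proj[of 0] M(1) t' by (simp add: w_def)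
  have path: "path H (init H) ?c (exit H)" using c by (simp add: traces_def)
  have "snd (w' ! z) = 0" if "\<sigma> (length p0 - 1) < z" "z < \<sigma> q" for z
    by (rule atomic_between[OF w'(1) \<sigma> proj0 H(1) path p(1) _ _ q(1) _ _ that])
      (use p q in \<open>simp_all add: count_p[unfolded One_nat_def] count_q\<close>)
  moreover have "snd ` set M \<inter> snd ` set (index 0 s0) = {}"
    using M(1) by (auto simp: index_def proj_def filter_empty_conv)
  ultimately have "\<sigma> q < \<sigma> (length p0 + m)"
    using M(5) w'(1) \<sigma> proj q unfolding forced_def w_def by auto
  moreover have "\<sigma> (length p0 + m) < \<sigma> q"
    using M(3,4) ab(3) q by (intro reordering_dep[OF \<sigma>]) (auto simp: indep_def w_def nth_append q_def)
  ultimately show False by simp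
qed

lemma sound_iff: "sound_fusion G I F \<longleftrightarrow> \<not> breaking_chain I"
  using breaking_chain_unsound no_breaking_chain_sound by blast

end

section \<open>Comparison of the two graphs of step 1\<close>

lemma arrow_subset_inner_arrow:
  assumes "is_cfg G"
  shows "arrow G I F \<subseteq> inner_arrow G I F"
proof
  let ?P = "po G \<union> atomic_rel F" and ?D = "dependence G I"
  fix x assume "x \<in> arrow G I F"
  then obtain a a' b b' where x: "x = (a, b)" "(a, a') \<in> ?D" "(a', b') \<in> inner_arrow G I F" "(b', b) \<in> ?D"
    unfolding arrow_eq by blast
  then obtain c where c: "(a', c) \<in> ?P" "(c, b') \<in> (?D O ?P)\<^sup>*" unfolding inner_arrow_def by blast
  \<comment> \<open>Reflexivity of program order lets a chain begin and end at the outer ends of the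
    two stripped dependences.\<close>
  have refl: "(d, d) \<in> ?P" if "d \<in> labels G" for d using that by (auto simp: po_eq[OF assms])
  have "a \<in> labels G" "b \<in> labels G" using x(2,4) by (auto simp: dependence_def)
  then have "(a, a) \<in> ?P" "(b, b) \<in> ?P" using refl by blast+
  moreover have "(a, b) \<in> (?D O ?P)\<^sup>*"
  proof -
    have "(a, c) \<in> ?D O ?P" "(b', b) \<in> ?D O ?P" using x(2,4) c(1) \<open>(b, b) \<in> ?P\<close> by blast+
    then show ?thesis using c(2)
      by (meson converse_rtrancl_into_rtrancl rtrancl.rtrancl_into_rtrancl)
  qed
  ultimately show "x \<in> inner_arrow G I F" unfolding x(1) inner_arrow_def by blast
qed

context fusion
begin

lemma declared_unsound_inner_arrow_iff: "declared_unsound (inner_arrow G I F) I F \<longleftrightarrow> breaking_chain I"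
  unfolding declared_unsound_iff[OF blocks_cfg] breaking_chain_def ..

text \<open>The test is monotone in the graph of step 1. Hence the version with \<open>arrow\<close>
  never rejects a sound fusion, even if \<open>I\<close> is asymmetric.\<close>

lemma declared_unsound_arrow_inner_arrow:
  "declared_unsound (arrow G I F) I F \<Longrightarrow> declared_unsound (inner_arrow G I F) I F"
  using arrow_subset_inner_arrow[OF cfg, of I F] unfolding declared_unsound_def by blast

text \<open>If \<open>I\<close> is symmetric, then a chain \<open>e D a \<rightarrow> b D f\<close> can be prolonged at both ends
  by going back and forth: \<open>a D e D a \<rightarrow> b D f D b\<close>.\<close>

lemma declared_unsound_arrow_sym:
  assumes "sym I" "declared_unsound (inner_arrow G I F) I F"
  shows "declared_unsound (arrow G I F) I F"
proof -
  let ?D = "dependence G I"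
  obtain \<beta> H e f a b where H: "(\<beta>, H) \<in> set (blocks F)" "(e, f) \<in> (edge_succ H)\<^sup>+"
    and ab: "(a, b) \<in> inner_arrow G I F" "(lab e, a) \<notin> I" "(b, lab f) \<notin> I"
    using assms(2) unfolding declared_unsound_inner_arrow_iff breaking_chain_def by blast
  have labels: "lab e \<in> labels G" "lab f \<in> labels G" "a \<in> labels G" "b \<in> labels G"
  proof -
    have "e \<in> edges H" "f \<in> edges H" using H(2) unfolding edge_succ_trancl_iff by blast+
    then show "lab e \<in> labels G" "lab f \<in> labels G" using lab_in_labels block_cfg(3)[OF H(1)] by blast+
    show "a \<in> labels G" "b \<in> labels G" using ab(1) inner_arrow_labels by blast+
  qed
  have D: "(lab e, a) \<in> ?D" "(a, lab e) \<in> ?D" "(b, lab f) \<in> ?D" "(lab f, b) \<in> ?D"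
    using labels ab(2,3) assms(1) by (auto simp: dependence_def dest: symD)
  obtain c where c: "(a, c) \<in> PA" "(c, b) \<in> (?D O PA)\<^sup>*"
    using ab(1) unfolding inner_arrow_def by blast
  have refl: "(lab e, lab e) \<in> PA" "(lab f, lab f) \<in> PA" using labels by (auto simp: po_eq[OF cfg])
  have "(lab e, c) \<in> ?D O PA" "(b, lab f) \<in> ?D O PA" using D c(1) refl by blast+
  then have "(lab e, lab f) \<in> (?D O PA)\<^sup>*"
    using c(2) by (meson converse_rtrancl_into_rtrancl rtrancl.rtrancl_into_rtrancl)
  then have "(lab e, lab f) \<in> inner_arrow G I F" using refl(1) unfolding inner_arrow_def by blast
  then have "(a, b) \<in> arrow G I F" unfolding arrow_eq using D by blast
  then show ?thesis using H ab(2,3) unfolding declared_unsound_iff[OF blocks_cfg] by blast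
qed

end

theorem theorem4p5:
  assumes "infinite (UNIV :: 'a set)"
  shows "\<exists>p :: nat poly.
    \<forall>(g :: ('l, 'a) cfg_rep) (is :: ('a \<times> 'a) list) (f :: ('l, 'a) fusion_rep) G I F.
      G = cfg_of g \<and> I = set is \<and> F = fusion_of f \<and>
      is_cfg G \<and> I \<subseteq> labels G \<times> labels G \<and> atomic_fusion F G \<longrightarrow>
        (val (decide_inner_arrow g is f) \<longleftrightarrow> sound_fusion G I F) \<and>
        (val (decide_inner_arrow g is f) \<longleftrightarrow> \<not> declared_unsound (inner_arrow G I F) I F) \<and>
        steps (decide_inner_arrow g is f) \<le> poly p (input_size g is f) \<and>
        (sym I \<longrightarrow> (val (decide_arrow g is f) \<longleftrightarrow> sound_fusion G I F)) \<and>
        (sound_fusion G I F \<longrightarrow> val (decide_arrow g is f)) \<and>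
        (val (decide_arrow g is f) \<longleftrightarrow> \<not> declared_unsound (arrow G I F) I F) \<and>
        steps (decide_arrow g is f) \<le> poly p (input_size g is f)"
proof -
  obtain p :: "nat poly" where p: "\<forall>(g :: ('l, 'a) cfg_rep) is (f :: ('l, 'a) fusion_rep).
      steps (decide_inner_arrow g is f) \<le> poly p (input_size g is f) \<and>
      steps (decide_arrow g is f) \<le> poly p (input_size g is f)"
    using polynomial_time by blast
  show ?thesis
  proof (intro exI[of _ p] allI impI; elim conjE)
    fix g :: "('l, 'a) cfg_rep" and "is" :: "('a \<times> 'a) list" and f :: "('l, 'a) fusion_rep"
      and G I F
    assume G: "G = cfg_of g" and I: "I = set is" and F: "F = fusion_of f"
      and "is_cfg G" "atomic_fusion F G"
    interpret fusion G F by unfold_locales fact+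
    note cfgs = cfg[unfolded G] blocks_cfg[unfolded F]
    have inner: "val (decide_inner_arrow g is f) \<longleftrightarrow> \<not> declared_unsound (inner_arrow G I F) I F"
      using val_check_blocks_t[of "val (inner_arrow_t g is f)" g "is" f]
        inner_arrow_labels[of I] set_inner_arrow_t[OF cfgs, of "is"]
      unfolding decide_inner_arrow_def val_bind G I F by simp
    \<comment> \<open>The lookup tables cover the labels of \<open>G\<close> only, so the computed
      pairs have to lie among these.\<close>
    have "arrow G I F \<subseteq> labels G \<times> labels G"
      using arrow_subset_inner_arrow[OF cfg] inner_arrow_labels by blast
    then have outer: "val (decide_arrow g is f) \<longleftrightarrow> \<not> declared_unsound (arrow G I F) I F"
      using val_check_blocks_t[of "val (arrow_t g is f)" g "is" f] set_arrow_t[OF cfgs, of "is"]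
      unfolding decide_arrow_def val_bind G I F by simp
    have sound: "sound_fusion G I F \<longleftrightarrow> \<not> declared_unsound (inner_arrow G I F) I F"
      unfolding declared_unsound_inner_arrow_iff by (rule sound_iff)
    show "(val (decide_inner_arrow g is f) \<longleftrightarrow> sound_fusion G I F) \<and>
        (val (decide_inner_arrow g is f) \<longleftrightarrow> \<not> declared_unsound (inner_arrow G I F) I F) \<and>
        steps (decide_inner_arrow g is f) \<le> poly p (input_size g is f) \<and>
        (sym I \<longrightarrow> (val (decide_arrow g is f) \<longleftrightarrow> sound_fusion G I F)) \<and>
        (sound_fusion G I F \<longrightarrow> val (decide_arrow g is f)) \<and>
        (val (decide_arrow g is f) \<longleftrightarrow> \<not> declared_unsound (arrow G I F) I F) \<and>
        steps (decide_arrow g is f) \<le> poly p (input_size g is f)"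
      using inner outer sound p declared_unsound_arrow_inner_arrow declared_unsound_arrow_sym
      by blast
  qed
qed

end
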